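(* Let $V_0,\dots,V_p$ and $W_0,\dots,W_q$ be complex vector spaces with $\dim V_i=k_i+1$, $\dim W_j=l_j+1$ and $W_0^\vee\simeq V_p$ (so $l_0=k_p$). Let $A\in V_0\otimes\dots\otimes V_p$ and $B\in W_0\otimes\dots\otimes W_q$ be nondegenerate matrices of boundary format, i.e. with $k_0=\sum_{i=1}^p k_i$ and $l_0=\sum_{j=1}^q l_j$. Then the convolution $A\ast B\in V_0\otimes\dots\otimes V_{p-1}\otimes W_1\otimes\dots\otimes W_q$ is also nondegenerate, and $$\mathrm{Det}(A\ast B)=(\mathrm{Det}\,A)^{\binom{l_0}{l_1,\dots,l_q}}\,(\mathrm{Det}\,B)^{\binom{k_0+1}{k_1,\dots,k_{p-1},k_p+1}},$$ where $\mathrm{Det}$ denotes the hyperdeterminant of boundary format matrices and $\binom{n}{n_1,\dots,n_r}=\frac{n!}{n_1!\cdots n_r!}$ (with $n=n_1+\dots+n_r$) is the multinomial coefficient.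
   Context: Boundary format. Let $V_0,\dots,V_p$ be complex vector spaces with $\dim V_i=k_i+1$. An element $A\in V_0\otimes\dots\otimes V_p$ is called a (multidimensional) matrix of format $(k_0+1)\times\dots\times(k_p+1)$; it is of boundary format if $k_0=\sum_{i=1}^p k_i$. Nondegeneracy. Regard $A\in V_0\otimes\dots\otimes V_p$ as a linear map $A:V_1^\vee\otimes\dots\otimes V_p^\vee\to V_0$. $A$ is degenerate if there are nonzero $v_i\in V_i^\vee$, $i=1,\dots,p$, with $A(v_1\otimes\dots\otimes v_p)=0$; otherwise it is nondegenerate. Convolution. Write $A=(a_{i_0,\dots,i_p})$ and $B=(b_{j_0,\dots,j_q})$ in coordinates, with $0\le i_r\le k_r$, $0\le j_r\le l_r$, $k_p=l_0$, and with the bases of $V_p$ and $W_0$ dual to each other under $W_0^\vee\simeq V_p$. Then $A\ast B$ is the matrix with entries $c_{i_0,\dots,i_{p-1},j_1,\dots,j_q}=\sum_{h=0}^{k_p}a_{i_0,\dots,i_{p-1},h}\,b_{h,j_1,\dots,j_q}$. The convolution of boundary format matrices is again of boundary format, with $V_0$ as the factor in position $0$. Hyperdeterminant. Let $A\in V_0\otimes\dots\otimes V_p$ be of boundary format and set $m_j=\sum_{i=1}^{j-1}k_i$ for $j=1,\dots,p$ (so $m_1=0$). Viewing $A$ as a map $V_0^\vee\to V_1\otimes\dots\otimes V_p$ and multiplying in the symmetric algebras of $V_1,\dots,V_p$ gives the natural linear map $$\partial_A: V_0^\vee\otimes S^{m_1}V_1\otimes\dots\otimes S^{m_p}V_p\to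 S^{m_1+1}V_1\otimes\dots\otimes S^{m_p+1}V_p$$ between spaces of the same dimension $N=\frac{(k_0+1)!}{k_1!\cdots k_p!}$. The hyperdeterminant is the usual determinant $\mathrm{Det}(A):=\det\partial_A$. Here, for a vector space $V$ of dimension $n$, $\det V:=\wedge^nV$, and a linear map $\Phi:V\to W$ between spaces of the same dimension has determinant $\det\Phi\in\mathrm{Hom}(\det V,\det W)$. Using the canonical isomorphisms $\det(E\otimes F)\simeq(\det E)^{\otimes f}\otimes(\det F)^{\otimes e}$ and $\det(S^kE)\simeq(\det E)^{\otimes\binom{e+k-1}{e}}$ (where $e=\dim E$, $f=\dim F$), $\mathrm{Det}$ is a $GL(V_0)\times\dots\times GL(V_p)$-equivariant function $V_0\otimes\dots\otimes V_p\to\bigotimes_{i=0}^p(\det V_i)^{\otimes N/(k_i+1)}$. The determinant of $\partial_A$ is taken to be the same for every ordering of $V_1,\dots,V_p$ (different orderings give different $m_j$ and different maps $\partial_A$). *)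

theory Defs
  imports "Jordan_Normal_Form.Determinant"
begin

text \<open>
  A format $(k_0+1)\times\dots\times(k_p+1)$ is given by the list \<open>k = [k\<^sub>0, \<dots>, k\<^sub>p]\<close>, and an
  element of $V_0\otimes\dots\otimes V_p$ by its coordinates \<open>A [i\<^sub>0, \<dots>, i\<^sub>p]\<close> in fixed bases,
  that is, $V_r = \mathbb{C}^{k_r+1}$ with its standard basis. Values of \<open>A\<close> outside \<open>indices k\<close>
  play no role.
\<close>

type_synonym multimat = "nat list \<Rightarrow> complex"

definition indices :: "nat list \<Rightarrow> nat list set" where
  "indices k = {is. length is = length k \<and> (\<forall>r<length k. is ! r \<le> k ! r)}"

definition boundary_format :: "nat list \<Rightarrow> bool" where
  "boundary_format k \<longleftrightarrow> k \<noteq> [] \<and> k ! 0 = sum_list (tl k)"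

text \<open>
  \<open>apply_map k A vs i0\<close> is the coordinate \<open>i0\<close> of \<open>A(v\<^sub>1 \<otimes> \<dots> \<otimes> v\<^sub>p)\<close>, where \<open>vs = [v\<^sub>1, \<dots>, v\<^sub>p]\<close>
  are vectors of $V_1^\vee,\dots,V_p^\vee$ in the dual bases.
\<close>

definition apply_map :: "nat list \<Rightarrow> multimat \<Rightarrow> complex vec list \<Rightarrow> nat \<Rightarrow> complex" where
  "apply_map k A vs i0 =
     (\<Sum>is \<in> indices (tl k). A (i0 # is) * (\<Prod>r<length (tl k). vs ! r $ (is ! r)))"

definition degenerate :: "nat list \<Rightarrow> multimat \<Rightarrow> bool" where
  "degenerate k A \<longleftrightarrow>
     (\<exists>vs. length vs = length (tl k) \<and>
           (\<forall>r<length (tl k). vs ! r \<in> carrier_vec (tl k ! r + 1) \<and>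
                              vs ! r \<noteq> 0\<^sub>v (tl k ! r + 1)) \<and>
           (\<forall>i0\<le>k ! 0. apply_map k A vs i0 = 0))"

abbreviation nondegenerate :: "nat list \<Rightarrow> multimat \<Rightarrow> bool" where
  "nondegenerate k A \<equiv> \<not> degenerate k A"

text \<open>
  In \<open>conv k A B\<close> the list \<open>k\<close> is the format of \<open>A\<close>; an index list of the result is
  \<open>[i\<^sub>0, \<dots>, i\<^sub>p\<^sub>-\<^sub>1, j\<^sub>1, \<dots>, j\<^sub>q]\<close>, with \<open>p = length k - 1\<close>.
\<close>

definition conv_format :: "nat list \<Rightarrow> nat list \<Rightarrow> nat list" where
  "conv_format k l = butlast k @ tl l"

definition conv :: "nat list \<Rightarrow> multimat \<Rightarrow> multimat \<Rightarrow> multimat" where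
  "conv k A B = (\<lambda>is. \<Sum>h\<le>last k. A (take (length k - 1) is @ [h]) * B (h # drop (length k - 1) is))"

text \<open>
  The exponent lists of the monomials of degree \<open>d\<close> in \<open>n\<close> variables, in decreasing lexicographic
  order. These monomials are the basis used for \<open>S\<^sup>d\<close> of an \<open>n\<close>-dimensional space, and lists of such
  exponent lists index the basis of a tensor product of symmetric powers.
\<close>

fun monomials :: "nat \<Rightarrow> nat \<Rightarrow> nat list list" where
  "monomials 0 d = (if d = 0 then [[]] else [])"
| "monomials (Suc n) d =
     concat (map (\<lambda>a. map (Cons a) (monomials n (d - a))) (rev [0..<Suc d]))"

definition sym_tensor_basis :: "nat list \<Rightarrow> nat list \<Rightarrow> nat list list list" where
  "sym_tensor_basis ks ds = product_lists (map2 (\<lambda>kj d. monomials (kj + 1) d) ks ds)"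

text \<open>For \<open>ks = [k\<^sub>1, \<dots>, k\<^sub>p]\<close> this is the list of the partial sums \<open>m\<^sub>1 = 0, m\<^sub>2 = k\<^sub>1, \<dots>, m\<^sub>p\<close>.\<close>

definition sym_degrees :: "nat list \<Rightarrow> nat list" where
  "sym_degrees ks = map (\<lambda>j. sum_list (take j ks)) [0..<length ks]"

definition source_basis :: "nat list \<Rightarrow> (nat \<times> nat list list) list" where
  "source_basis k = List.product [0..<k ! 0 + 1] (sym_tensor_basis (tl k) (sym_degrees (tl k)))"

definition target_basis :: "nat list \<Rightarrow> nat list list list" where
  "target_basis k = sym_tensor_basis (tl k) (map Suc (sym_degrees (tl k)))"

definition mul_vars :: "nat list list \<Rightarrow> nat list \<Rightarrow> nat list list" where
  "mul_vars \<alpha>s is = map2 (\<lambda>\<alpha> i. \<alpha>[i := Suc (\<alpha> ! i)]) \<alpha>s is"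

text \<open>
  The matrix of $\partial_A$ in the bases above:
  $\partial_A(e_{i_0}^\vee\otimes x_1^{\alpha_1}\otimes\dots\otimes x_p^{\alpha_p}) = \sum_{i_1,\dots,i_p}
  a_{i_0 i_1\dots i_p}\, x_{1,i_1}x_1^{\alpha_1}\otimes\dots\otimes x_{p,i_p}x_p^{\alpha_p}$.
\<close>

definition boundary_map :: "nat list \<Rightarrow> multimat \<Rightarrow> complex mat" where
  "boundary_map k A =
     mat (length (target_basis k)) (length (source_basis k))
       (\<lambda>(r, c). case source_basis k ! c of (i0, \<alpha>s) \<Rightarrow>
          \<Sum>is \<in> {is \<in> indices (tl k). mul_vars \<alpha>s is = target_basis k ! r}. A (i0 # is))"

text \<open>
  The isomorphisms $\det(E\otimes F)\simeq(\det E)^{\otimes f}\otimes(\det F)^{\otimes e}$ and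
  $\det(S^kE)\simeq(\det E)^{\otimes\binom{e+k-1}{e}}$ depend, up to sign, on how the product bases
  and the monomials are ordered, and so does $\det\partial_A$ as a number. For arbitrary choices of
  the orderings the sign would also depend on the ordering of $V_1,\dots,V_p$. The sign is fixed,
  once for each format, by giving the value 1 to the identity matrix of boundary format, whose
  entry is 1 if $i_0=i_1+\dots+i_p$ and 0 otherwise. This matrix, seen as a map, is
  the multiplication of polynomials in one variable of degrees at most $k_1,\dots,k_p$. It is thus
  nondegenerate over every field, so that the integer \<open>det (boundary_map k (identity_multimat))\<close>
  is 1 or -1, and the factor \<open>sgn\<close> below is this sign. The identity matrix is unchanged when
  $V_1,\dots,V_p$ are permuted, so the determinant becomes the same for all their orderings.
\<close>

definition identity_multimat :: multimat where
  "identity_multimat = (\<lambda>is. if hd is = sum_list (tl is) then 1 else 0)"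

definition hyperdet :: "nat list \<Rightarrow> multimat \<Rightarrow> complex" where
  "hyperdet k A = sgn (det (boundary_map k identity_multimat)) * det (boundary_map k A)"

text \<open>Used only when \<open>n = sum_list ns\<close>; the division is then exact.\<close>

definition multinomial :: "nat \<Rightarrow> nat list \<Rightarrow> nat" where
  "multinomial n ns = fact n div prod_list (map fact ns)"

end

theory Submission
  imports Defs "HOL-Library.Poly_Mapping" "HOL-Library.Function_Algebras"
begin

text \<open>
  Let \<open>B\<close> have format $l_0; l_1,\dots,l_q$ and let $g_0,\dots,g_{l_0}$ be the multilinear forms in
  variables $y_1,\dots,y_q$ that it defines. Write $n_j = l_1+\dots+l_{j-1}$ and let $T_{n+d}$ be the
  space of polynomials of degree $n_j+d$ in $y_j$ for all \<open>j\<close>. Then $\partial_B$ is the map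
  $e_h \otimes t \mapsto g_h t$ from $W_0^\vee \otimes T_n$ to $T_{n+1}$. It is the case $d = 1$ of
  $\Phi_d\colon S^d(W_0^\vee) \otimes T_n \to T_{n+d}$, $z^\gamma \otimes t \mapsto g^\gamma t$, whose
  source and target always have the same dimension.

  The forms of $A * B$ arise from those of \<open>A\<close> by substituting $g_h$ for the variables of $V_p$.
  Put $m = k_1+\dots+k_{p-1}$. The degrees that define $\partial_{A*B}$ are those of $\partial_A$ for
  $V_1,\dots,V_{p-1}$, and $m + n_j$ for $W_j$. Hence there is a commutative square
  \[ \partial_{A*B} \circ (\mathrm{id} \otimes \Phi_m) =
     (\mathrm{id} \otimes \Phi_{m+1}) \circ (\partial_A \otimes \mathrm{id}_{T_n}) \]
  (\<open>convolution_square\<close>). Taking determinants gives the power of $\det\partial_A$ at once, since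
  $\dim T_n = l_0!/\prod l_j!$. It remains to know $\det\Phi_d$ and the constants.

  The determinant of $\Phi_d$ is a constant times $(\det\partial_B)^{c_d}$ (\<open>pow_det_eq\<close>).
  Let \<open>B\<close> depend on a parameter, with derivatives $\delta g_h$ of the forms. Where $\partial_B$ is
  invertible there are endomorphisms $X_{jh}$ of $T_n$ with
  $(\delta g_h) t = \sum_j g_j X_{jh} t$. By the product rule the derivative of $\Phi_d$ is $\Phi_d$
  composed with $\sum_{h,j} z_j\partial_{z_h} \otimes X_{jh}$. The trace of $z_j\partial_{z_h}$ on $S^d$ is 0
  for $j \neq h$ and a number $c_d$ independent of \<open>h\<close> for $j = h$, with $c_1 = 1$. So the logarithmic
  derivative of $\det\Phi_d$ is $c_d$ times that of $\det\partial_B$.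

  The constants are found at the identity matrices, whose convolution is an identity matrix. Their
  forms are the coefficients of the product of generic polynomials of degrees $l_1,\dots,l_q$ in
  one variable. The Dedekind--Mertens lemma shows that $\partial$ is surjective over the integers
  for them (\<open>id_products_span\<close>), so its determinant is 1 or -1, and also that $\det\Phi_d \neq 0$ there,
  so that one may cancel. The result is an identity of polynomials in the entries of \<open>A\<close> and \<open>B\<close>.

  That $A * B$ is nondegenerate is seen directly: it is evaluated by inserting the vector
  $B(w_1 \otimes \dots \otimes w_q)$, which is nonzero, into the last argument of \<open>A\<close>.
\<close>

section \<open>Determinants with rows and columns indexed by lists\<close>

text \<open>Bases are indexed by lists of tuples, and their ordering is irrelevant for everything
  below except for signs. It is therefore convenient to name the entries of a matrix by basis
  elements and to let the two lists fix the ordering.\<close>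

definition list_det :: "'x list \<Rightarrow> 'y list \<Rightarrow> ('y \<Rightarrow> 'x \<Rightarrow> 'a::comm_ring_1) \<Rightarrow> 'a" where
  "list_det xs ys F = det (mat (length ys) (length xs) (\<lambda>(r, c). F (ys ! r) (xs ! c)))"

lemma list_det_cong:
  assumes "\<And>y x. y \<in> set ys \<Longrightarrow> x \<in> set xs \<Longrightarrow> F y x = G y x"
  shows "list_det xs ys F = list_det xs ys G"
proof -
  have "mat (length ys) (length xs) (\<lambda>(r, c). F (ys ! r) (xs ! c)) =
        mat (length ys) (length xs) (\<lambda>(r, c). G (ys ! r) (xs ! c))"
    using assms by (intro eq_matI) auto
  then show ?thesis by (simp add: list_det_def)
qed

lemma list_det_map:
  "list_det (map f xs) (map g ys) F = list_det xs ys (\<lambda>y x. F (g y) (f x))"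
proof -
  have "mat (length ys) (length xs) (\<lambda>(r, c). F (map g ys ! r) (map f xs ! c)) =
        mat (length ys) (length xs) (\<lambda>(r, c). F (g (ys ! r)) (f (xs ! c)))"
    by (intro eq_matI) auto
  then show ?thesis by (simp add: list_det_def)
qed

lemma sum_set_conv_nth:
  assumes "distinct xs"
  shows "(\<Sum>x\<in>set xs. f x) = (\<Sum>i<length xs. f (xs ! i))"
  using sum.distinct_set_conv_list[OF assms, of f]
  by (simp add: sum_list_sum_nth atLeast0LessThan)

lemma list_det_mult:
  assumes len: "length xs = length ys" "length zs = length ys" and "distinct ys"
  shows "list_det xs zs (\<lambda>z x. \<Sum>y\<in>set ys. F z y * G y x) = list_det ys zs F * list_det xs ys G"
proof -
  define n where "n = length ys"
  let ?F = "mat n n (\<lambda>(r, c). F (zs ! r) (ys ! c))"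
  let ?G = "mat n n (\<lambda>(r, c). G (ys ! r) (xs ! c))"
  have "mat n n (\<lambda>(r, c). \<Sum>y\<in>set ys. F (zs ! r) y * G y (xs ! c)) = ?F * ?G"
    by (intro eq_matI)
       (auto simp: scalar_prod_def sum_set_conv_nth[OF assms(3)] n_def atLeast0LessThan)
  moreover have "det (?F * ?G) = det ?F * det ?G"
    by (rule det_mult[of _ n]) auto
  ultimately show ?thesis
    using len by (simp add: list_det_def n_def)
qed

lemma sum_mult_delta:
  fixes f :: "'x \<Rightarrow> 'a::comm_ring_1"
  assumes "finite S" "x \<in> S"
  shows "(\<Sum>y\<in>S. f y * (if y = x then 1 else 0)) = f x"
    and "(\<Sum>y\<in>S. (if x = y then 1 else 0) * f y) = f x"
proof -
  have "(\<Sum>y\<in>S. f y * (if y = x then 1 else 0)) = (\<Sum>y\<in>S. if y = x then f y else 0)"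
    by (intro sum.cong) auto
  then show "(\<Sum>y\<in>S. f y * (if y = x then 1 else 0)) = f x"
    using assms by (simp add: sum.delta)
  have "(\<Sum>y\<in>S. (if x = y then 1 else 0) * f y) = (\<Sum>y\<in>S. if y = x then f y else 0)"
    by (intro sum.cong) auto
  then show "(\<Sum>y\<in>S. (if x = y then 1 else 0) * f y) = f x"
    using assms by (simp add: sum.delta)
qed

lemma list_det_id:
  assumes "distinct xs"
  shows "list_det xs xs (\<lambda>y x. if y = x then 1 else 0) = (1 :: 'a::comm_ring_1)"
proof -
  have "mat (length xs) (length xs) (\<lambda>(r, c). if xs ! r = xs ! c then 1 else 0 :: 'a) =
        1\<^sub>m (length xs)"
    using assms by (intro eq_matI) (auto simp: nth_eq_iff_index_eq)
  then show ?thesis by (simp add: list_det_def)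
qed

text \<open>The factor is the product of the determinants of two permutation matrices. What matters is
  only that it is the same for all entries \<open>F\<close>.\<close>

lemma list_det_reorder:
  assumes "distinct xs" "distinct xs'" "set xs = set xs'"
    and "distinct ys" "distinct ys'" "set ys = set ys'"
    and "length xs = length ys"
  obtains c :: "'a::field" where "c \<noteq> 0"
    "\<And>F. list_det xs ys F = c * list_det xs' ys' F"
proof -
  let ?I = "\<lambda>y x. (if y = x then 1 else 0) :: 'a"
  have len: "length xs' = length xs" "length ys' = length ys" "length xs = length ys"
    using assms by (auto simp: distinct_card[symmetric])
  have unit: "list_det us vs ?I \<noteq> 0"
    if "distinct us" "distinct vs" "set us = set vs" "length us = length vs"
    for us vs :: "'z list"
  proof -
    have "list_det us us (\<lambda>z x. \<Sum>y\<in>set vs. ?I z y * ?I y x) =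
            list_det vs us ?I * list_det us vs ?I"
      using that by (intro list_det_mult) auto
    moreover have "list_det us us (\<lambda>z x. \<Sum>y\<in>set vs. ?I z y * ?I y x) = list_det us us ?I"
      using that by (intro list_det_cong sum_mult_delta(1)) auto
    ultimately have "list_det vs us ?I * list_det us vs ?I = 1"
      by (simp only: list_det_id[OF that(1)])
    then show ?thesis by (metis mult_zero_right zero_neq_one)
  qed
  let ?c = "list_det ys' ys ?I * list_det xs xs' ?I"
  have "list_det xs ys F = ?c * list_det xs' ys' F" for F :: "_ \<Rightarrow> _ \<Rightarrow> 'a"
  proof -
    have "list_det xs ys F = list_det xs ys (\<lambda>z x. \<Sum>y\<in>set xs'. F z y * ?I y x)"
      using assms by (intro list_det_cong sum_mult_delta(1)[symmetric]) auto
    also have "\<dots> = list_det xs' ys F * list_det xs xs' ?I"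
      using assms len by (intro list_det_mult) auto
    also have "list_det xs' ys F = list_det xs' ys (\<lambda>z x. \<Sum>y\<in>set ys'. ?I z y * F y x)"
      using assms by (intro list_det_cong sum_mult_delta(2)[symmetric]) auto
    also have "\<dots> = list_det ys' ys ?I * list_det xs' ys' F"
      using assms len by (intro list_det_mult) auto
    finally show ?thesis by simp
  qed
  moreover have "?c \<noteq> 0"
    using unit[of ys' ys] unit[of xs xs'] assms len by auto
  ultimately show thesis using that by blast
qed

lemma list_det_append:
  fixes F :: "'y \<Rightarrow> 'x \<Rightarrow> 'a::idom"
  assumes len: "length xs = length ys" "length xs' = length ys'"
    and 1: "\<And>y x. y \<in> set ys \<Longrightarrow> x \<in> set xs' \<Longrightarrow> F y x = 0"
    and 2: "\<And>y x. y \<in> set ys' \<Longrightarrow> x \<in> set xs \<Longrightarrow> F y x = 0"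
  shows "list_det (xs @ xs') (ys @ ys') F = list_det xs ys F * list_det xs' ys' F"
proof -
  define n m where "n = length ys" and "m = length ys'"
  let ?A = "mat n n (\<lambda>(r, c). F (ys ! r) (xs ! c))"
  let ?D = "mat m m (\<lambda>(r, c). F (ys' ! r) (xs' ! c))"
  have "mat (n + m) (n + m) (\<lambda>(r, c). F ((ys @ ys') ! r) ((xs @ xs') ! c)) =
        four_block_mat ?A (0\<^sub>m n m) (0\<^sub>m m n) ?D"
    using len 1 2
    by (intro eq_matI) (auto simp: n_def m_def nth_append four_block_mat_def Let_def)
  moreover have "det (four_block_mat ?A (0\<^sub>m n m) (0\<^sub>m m n) ?D) = det ?A * det ?D"
    by (rule det_four_block_mat_upper_right_zero) auto
  ultimately show ?thesis
    using len by (simp add: list_det_def n_def m_def)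
qed

text \<open>This is $\det(\mathrm{id}_U \otimes F) = (\det F)^{\dim U}$: the matrix is block diagonal
  with one copy of \<open>F\<close> for each element of \<open>us\<close>.\<close>

lemma list_det_product:
  fixes F :: "'y \<Rightarrow> 'x \<Rightarrow> 'a::idom"
  assumes "length xs = length ys" "distinct us"
  shows "list_det (List.product us xs) (List.product us ys)
           (\<lambda>(v, y) (u, x). if v = u then F y x else 0) = list_det xs ys F ^ length us"
  using assms(2)
proof (induction us)
  case Nil
  then show ?case by (simp add: list_det_def)
next
  case (Cons u us)
  let ?G = "\<lambda>(v, y) (u, x). if v = u then F y x else 0"
  have "list_det (List.product (u # us) xs) (List.product (u # us) ys) ?G =
        list_det (map (Pair u) xs) (map (Pair u) ys) ?G *
        list_det (List.product us xs) (List.product us ys) ?G"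
    unfolding List.product.simps
    by (rule list_det_append) (use Cons.prems assms(1) in auto)
  then show ?case
    using Cons by (simp add: list_det_map)
qed

lemma (in comm_ring_hom) hom_list_det:
  "list_det xs ys (\<lambda>y x. hom (F y x)) = hom (list_det xs ys F)"
proof -
  have "mat (length ys) (length xs) (\<lambda>(r, c). hom (F (ys ! r) (xs ! c))) =
        map_mat hom (mat (length ys) (length xs) (\<lambda>(r, c). F (ys ! r) (xs ! c)))"
    by (intro eq_matI) auto
  then show ?thesis by (simp add: list_det_def)
qed

lemma list_det_poly:
  "list_det xs ys (\<lambda>y x. poly (F y x) t) = poly (list_det xs ys F) t"
proof -
  interpret comm_ring_hom "\<lambda>p. poly p t" by unfold_locales auto
  show ?thesis by (rule hom_list_det)
qed

lemma list_det_Ints: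
  fixes F :: "'y \<Rightarrow> 'x \<Rightarrow> 'a::comm_ring_1"
  assumes "\<And>y x. y \<in> set ys \<Longrightarrow> x \<in> set xs \<Longrightarrow> F y x \<in> \<int>"
  shows "list_det xs ys F \<in> \<int>"
proof -
  define G where "G = (\<lambda>y x. SOME z. F y x = of_int z)"
  have G: "F y x = of_int (G y x)" if "y \<in> set ys" "x \<in> set xs" for y x
    unfolding G_def using assms[OF that] by (rule Ints_cases) (rule someI)
  have "list_det xs ys F = of_int (list_det xs ys G)"
    using G by (subst of_int_hom.hom_list_det[symmetric]) (auto intro: list_det_cong)
  then show ?thesis by simp
qed

lemma pderiv_sum: "pderiv (\<Sum>x\<in>S. f x) = (\<Sum>x\<in>S. pderiv (f x))"
  by (induction S rule: infinite_finite_induct) (simp_all add: pderiv_add)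

text \<open>Jacobi's formula for the derivative of a determinant, in the form it is needed here: if
  $q M' = M X$, then $q (\det M)' = \det M \cdot \mathrm{tr} X$. It holds without inverting \<open>M\<close>,
  since replacing column \<open>j\<close> of \<open>M\<close> by another column of \<open>M\<close> makes the determinant vanish.\<close>

lemma pderiv_list_det:
  fixes F :: "'y \<Rightarrow> 'x \<Rightarrow> 'a::idom poly"
  assumes len: "length xs = length ys" and dist: "distinct xs"
    and X: "\<And>y x. y \<in> set ys \<Longrightarrow> x \<in> set xs \<Longrightarrow>
              q * pderiv (F y x) = (\<Sum>z\<in>set xs. F y z * X z x)"
  shows "q * pderiv (list_det xs ys F) = list_det xs ys F * (\<Sum>x\<in>set xs. X x x)"
proof -
  define n where "n = length xs"
  define M where "M = (\<lambda>i j. F (ys ! i) (xs ! j))"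
  define Y where "Y = (\<lambda>i j. X (xs ! i) (xs ! j))"
  let ?P = "{p. p permutes {0..<n}}"
  have Y: "q * pderiv (M i j) = (\<Sum>k<n. M i k * Y k j)" if "i < n" "j < n" for i j
    unfolding M_def Y_def n_def using that len
    by (subst X) (auto simp: n_def sum_set_conv_nth[OF dist])
  have det: "det (mat n n (\<lambda>(i, j). N i j)) = (\<Sum>p\<in>?P. signof p * (\<Prod>j<n. N (p j) j))"
    for N :: "nat \<Rightarrow> nat \<Rightarrow> 'a poly"
  proof -
    have "p j < n" if "p \<in> ?P" "j < n" for p j
      using that permutes_in_image[of p "{0..<n}" j] by auto
    then show ?thesis
      by (subst det_col[of _ n]) (auto intro!: sum.cong prod.cong)
  qed
  have prodsplit: "(\<Prod>i<n. g i) = g j * (\<Prod>i\<in>{..<n} - {j}. g i)" if "j < n" for j and g :: "nat \<Rightarrow> 'a poly"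
    using that by (simp add: prod.remove)
  have "pderiv (of_int z :: 'a poly) = 0" for z :: int
    by (simp add: of_int_poly pderiv_pCons)
  then have signof: "pderiv (signof p * r) = signof p * pderiv r" for p and r :: "'a poly"
    by (simp add: pderiv_mult sign_def pderiv_minus)
  have "q * pderiv (det (mat n n (\<lambda>(i, j). M i j))) =
        (\<Sum>p\<in>?P. signof p * (\<Sum>j<n. (\<Prod>i\<in>{..<n} - {j}. M (p i) i) * (q * pderiv (M (p j) j))))"
    unfolding det pderiv_sum signof pderiv_prod sum_distrib_left
    by (intro sum.cong refl) (simp add: mult_ac sum_distrib_left)
  also have "\<dots> = (\<Sum>p\<in>?P. signof p * (\<Sum>j<n. (\<Prod>i\<in>{..<n} - {j}. M (p i) i) *
                     (\<Sum>k<n. M (p j) k * Y k j)))"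
  proof (intro sum.cong refl arg_cong2[of _ _ _ _ "(*)"])
    fix p j assume "p \<in> ?P" "j \<in> {..<n}"
    then have "p j < n" "j < n"
      using permutes_in_image[of p "{0..<n}" j] by auto
    then show "q * pderiv (M (p j) j) = (\<Sum>k<n. M (p j) k * Y k j)"
      by (rule Y)
  qed
  also have "\<dots> = (\<Sum>p\<in>?P. \<Sum>j<n. \<Sum>k<n. Y k j * (signof p * (\<Prod>i<n. M (p i) (if i = j then k else i))))"
    unfolding sum_distrib_left
    by (intro sum.cong refl, subst prodsplit) (auto simp: mult_ac intro!: prod.cong)
  also have "\<dots> = (\<Sum>j<n. \<Sum>k<n. Y k j * det (mat n n (\<lambda>(i, l). M i (if l = j then k else l))))"
    unfolding det sum_distrib_left by (subst sum.swap, intro sum.cong refl, subst sum.swap) simp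
  also have "\<dots> = (\<Sum>j<n. \<Sum>k<n. if k = j then Y j j * det (mat n n (\<lambda>(i, j). M i j)) else 0)"
  proof (intro sum.cong refl)
    fix j k assume "j \<in> {..<n}" "k \<in> {..<n}"
    then have jk: "j < n" "k < n" by auto
    let ?N = "mat n n (\<lambda>(i, l). M i (if l = j then k else l))"
    show "Y k j * det ?N = (if k = j then Y j j * det (mat n n (\<lambda>(i, j). M i j)) else 0)"
    proof (cases "k = j")
      case True
      then show ?thesis
        by (auto intro!: arg_cong[of _ _ det] eq_matI)
    next
      case False
      have "det ?N = 0"
        by (rule det_identical_columns[of _ n k j]) (use False jk in \<open>auto intro!: eq_vecI\<close>)
      with False show ?thesis by simp
    qed
  qed
  also have "\<dots> = det (mat n n (\<lambda>(i, j). M i j)) * (\<Sum>j<n. Y j j)"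
    by (simp add: sum.delta sum_distrib_left mult.commute)
  finally show ?thesis
    using len by (simp add: list_det_def M_def Y_def n_def sum_set_conv_nth[OF dist])
qed

text \<open>Cramer's rule. It needs no division, so it remains available when the entries are
  polynomials in a parameter with respect to which one wants to differentiate.\<close>

lemma list_det_solve:
  fixes F :: "'y \<Rightarrow> 'x \<Rightarrow> 'a::comm_ring_1"
  assumes len: "length xs = length ys" and dist: "distinct xs" "distinct ys"
  obtains X where "\<And>y. y \<in> set ys \<Longrightarrow> list_det xs ys F * b y = (\<Sum>x\<in>set xs. F y x * X x)"
proof -
  define n where "n = length xs"
  define M where "M = mat n n (\<lambda>(r, c). F (ys ! r) (xs ! c))"
  define u where "u = adj_mat M *\<^sub>v vec n (\<lambda>i. b (ys ! i))"
  have M: "M \<in> carrier_mat n n" by (simp add: M_def)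
  note adj = adj_mat[OF M]
  have u: "u \<in> carrier_vec n" using adj(1) by (simp add: u_def)
  have "M *\<^sub>v u = (M * adj_mat M) *\<^sub>v vec n (\<lambda>i. b (ys ! i))"
    unfolding u_def using adj(1) M by (subst assoc_mult_mat_vec) auto
  also have "\<dots> = det M \<cdot>\<^sub>v vec n (\<lambda>i. b (ys ! i))"
    unfolding adj(2) by (intro eq_vecI) (auto simp: row_smult)
  finally have eq: "M *\<^sub>v u = det M \<cdot>\<^sub>v vec n (\<lambda>i. b (ys ! i))" .
  define X where "X = (\<lambda>x. u $ (THE i. i < n \<and> xs ! i = x))"
  have X: "X (xs ! i) = u $ i" if "i < n" for i
  proof -
    have "(THE j. j < n \<and> xs ! j = xs ! i) = i"
      using that dist(1) by (auto simp: n_def nth_eq_iff_index_eq)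
    then show ?thesis by (simp add: X_def)
  qed
  show thesis
  proof (rule that[of X])
    fix y assume "y \<in> set ys"
    then obtain r where r: "r < n" "y = ys ! r"
      using len by (auto simp: in_set_conv_nth n_def)
    have "det M * b y = (M *\<^sub>v u) $ r" using r by (simp add: eq)
    also have "\<dots> = (\<Sum>i<n. M $$ (r, i) * u $ i)"
      using r M u by (auto simp: scalar_prod_def atLeast0LessThan intro!: sum.cong)
    also have "\<dots> = (\<Sum>i<n. F y (xs ! i) * X (xs ! i))"
      using r by (intro sum.cong refl) (auto simp: M_def X)
    also have "\<dots> = (\<Sum>x\<in>set xs. F y x * X x)"
      by (simp add: sum_set_conv_nth[OF dist(1)] n_def)
    finally show "list_det xs ys F * b y = (\<Sum>x\<in>set xs. F y x * X x)"
      using len by (simp add: list_det_def M_def n_def)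
  qed
qed

section \<open>Monomial bases\<close>

lemma set_monomials: "set (monomials n d) = {\<alpha>. length \<alpha> = n \<and> sum_list \<alpha> = d}"
proof (induction n arbitrary: d)
  case (Suc n)
  have "\<alpha> \<in> set (monomials (Suc n) d)" if \<alpha>: "length \<alpha> = Suc n" "sum_list \<alpha> = d" for \<alpha>
  proof -
    from \<alpha> obtain a \<beta> where "\<alpha> = a # \<beta>" "length \<beta> = n" "a + sum_list \<beta> = d"
      by (auto simp: length_Suc_conv)
    then show ?thesis
      by (auto simp: Suc.IH image_iff intro!: exI[of _ a] bexI[of _ a])
  qed
  moreover have "length \<alpha> = Suc n" "sum_list \<alpha> = d" if "\<alpha> \<in> set (monomials (Suc n) d)" for \<alpha>
    using that by (auto simp: Suc.IH)
  ultimately show ?case by blast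
qed auto

lemma distinct_concat_map_Cons:
  assumes "distinct as" "\<And>a. a \<in> set as \<Longrightarrow> distinct (F a)"
  shows "distinct (concat (map (\<lambda>a. map (Cons a) (F a)) as))"
  using assms by (induction as) (auto simp: distinct_map)

lemma distinct_monomials: "distinct (monomials n d)"
  by (induction n arbitrary: d)
     (simp_all only: monomials.simps, simp, rule distinct_concat_map_Cons, auto)

lemma length_monomials: "length (monomials (Suc n) d) = (n + d) choose d"
proof (induction n arbitrary: d)
  case 0
  have "length (monomials (Suc 0) d) = (\<Sum>a\<leftarrow>[0..<Suc d]. if a = d then 1 else 0)"
    unfolding monomials.simps length_concat map_map rev_map[symmetric] sum_list_rev
    by (intro arg_cong[of _ _ sum_list] map_cong) auto
  also have "\<dots> = (\<Sum>a<Suc d. if a = d then 1 else 0)"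
    by (simp add: interv_sum_list_conv_sum_set_nat atLeast0LessThan del: upt_Suc)
  also have "\<dots> = 1" by (subst sum.delta) auto
  finally show ?case by simp
next
  case (Suc n)
  have "length (monomials (Suc (Suc n)) d) = (\<Sum>a\<leftarrow>[0..<Suc d]. (n + (d - a)) choose (d - a))"
    unfolding monomials.simps(2)[of "Suc n"] length_concat map_map rev_map[symmetric] sum_list_rev
    by (intro arg_cong[of _ _ sum_list] map_cong) (auto simp del: monomials.simps simp: Suc.IH)
  also have "\<dots> = (\<Sum>a\<le>d. (n + (d - a)) choose (d - a))"
    by (simp add: interv_sum_list_conv_sum_set_nat atLeast0LessThan lessThan_Suc_atMost del: upt_Suc)
  also have "\<dots> = (\<Sum>a\<le>d. (n + a) choose a)"
    by (rule sum.reindex_bij_witness[of _ "\<lambda>a. d - a" "\<lambda>a. d - a"]) auto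
  also have "\<dots> = Suc (n + d) choose d"
    by (rule sum_choose_lower)
  finally show ?case by simp
qed

(* otherwise the recursion unfolds as soon as n + 1 is normalised to Suc n *)
declare monomials.simps [simp del]

lemma sum_list_conv_sum_nth: "sum_list xs = (\<Sum>i<length xs. xs ! i)"
  by (simp add: sum_list_sum_nth atLeast0LessThan)

lemma set_sym_tensor_basis:
  assumes "length ds = length ls"
  shows "set (sym_tensor_basis ls ds) =
    {\<eta>. length \<eta> = length ls \<and>
        (\<forall>j<length ls. length (\<eta> ! j) = ls ! j + 1 \<and> sum_list (\<eta> ! j) = ds ! j)}"
  using assms by (auto simp: sym_tensor_basis_def product_lists_set list_all2_conv_all_nth
      set_monomials)

lemma distinct_sym_tensor_basis: "distinct (sym_tensor_basis ls ds)"
  unfolding sym_tensor_basis_def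
  by (rule distinct_product_lists) (auto simp: distinct_monomials set_zip)

lemma length_product_lists: "length (product_lists xss) = prod_list (map length xss)"
  by (induction xss) (auto simp: length_concat o_def sum_list_triv)

lemma sym_degrees_append:
  "sym_degrees (ks @ ls) = sym_degrees ks @ map ((+) (sum_list ks)) (sym_degrees ls)"
proof (rule nth_equalityI)
  show "length (sym_degrees (ks @ ls)) =
        length (sym_degrees ks @ map ((+) (sum_list ks)) (sym_degrees ls))"
    by (simp add: sym_degrees_def)
  show "sym_degrees (ks @ ls) ! j = (sym_degrees ks @ map ((+) (sum_list ks)) (sym_degrees ls)) ! j"
    if "j < length (sym_degrees (ks @ ls))" for j
    using that by (auto simp: sym_degrees_def nth_append)
qed

lemma length_sym_degrees [simp]: "length (sym_degrees ls) = length ls"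
  by (simp add: sym_degrees_def)

lemma nth_sym_degrees [simp]: "j < length ls \<Longrightarrow> sym_degrees ls ! j = sum_list (take j ls)"
  by (simp add: sym_degrees_def)

text \<open>The basis of $S^{m_1+s}V_1 \otimes \dots \otimes S^{m_p+s}V_p$: the source and the target of
  $\partial_A$ are the cases \<open>s = 0\<close> and \<open>s = 1\<close>.\<close>

definition shifted_basis :: "nat list \<Rightarrow> nat \<Rightarrow> nat list list list" where
  "shifted_basis ls s = sym_tensor_basis ls (map ((+) s) (sym_degrees ls))"

lemma source_basis_eq: "source_basis k = List.product [0..<k ! 0 + 1] (shifted_basis (tl k) 0)"
proof -
  have "map ((+) 0) (sym_degrees (tl k)) = sym_degrees (tl k)"
    by (rule map_idI) simp
  then show ?thesis by (simp only: source_basis_def shifted_basis_def)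
qed

lemma target_basis_eq: "target_basis k = shifted_basis (tl k) 1"
proof -
  have "map ((+) 1) (sym_degrees (tl k)) = map Suc (sym_degrees (tl k))"
    by (rule map_cong) auto
  then show ?thesis by (simp only: target_basis_def shifted_basis_def)
qed

lemma set_shifted_basis:
  "set (shifted_basis ls s) =
    {\<eta>. length \<eta> = length ls \<and>
        (\<forall>j<length ls. length (\<eta> ! j) = ls ! j + 1 \<and> sum_list (\<eta> ! j) = sum_list (take j ls) + s)}"
  unfolding shifted_basis_def
  by (subst set_sym_tensor_basis) (auto simp: add.commute)

lemma distinct_shifted_basis: "distinct (shifted_basis ls s)"
  by (simp add: shifted_basis_def distinct_sym_tensor_basis)

lemma set_shifted_basis_append:
  "set (shifted_basis (ks @ ls) s) =
    (\<lambda>(\<alpha>, \<eta>). \<alpha> @ \<eta>) ` (set (shifted_basis ks s) \<times> set (shifted_basis ls (sum_list ks + s)))"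
  (is "?L = ?R")
proof
  show "?L \<subseteq> ?R"
  proof
    fix \<zeta> assume \<zeta>: "\<zeta> \<in> ?L"
    have "take (length ks) \<zeta> \<in> set (shifted_basis ks s)"
    proof -
      have "length (\<zeta> ! j) = ks ! j + 1" "sum_list (\<zeta> ! j) = sum_list (take j ks) + s" if "j < length ks" for j
      proof -
        have "j < length (ks @ ls)" using that by simp
        then have "length (\<zeta> ! j) = (ks @ ls) ! j + 1 \<and> sum_list (\<zeta> ! j) = sum_list (take j (ks @ ls)) + s"
          using \<zeta> by (auto simp: set_shifted_basis)
        then show "length (\<zeta> ! j) = ks ! j + 1" "sum_list (\<zeta> ! j) = sum_list (take j ks) + s"
          using that by (auto simp: nth_append)
      qed
      then show ?thesis using \<zeta> by (auto simp: set_shifted_basis)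
    qed
    moreover have "drop (length ks) \<zeta> \<in> set (shifted_basis ls (sum_list ks + s))"
    proof -
      have "length (\<zeta> ! (length ks + j)) = ls ! j + 1"
           "sum_list (\<zeta> ! (length ks + j)) = sum_list (take j ls) + (sum_list ks + s)"
        if "j < length ls" for j
      proof -
        have "length ks + j < length (ks @ ls)" using that by simp
        then have "length (\<zeta> ! (length ks + j)) = (ks @ ls) ! (length ks + j) + 1 \<and>
              sum_list (\<zeta> ! (length ks + j)) = sum_list (take (length ks + j) (ks @ ls)) + s"
          using \<zeta> unfolding set_shifted_basis by blast
        then show "length (\<zeta> ! (length ks + j)) = ls ! j + 1"
           "sum_list (\<zeta> ! (length ks + j)) = sum_list (take j ls) + (sum_list ks + s)"
          by (auto simp: nth_append)
      qed
      then show ?thesis using \<zeta> by (auto simp: set_shifted_basis)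
    qed
    ultimately show "\<zeta> \<in> ?R"
      by (intro image_eqI[of _ _ "(take (length ks) \<zeta>, drop (length ks) \<zeta>)"]) auto
  qed
  show "?R \<subseteq> ?L"
    by (auto simp: set_shifted_basis nth_append add_ac)
qed

lemma append_in_shifted_basis:
  assumes "length \<alpha> = length ks"
  shows "\<alpha> @ \<eta> \<in> set (shifted_basis (ks @ ls) s) \<longleftrightarrow>
    \<alpha> \<in> set (shifted_basis ks s) \<and> \<eta> \<in> set (shifted_basis ls (sum_list ks + s))"
  using assms unfolding set_shifted_basis_append
  by (auto simp: set_shifted_basis)

text \<open>The dimension of a tensor product of symmetric powers, with degrees $m_j + s$, telescopes to
  a multinomial coefficient.\<close>

lemma length_shifted_basis:
  "length (shifted_basis ls s) * (fact s * prod_list (map fact ls)) = fact (s + sum_list ls)"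
proof -
  have "prod_list (map length (map2 (\<lambda>kj d. monomials (kj + 1) d) ls (map ((+) s) (sym_degrees ls))))
        * (fact s * prod_list (map fact ls)) = fact (s + sum_list ls)"
  proof (induction ls arbitrary: s)
    case (Cons l ls)
    have "sym_degrees (l # ls) = 0 # map ((+) l) (sym_degrees ls)"
      using sym_degrees_append[of "[l]" ls] by (simp add: sym_degrees_def)
    moreover have "map ((+) s) (map ((+) l) (sym_degrees ls)) = map ((+) (s + l)) (sym_degrees ls)"
      by (simp add: add.assoc)
    moreover have "(l + s choose s) * (fact s * fact l) = fact (s + l)"
      using binomial_fact_lemma[of s "l + s"] by (simp add: mult_ac add.commute)
    moreover define P where "P = prod_list (map length
      (map2 (\<lambda>kj d. monomials (kj + 1) d) ls (map ((+) (s + l)) (sym_degrees ls))))"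
    moreover have "P * (fact (s + l) * prod_list (map fact ls)) = fact (s + l + sum_list ls)"
      unfolding P_def by (rule Cons.IH)
    ultimately have "(l + s choose s) * P * (fact s * (fact l * prod_list (map fact ls))) =
        fact (s + l + sum_list ls)"
      by (metis (no_types, opaque_lifting) mult.assoc mult.commute)
    moreover have "prod_list (map length (map2 (\<lambda>kj d. monomials (kj + 1) d) (l # ls)
        (map ((+) s) (sym_degrees (l # ls))))) = (l + s choose s) * P"
      unfolding \<open>sym_degrees (l # ls) = _\<close> P_def
        \<open>map ((+) s) (map ((+) l) (sym_degrees ls)) = _\<close>[symmetric]
      by (simp add: length_monomials del: map_map)
    ultimately show ?case
      by (simp add: add.assoc)
  qed (simp add: sym_degrees_def)
  then show ?thesis
    by (simp add: shifted_basis_def sym_tensor_basis_def length_product_lists)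
qed

lemma fact_prod_pos: "prod_list (map fact ls) > (0 :: nat)"
  by (induction ls) auto

lemma length_source_target:
  "(sum_list ls + 1) * length (shifted_basis ls 0) = length (shifted_basis ls 1)"
proof -
  have "(sum_list ls + 1) * length (shifted_basis ls 0) * prod_list (map fact ls) =
        length (shifted_basis ls 1) * prod_list (map fact ls)"
    using length_shifted_basis[of ls 0] length_shifted_basis[of ls 1]
    by (simp add: mult.assoc distrib_right)
  moreover have "prod_list (map fact ls) \<noteq> (0 :: nat)"
    using fact_prod_pos[of ls] by (rule neq0_conv[THEN iffD2])
  ultimately show ?thesis by (metis mult_right_cancel)
qed

lemma length_shifted_basis_split:
  "length (monomials (sum_list ls + 1) d) * length (shifted_basis ls 0) = length (shifted_basis ls d)"
proof -
  have "(sum_list ls + d choose d) * (fact d * fact (sum_list ls)) = fact (d + sum_list ls)"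
    using binomial_fact_lemma[of d "sum_list ls + d"] by (simp add: mult_ac add.commute)
  then have "(sum_list ls + d choose d) * length (shifted_basis ls 0) * (fact d * prod_list (map fact ls)) =
        length (shifted_basis ls d) * (fact d * prod_list (map fact ls))"
    using length_shifted_basis[of ls 0] length_shifted_basis[of ls d]
    by (metis (no_types, lifting) add.left_neutral fact_0 mult.assoc mult.left_commute mult_1)
  moreover have "fact d * prod_list (map fact ls) \<noteq> (0 :: nat)"
    unfolding neq0_conv using fact_prod_pos[of "d # ls"] unfolding list.map prod_list.Cons .
  ultimately have "(sum_list ls + d choose d) * length (shifted_basis ls 0) = length (shifted_basis ls d)"
    by (metis mult_right_cancel)
  then show ?thesis by (simp add: length_monomials)
qed

lemma multinomial_eq_length_shifted_basis:
  assumes "n = sum_list ls"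
  shows "multinomial n ls = length (shifted_basis ls 0)"
proof -
  have "fact n = length (shifted_basis ls 0) * prod_list (map fact ls)"
    using length_shifted_basis[of ls 0] assms by simp
  then show ?thesis
    unfolding multinomial_def using fact_prod_pos[of ls] by simp
qed

section \<open>Multigraded polynomials\<close>

text \<open>The variables are indexed by pairs \<open>(j, i)\<close>: the \<open>i\<close>-th coordinate on the \<open>j\<close>-th tensor
  factor. A monomial is given by its exponent function, so that the product of symmetric algebras
  $S(W_1) \otimes \dots \otimes S(W_q)$ becomes a ring of finitely supported functions on
  exponents.\<close>

type_synonym 'a mpoly = "(nat \<Rightarrow> nat \<Rightarrow> nat) \<Rightarrow>\<^sub>0 'a"

definition expo :: "nat list list \<Rightarrow> nat \<Rightarrow> nat \<Rightarrow> nat" where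
  "expo \<eta> = (\<lambda>j i. if j < length \<eta> \<and> i < length (\<eta> ! j) then \<eta> ! j ! i else 0)"

definition unit_expo :: "nat list \<Rightarrow> nat \<Rightarrow> nat \<Rightarrow> nat" where
  "unit_expo is = (\<lambda>j i. if j < length is \<and> i = is ! j then 1 else 0)"

text \<open>Exponent functions are total, so the variables of the format have to be singled out by a
  support condition. With it these are the exponents of the monomials of multidegree \<open>D\<close>.\<close>

definition expos :: "nat list \<Rightarrow> (nat \<Rightarrow> nat) \<Rightarrow> (nat \<Rightarrow> nat \<Rightarrow> nat) set" where
  "expos ls D = {m. (\<forall>j i. m j i \<noteq> 0 \<longrightarrow> j < length ls \<and> i \<le> ls ! j) \<and>
                    (\<forall>j<length ls. (\<Sum>i\<le>ls ! j. m j i) = D j)}"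

text \<open>The multidegree of \<open>shifted_basis ls s\<close>. Below $T_{n+s}$ stands for the space of polynomials of
  this multidegree.\<close>

definition shifted_deg :: "nat list \<Rightarrow> nat \<Rightarrow> nat \<Rightarrow> nat" where
  "shifted_deg ls s = (\<lambda>j. sum_list (take j ls) + s)"

lemma length_mul_vars:
  "is \<in> indices ls \<Longrightarrow> length \<eta> = length ls \<Longrightarrow> length (mul_vars \<eta> is) = length ls"
  by (simp add: mul_vars_def indices_def)

lemma nth_mul_vars:
  "is \<in> indices ls \<Longrightarrow> length \<eta> = length ls \<Longrightarrow> j < length ls \<Longrightarrow>
   mul_vars \<eta> is ! j = (\<eta> ! j)[is ! j := Suc (\<eta> ! j ! (is ! j))]"
  by (simp add: mul_vars_def indices_def)

lemma expo_mul_vars: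
  assumes "is \<in> indices ls" "\<eta> \<in> set (shifted_basis ls s)"
  shows "expo (mul_vars \<eta> is) = unit_expo is + expo \<eta>"
proof (intro ext)
  fix j i
  have len: "length \<eta> = length ls" "length is = length ls"
    using assms by (auto simp: set_shifted_basis indices_def)
  show "expo (mul_vars \<eta> is) j i = (unit_expo is + expo \<eta>) j i"
  proof (cases "j < length ls")
    case True
    then have "length (\<eta> ! j) = ls ! j + 1" "is ! j \<le> ls ! j"
      using assms by (auto simp: set_shifted_basis indices_def)
    then show ?thesis
      using assms(1) len True
      by (auto simp: expo_def unit_expo_def length_mul_vars nth_mul_vars nth_list_update)
  next
    case False
    then show ?thesis
      using assms(1) len by (simp add: expo_def unit_expo_def length_mul_vars)
  qed
qed

lemma mul_vars_in_shifted_basis: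
  assumes "is \<in> indices ls" "\<eta> \<in> set (shifted_basis ls s)"
  shows "mul_vars \<eta> is \<in> set (shifted_basis ls (Suc s))"
proof -
  have len: "length \<eta> = length ls" using assms by (auto simp: set_shifted_basis)
  have "length (mul_vars \<eta> is ! j) = ls ! j + 1 \<and>
        sum_list (mul_vars \<eta> is ! j) = sum_list (take j ls) + Suc s" if "j < length ls" for j
  proof -
    have "length (\<eta> ! j) = ls ! j + 1" "is ! j \<le> ls ! j"
         "sum_list (\<eta> ! j) = sum_list (take j ls) + s"
      using assms that by (auto simp: set_shifted_basis indices_def)
    then show ?thesis
      using that assms(1) len by (simp add: nth_mul_vars sum_list_update)
  qed
  then show ?thesis
    using len assms(1) by (simp add: set_shifted_basis length_mul_vars)
qed

lemma inj_on_expo: "inj_on expo (set (shifted_basis ls s))"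
proof (rule inj_onI)
  fix \<eta> \<zeta> assume *: "\<eta> \<in> set (shifted_basis ls s)" "\<zeta> \<in> set (shifted_basis ls s)"
    and eq: "expo \<eta> = expo \<zeta>"
  show "\<eta> = \<zeta>"
  proof (rule nth_equalityI)
    show "length \<eta> = length \<zeta>" using * by (auto simp: set_shifted_basis)
    fix j assume j: "j < length \<eta>"
    show "\<eta> ! j = \<zeta> ! j"
    proof (rule nth_equalityI)
      show "length (\<eta> ! j) = length (\<zeta> ! j)" using * j by (auto simp: set_shifted_basis)
      fix i assume "i < length (\<eta> ! j)"
      then show "\<eta> ! j ! i = \<zeta> ! j ! i"
        using fun_cong[OF fun_cong[OF eq, of j], of i] j * by (auto simp: expo_def set_shifted_basis)
    qed
  qed
qed

lemma expo_image: "expo ` set (shifted_basis ls s) = expos ls (shifted_deg ls s)"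
proof
  have "expo \<eta> \<in> expos ls (shifted_deg ls s)" if "\<eta> \<in> set (shifted_basis ls s)" for \<eta>
  proof -
    have "(\<Sum>i\<le>ls ! j. expo \<eta> j i) = shifted_deg ls s j" if "j < length ls" for j
    proof -
      have *: "length (\<eta> ! j) = ls ! j + 1" "length \<eta> = length ls"
           "sum_list (\<eta> ! j) = sum_list (take j ls) + s"
        using \<open>\<eta> \<in> _\<close> that by (auto simp: set_shifted_basis)
      then have "(\<Sum>i\<le>ls ! j. expo \<eta> j i) = (\<Sum>i<length (\<eta> ! j). \<eta> ! j ! i)"
        using that by (intro sum.cong) (auto simp: expo_def)
      then show ?thesis
        using * by (simp add: sum_list_conv_sum_nth shifted_deg_def)
    qed
    then show ?thesis
      using that by (auto simp: expos_def expo_def set_shifted_basis split: if_splits)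
  qed
  then show "expo ` set (shifted_basis ls s) \<subseteq> expos ls (shifted_deg ls s)" by blast
  show "expos ls (shifted_deg ls s) \<subseteq> expo ` set (shifted_basis ls s)"
  proof
    fix m assume m: "m \<in> expos ls (shifted_deg ls s)"
    define \<eta> where "\<eta> = map (\<lambda>j. map (m j) [0..<ls ! j + 1]) [0..<length ls]"
    have "expo \<eta> j i = m j i" for j i
      using m by (force simp: expo_def \<eta>_def expos_def simp del: upt_Suc)
    then have "m = expo \<eta>" by (auto simp: fun_eq_iff)
    moreover have "\<eta> \<in> set (shifted_basis ls s)"
    proof -
      have "sum_list (\<eta> ! j) = sum_list (take j ls) + s" if "j < length ls" for j
      proof -
        have "sum_list (\<eta> ! j) = (\<Sum>i\<le>ls ! j. m j i)"
          using that by (simp add: \<eta>_def interv_sum_list_conv_sum_set_nat atLeast0LessThan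
              lessThan_Suc_atMost del: upt_Suc)
        then show ?thesis using m that by (simp add: expos_def shifted_deg_def)
      qed
      then show ?thesis by (auto simp: set_shifted_basis \<eta>_def)
    qed
    ultimately show "m \<in> expo ` set (shifted_basis ls s)" by blast
  qed
qed

lemma expos_add:
  "m \<in> expos ls D \<Longrightarrow> m' \<in> expos ls E \<Longrightarrow> m + m' \<in> expos ls (\<lambda>j. D j + E j)"
  by (auto simp: expos_def sum.distrib)

lemma unit_expo_in_expos: "is \<in> indices ls \<Longrightarrow> unit_expo is \<in> expos ls (\<lambda>_. 1)"
  by (auto simp: expos_def unit_expo_def indices_def split: if_splits)

definition homogeneous :: "nat list \<Rightarrow> (nat \<Rightarrow> nat) \<Rightarrow> 'a::zero mpoly set" where
  "homogeneous ls D = {f. Poly_Mapping.keys f \<subseteq> expos ls D}"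

lemma homogeneous_0: "0 \<in> homogeneous ls D"
  by (simp add: homogeneous_def)

lemma homogeneous_single: "m \<in> expos ls D \<Longrightarrow> Poly_Mapping.single m c \<in> homogeneous ls D"
  by (auto simp: homogeneous_def)

lemma homogeneous_add:
  fixes f g :: "'a::comm_ring_1 mpoly"
  shows "f \<in> homogeneous ls D \<Longrightarrow> g \<in> homogeneous ls D \<Longrightarrow> f + g \<in> homogeneous ls D"
  using Poly_Mapping.keys_add[of f g] by (auto simp: homogeneous_def)

lemma homogeneous_sum:
  fixes f :: "'i \<Rightarrow> 'a::comm_ring_1 mpoly"
  shows "(\<And>i. i \<in> S \<Longrightarrow> f i \<in> homogeneous ls D) \<Longrightarrow> (\<Sum>i\<in>S. f i) \<in> homogeneous ls D"
  by (induction S rule: infinite_finite_induct) (auto intro: homogeneous_add homogeneous_0)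

lemma homogeneous_mult:
  fixes f g :: "'a::comm_ring_1 mpoly"
  assumes "f \<in> homogeneous ls D" "g \<in> homogeneous ls E"
  shows "f * g \<in> homogeneous ls (\<lambda>j. D j + E j)"
  using assms keys_mult[of f g] by (fastforce simp: homogeneous_def intro: expos_add)

lemma homogeneous_one: "(1 :: 'a::comm_ring_1 mpoly) \<in> homogeneous ls (\<lambda>_. 0)"
  by (auto simp: homogeneous_def expos_def)

lemma homogeneous_power:
  fixes f :: "'a::comm_ring_1 mpoly"
  assumes "f \<in> homogeneous ls (\<lambda>_. 1)"
  shows "f ^ n \<in> homogeneous ls (\<lambda>_. n)"
proof (induction n)
  case (Suc n)
  show ?case using homogeneous_mult[OF assms Suc] by simp
qed (simp add: homogeneous_one)

lemma homogeneous_prod: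
  fixes f :: "'i \<Rightarrow> 'a::comm_ring_1 mpoly"
  assumes "\<And>i. i \<in> S \<Longrightarrow> f i \<in> homogeneous ls (\<lambda>_. e i)"
  shows "(\<Prod>i\<in>S. f i) \<in> homogeneous ls (\<lambda>_. \<Sum>i\<in>S. e i)"
  using assms
proof (induction S rule: infinite_finite_induct)
  case (insert i S)
  then show ?case using homogeneous_mult[of "f i" ls "\<lambda>_. e i"] by simp
qed (simp_all add: homogeneous_one)

lemma lookup_const_mult:
  "Poly_Mapping.lookup (Poly_Mapping.single 0 c * f) m = c * Poly_Mapping.lookup f m"
  unfolding mult_map_scale_conv_mult[symmetric]
  by (simp add: Poly_Mapping.map.rep_eq when_def)

lemma homogeneous_expand:
  fixes f :: "'a::comm_ring_1 mpoly"
  assumes "f \<in> homogeneous ls (shifted_deg ls s)"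
  shows "f = (\<Sum>\<eta>\<in>set (shifted_basis ls s).
               Poly_Mapping.single (expo \<eta>) (Poly_Mapping.lookup f (expo \<eta>)))"
proof (rule poly_mapping_eqI)
  fix m
  have "(\<Sum>\<eta>\<in>set (shifted_basis ls s).
          Poly_Mapping.lookup (Poly_Mapping.single (expo \<eta>) (Poly_Mapping.lookup f (expo \<eta>))) m) =
        (\<Sum>m'\<in>expos ls (shifted_deg ls s). if m' = m then Poly_Mapping.lookup f m else 0)"
    unfolding expo_image[symmetric] sum.reindex[OF inj_on_expo]
    by (intro sum.cong) (auto simp: lookup_single when_def)
  also have "\<dots> = Poly_Mapping.lookup f m"
  proof -
    have "finite (expos ls (shifted_deg ls s))"
      unfolding expo_image[symmetric] by simp
    then show ?thesis
      using assms by (auto simp: sum.delta homogeneous_def in_keys_iff)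
  qed
  finally show "Poly_Mapping.lookup f m = Poly_Mapping.lookup (\<Sum>\<eta>\<in>set (shifted_basis ls s).
               Poly_Mapping.single (expo \<eta>) (Poly_Mapping.lookup f (expo \<eta>))) m"
    by (simp add: lookup_sum)
qed

section \<open>The multilinear forms of a multidimensional matrix\<close>

definition monomial :: "nat list list \<Rightarrow> 'a::comm_ring_1 mpoly" where
  "monomial \<eta> = Poly_Mapping.single (expo \<eta>) 1"

definition form :: "nat list \<Rightarrow> (nat list \<Rightarrow> 'a::comm_ring_1) \<Rightarrow> nat \<Rightarrow> 'a mpoly" where
  "form ls B h = (\<Sum>is\<in>indices ls. Poly_Mapping.single (unit_expo is) (B (h # is)))"

definition form_pow :: "nat list \<Rightarrow> (nat list \<Rightarrow> 'a::comm_ring_1) \<Rightarrow> nat list \<Rightarrow> 'a mpoly" where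
  "form_pow ls B \<gamma> = (\<Prod>h<length \<gamma>. form ls B h ^ (\<gamma> ! h))"

text \<open>The forms $g_0,\dots,g_{l_0}$ of \<open>B\<close> define the map $\partial_B$, which sends
  $e_h \otimes t$ to $g_h t$, and the maps $\Phi_d\colon S^d \otimes T_n \to T_{n+d}$, which send
  $z^\gamma \otimes t$ to $g^\gamma t$. Their matrices have the following entries.\<close>

definition mult_entry ::
  "nat list \<Rightarrow> (nat list \<Rightarrow> 'a::comm_ring_1) \<Rightarrow> nat list list \<Rightarrow> nat \<times> nat list list \<Rightarrow> 'a" where
  "mult_entry ls B \<zeta> = (\<lambda>(h, \<eta>). Poly_Mapping.lookup (form ls B h * monomial \<eta>) (expo \<zeta>))"

definition pow_entry ::
  "nat list \<Rightarrow> (nat list \<Rightarrow> 'a::comm_ring_1) \<Rightarrow> nat list list \<Rightarrow> nat list \<times> nat list list \<Rightarrow> 'a" where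
  "pow_entry ls B \<zeta> = (\<lambda>(\<gamma>, \<tau>). Poly_Mapping.lookup (form_pow ls B \<gamma> * monomial \<tau>) (expo \<zeta>))"

lemma indices_Nil [simp]: "indices [] = {[]}"
  by (auto simp: indices_def)

lemma indices_append:
  "indices (ks @ ls) = (\<lambda>(is, js). is @ js) ` (indices ks \<times> indices ls)" (is "?L = ?R")
proof
  show "?L \<subseteq> ?R"
  proof
    fix xs assume xs: "xs \<in> ?L"
    have "xs ! (length ks + j) \<le> ls ! j" if "j < length ls" for j
    proof -
      have "xs ! (length ks + j) \<le> (ks @ ls) ! (length ks + j)"
        using xs that unfolding indices_def by (simp only: mem_Collect_eq length_append)
      then show ?thesis by simp
    qed
    moreover have "\<forall>j<length ks. xs ! j \<le> (ks @ ls) ! j"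
      using xs by (auto simp: indices_def)
    ultimately have "take (length ks) xs \<in> indices ks" "drop (length ks) xs \<in> indices ls"
      using xs by (auto simp: indices_def nth_append)
    then show "xs \<in> ?R"
      by (intro image_eqI[of _ _ "(take (length ks) xs, drop (length ks) xs)"]) auto
  qed
  show "?R \<subseteq> ?L" by (auto simp: indices_def nth_append)
qed

lemma indices_singleton: "indices [l] = (\<lambda>h. [h]) ` {..l}"
  by (auto simp: indices_def length_Suc_conv image_iff)

lemma finite_indices [simp]: "finite (indices ls)"
proof (induction ls)
  case (Cons l ls)
  then show ?case
    using indices_append[of "[l]" ls] by (simp add: indices_singleton)
qed simp

lemma form_homogeneous: "form ls B h \<in> homogeneous ls (\<lambda>_. 1)"
  unfolding form_def by (intro homogeneous_sum homogeneous_single unit_expo_in_expos)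

lemma monomial_homogeneous:
  "\<eta> \<in> set (shifted_basis ls s) \<Longrightarrow> monomial \<eta> \<in> homogeneous ls (shifted_deg ls s)"
  unfolding monomial_def by (intro homogeneous_single) (auto simp flip: expo_image)

lemma form_pow_homogeneous: "form_pow ls B \<gamma> \<in> homogeneous ls (\<lambda>_. sum_list \<gamma>)"
  unfolding form_pow_def sum_list_conv_sum_nth
  by (intro homogeneous_prod homogeneous_power form_homogeneous)

lemma form_pow_monomial_homogeneous:
  assumes "\<tau> \<in> set (shifted_basis ls s)"
  shows "form_pow ls B \<gamma> * monomial \<tau> \<in> homogeneous ls (shifted_deg ls (s + sum_list \<gamma>))"
  using homogeneous_mult[OF form_pow_homogeneous[of ls B \<gamma>] monomial_homogeneous[OF assms]]
  by (simp add: shifted_deg_def add_ac)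

lemma form_monomial_homogeneous:
  assumes "\<tau> \<in> set (shifted_basis ls s)"
  shows "form ls B h * monomial \<tau> \<in> homogeneous ls (shifted_deg ls (Suc s))"
  using homogeneous_mult[OF form_homogeneous[of ls B h] monomial_homogeneous[OF assms]]
  by (simp add: shifted_deg_def add_ac)

lemma mult_entry_eq:
  assumes "\<eta> \<in> set (shifted_basis ls s)" "\<zeta> \<in> set (shifted_basis ls (Suc s))"
  shows "mult_entry ls B \<zeta> (h, \<eta>) = (\<Sum>is\<in>{is \<in> indices ls. mul_vars \<eta> is = \<zeta>}. B (h # is))"
proof -
  have "unit_expo is + expo \<eta> = expo \<zeta> \<longleftrightarrow> mul_vars \<eta> is = \<zeta>" if "is \<in> indices ls" for "is"
    unfolding expo_mul_vars[OF that assms(1), symmetric]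
    using inj_onD[OF inj_on_expo _ mul_vars_in_shifted_basis[OF that assms(1)] assms(2)] by blast
  then have "mult_entry ls B \<zeta> (h, \<eta>) =
      (\<Sum>is\<in>indices ls. if mul_vars \<eta> is = \<zeta> then B (h # is) else 0)"
    by (auto simp: mult_entry_def form_def monomial_def sum_distrib_right mult_single lookup_sum
        lookup_single when_def intro!: sum.cong)
  also have "\<dots> = (\<Sum>is\<in>{is \<in> indices ls. mul_vars \<eta> is = \<zeta>}. B (h # is))"
    by (simp add: sum.inter_filter)
  finally show ?thesis .
qed

text \<open>Composing a map into $T_{n+s}$ with multiplication by the forms is a matrix product. This is
  how identities between polynomials become identities between matrices.\<close>

lemma lookup_form_mult:
  fixes f :: "'a::comm_ring_1 mpoly"
  assumes "f \<in> homogeneous ls (shifted_deg ls s)"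
  shows "Poly_Mapping.lookup (form ls B h * f) (expo \<zeta>) =
    (\<Sum>\<eta>\<in>set (shifted_basis ls s). mult_entry ls B \<zeta> (h, \<eta>) * Poly_Mapping.lookup f (expo \<eta>))"
proof -
  have *: "form ls B h * Poly_Mapping.single (expo \<eta>) c =
        Poly_Mapping.single 0 c * (form ls B h * monomial \<eta>)" for \<eta> c
    by (simp add: monomial_def mult.left_commute[of _ "form ls B h"] mult_single)
  show ?thesis
    by (subst homogeneous_expand[OF assms])
       (simp add: sum_distrib_left * lookup_sum lookup_const_mult mult_entry_def mult.commute)
qed

lemma prod_lessThan_remove:
  "h < (n::nat) \<Longrightarrow> (\<Prod>i<n. f i) = f h * (\<Prod>i\<in>{..<n} - {h}. f i :: 'a::comm_monoid_mult)"
  by (rule prod.remove) auto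

lemma form_pow_Suc:
  assumes "h < length \<gamma>"
  shows "form_pow ls B (\<gamma>[h := Suc (\<gamma> ! h)]) = form ls B h * form_pow ls B \<gamma>"
  using assms by (simp add: form_pow_def prod_lessThan_remove[of h] mult.assoc)

section \<open>Coefficientwise operations on polynomials\<close>

lemma mpoly_induct [case_names zero single add]:
  fixes f :: "'a::comm_ring_1 mpoly"
  assumes "P 0" "\<And>m c. P (Poly_Mapping.single m c)" "\<And>f g. P f \<Longrightarrow> P g \<Longrightarrow> P (f + g)"
  shows "P f"
proof -
  have eq: "f = (\<Sum>m\<in>Poly_Mapping.keys f. Poly_Mapping.single m (Poly_Mapping.lookup f m))"
  proof (rule poly_mapping_eqI)
    fix k
    have "Poly_Mapping.lookup (\<Sum>m\<in>Poly_Mapping.keys f. Poly_Mapping.single m (Poly_Mapping.lookup f m)) k =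
          (\<Sum>m\<in>Poly_Mapping.keys f. if m = k then Poly_Mapping.lookup f k else 0)"
      unfolding lookup_sum by (intro sum.cong) (auto simp: lookup_single when_def)
    then show "Poly_Mapping.lookup f k =
      Poly_Mapping.lookup (\<Sum>m\<in>Poly_Mapping.keys f. Poly_Mapping.single m (Poly_Mapping.lookup f m)) k"
      by (simp add: sum.delta in_keys_iff)
  qed
  have "P (\<Sum>m\<in>S. Poly_Mapping.single m (Poly_Mapping.lookup f m))" for S
    by (induction S rule: infinite_finite_induct) (auto intro: assms)
  then show ?thesis using eq by metis
qed

text \<open>The coefficients of \<open>B\<close> are going to be polynomials in a parameter, which can be differentiated
  and specialised without touching the variables of the multigraded ring.\<close>

definition coeff_pderiv :: "'a::idom poly mpoly \<Rightarrow> 'a poly mpoly" where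
  "coeff_pderiv = Poly_Mapping.map pderiv"

definition coeff_eval :: "'a::comm_ring_1 \<Rightarrow> 'a poly mpoly \<Rightarrow> 'a mpoly" where
  "coeff_eval t = Poly_Mapping.map (\<lambda>p. poly p t)"

lemma lookup_coeff_pderiv [simp]:
  "Poly_Mapping.lookup (coeff_pderiv f) m = pderiv (Poly_Mapping.lookup f m)"
  by (auto simp: coeff_pderiv_def Poly_Mapping.map.rep_eq when_def)

lemma lookup_coeff_eval [simp]:
  "Poly_Mapping.lookup (coeff_eval t f) m = poly (Poly_Mapping.lookup f m) t"
  by (auto simp: coeff_eval_def Poly_Mapping.map.rep_eq when_def)

lemma coeff_pderiv_add: "coeff_pderiv (f + g) = coeff_pderiv f + coeff_pderiv g"
  by (rule poly_mapping_eqI) (simp add: lookup_add pderiv_add)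

lemma coeff_pderiv_single: "coeff_pderiv (Poly_Mapping.single m c) = Poly_Mapping.single m (pderiv c)"
  by (rule poly_mapping_eqI) (simp add: lookup_single when_def)

lemma coeff_pderiv_0 [simp]: "coeff_pderiv 0 = 0"
  by (rule poly_mapping_eqI) simp

lemma coeff_pderiv_mult: "coeff_pderiv (f * g) = coeff_pderiv f * g + f * coeff_pderiv g"
proof (induction f rule: mpoly_induct)
  case (single m c)
  show ?case
  proof (induction g rule: mpoly_induct)
    case (single k d)
    then show ?case
      by (simp add: mult_single coeff_pderiv_single pderiv_mult single_add mult.commute add.commute)
  qed (simp_all add: distrib_left coeff_pderiv_add)
qed (simp_all add: distrib_right coeff_pderiv_add)

lemma coeff_pderiv_one [simp]: "coeff_pderiv 1 = 0"
  using coeff_pderiv_single[of 0 1] by (simp only: single_one pderiv_1 single_zero)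

lemma coeff_pderiv_power: "coeff_pderiv (f ^ n) = of_nat n * f ^ (n - 1) * coeff_pderiv f"
proof (induction n)
  case (Suc n)
  have "f * (of_nat n * f ^ (n - 1) * coeff_pderiv f) = of_nat n * f ^ n * coeff_pderiv f"
  proof (cases n)
    case (Suc m)
    then show ?thesis by (simp only: diff_Suc_1 power_Suc mult_ac)
  qed simp
  then have "coeff_pderiv (f ^ Suc n) = coeff_pderiv f * f ^ n + of_nat n * f ^ n * coeff_pderiv f"
    by (simp only: power_Suc coeff_pderiv_mult Suc)
  also have "\<dots> = (1 + of_nat n) * f ^ n * coeff_pderiv f"
    by (simp only: distrib_right distrib_left mult_1_left mult_1_right mult_ac)
  finally show ?case by (simp only: of_nat_Suc diff_Suc_1)
qed simp

lemma coeff_pderiv_prod: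
  assumes "finite S"
  shows "coeff_pderiv (\<Prod>i\<in>S. f i) = (\<Sum>i\<in>S. (\<Prod>j\<in>S - {i}. f j) * coeff_pderiv (f i))"
  using assms
proof induction
  case (insert i S)
  have "(\<Sum>a\<in>S. (\<Prod>j\<in>insert i S - {a}. f j) * coeff_pderiv (f a)) =
        f i * (\<Sum>a\<in>S. (\<Prod>j\<in>S - {a}. f j) * coeff_pderiv (f a))"
    unfolding sum_distrib_left
  proof (intro sum.cong refl)
    fix a assume "a \<in> S"
    then have "insert i S - {a} = insert i (S - {a})" using insert.hyps by auto
    then show "(\<Prod>j\<in>insert i S - {a}. f j) * coeff_pderiv (f a) =
               f i * ((\<Prod>j\<in>S - {a}. f j) * coeff_pderiv (f a))"
      using insert.hyps by (simp add: mult.assoc)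
  qed
  moreover have "insert i S - {i} = S" using insert.hyps by auto
  ultimately show ?case
    using insert by (simp add: coeff_pderiv_mult mult.commute)
qed simp

lemma coeff_pderiv_homogeneous: "f \<in> homogeneous ls D \<Longrightarrow> coeff_pderiv f \<in> homogeneous ls D"
proof -
  have "Poly_Mapping.keys (coeff_pderiv f) \<subseteq> Poly_Mapping.keys f"
  proof
    fix m assume "m \<in> Poly_Mapping.keys (coeff_pderiv f)"
    then have "pderiv (Poly_Mapping.lookup f m) \<noteq> 0" by (simp add: in_keys_iff)
    then have "Poly_Mapping.lookup f m \<noteq> 0" by (metis pderiv_0)
    then show "m \<in> Poly_Mapping.keys f" by (simp add: in_keys_iff)
  qed
  then show "f \<in> homogeneous ls D \<Longrightarrow> coeff_pderiv f \<in> homogeneous ls D"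
    unfolding homogeneous_def by blast
qed

lemma coeff_eval_add: "coeff_eval t (f + g) = coeff_eval t f + coeff_eval t g"
  by (rule poly_mapping_eqI) (simp add: lookup_add)

lemma coeff_eval_0 [simp]: "coeff_eval t 0 = 0"
  by (rule poly_mapping_eqI) simp

lemma coeff_eval_single:
  "coeff_eval t (Poly_Mapping.single m c) = Poly_Mapping.single m (poly c t)"
  by (rule poly_mapping_eqI) (simp add: lookup_single when_def)

lemma coeff_eval_one [simp]: "coeff_eval t 1 = 1"
  using coeff_eval_single[of t 0 1] by (simp only: single_one poly_1)

lemma coeff_eval_mult: "coeff_eval t (f * g) = coeff_eval t f * coeff_eval t g"
proof (induction f rule: mpoly_induct)
  case (single m c)
  show ?case
    by (induction g rule: mpoly_induct)
       (simp_all add: mult_single coeff_eval_single distrib_left coeff_eval_add)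
qed (simp_all add: distrib_right coeff_eval_add)

lemma coeff_eval_sum: "coeff_eval t (\<Sum>i\<in>S. f i) = (\<Sum>i\<in>S. coeff_eval t (f i))"
  by (induction S rule: infinite_finite_induct) (simp_all add: coeff_eval_add)

lemma coeff_eval_prod: "coeff_eval t (\<Prod>i\<in>S. f i) = (\<Prod>i\<in>S. coeff_eval t (f i))"
  by (induction S rule: infinite_finite_induct) (simp_all add: coeff_eval_mult)

lemma coeff_eval_power: "coeff_eval t (f ^ n) = coeff_eval t f ^ n"
  by (induction n) (simp_all add: coeff_eval_mult)

lemma coeff_eval_form: "coeff_eval t (form ls B h) = form ls (\<lambda>is. poly (B is) t) h"
  by (simp add: form_def coeff_eval_sum coeff_eval_single)

lemma coeff_eval_monomial: "coeff_eval t (monomial \<eta>) = monomial \<eta>"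
  by (simp add: monomial_def coeff_eval_single)

lemma mult_entry_poly: "mult_entry ls (\<lambda>is. poly (B is) t) \<zeta> x = poly (mult_entry ls B \<zeta> x) t"
  by (cases x) (simp add: mult_entry_def coeff_eval_mult coeff_eval_form coeff_eval_monomial
      flip: lookup_coeff_eval)

lemma pow_entry_poly: "pow_entry ls (\<lambda>is. poly (B is) t) \<zeta> x = poly (pow_entry ls B \<zeta> x) t"
  by (cases x) (simp add: pow_entry_def form_pow_def coeff_eval_mult coeff_eval_form
      coeff_eval_monomial coeff_eval_prod coeff_eval_power flip: lookup_coeff_eval)

section \<open>The determinant of the map given by the powers of the forms\<close>

definition mult_source :: "nat list \<Rightarrow> (nat \<times> nat list list) list" where
  "mult_source ls = List.product [0..<sum_list ls + 1] (shifted_basis ls 0)"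

definition pow_source :: "nat list \<Rightarrow> nat \<Rightarrow> (nat list \<times> nat list list) list" where
  "pow_source ls d = List.product (monomials (sum_list ls + 1) d) (shifted_basis ls 0)"

definition mult_det :: "nat list \<Rightarrow> (nat list \<Rightarrow> 'a::comm_ring_1) \<Rightarrow> 'a" where
  "mult_det ls B = list_det (mult_source ls) (shifted_basis ls 1) (mult_entry ls B)"

definition pow_det :: "nat list \<Rightarrow> nat \<Rightarrow> (nat list \<Rightarrow> 'a::comm_ring_1) \<Rightarrow> 'a" where
  "pow_det ls d B = list_det (pow_source ls d) (shifted_basis ls d) (pow_entry ls B)"

lemma length_mult_source: "length (mult_source ls) = length (shifted_basis ls 1)"
  using length_source_target[of ls] by (simp add: mult_source_def)

lemma length_pow_source: "length (pow_source ls d) = length (shifted_basis ls d)"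
  using length_shifted_basis_split[of ls d] by (simp add: pow_source_def)

lemma distinct_mult_source: "distinct (mult_source ls)"
  by (simp add: mult_source_def distinct_product distinct_shifted_basis)

lemma distinct_pow_source: "distinct (pow_source ls d)"
  by (simp only: pow_source_def distinct_product distinct_shifted_basis distinct_monomials)

text \<open>The trace of $z_h \partial_{z_h}$ on $S^d$ in \<open>n\<close> variables. It is the same for all \<open>h\<close>, which
  is why the definition uses the first variable.\<close>

definition exponent_sum :: "nat \<Rightarrow> nat \<Rightarrow> nat" where
  "exponent_sum n d = (\<Sum>\<gamma>\<in>set (monomials n d). \<gamma> ! 0)"

lemma exponent_sum_eq:
  assumes "h < n"
  shows "(\<Sum>\<gamma>\<in>set (monomials n d). \<gamma> ! h) = exponent_sum n d"
proof -
  define swap where "swap = (\<lambda>\<gamma> :: nat list. \<gamma>[0 := \<gamma> ! h, h := \<gamma> ! 0])"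
  have swap: "swap \<gamma> \<in> set (monomials n d) \<and> swap (swap \<gamma>) = \<gamma> \<and> swap \<gamma> ! 0 = \<gamma> ! h"
    if "\<gamma> \<in> set (monomials n d)" for \<gamma>
  proof -
    have "mset (swap \<gamma>) = mset \<gamma>"
      unfolding swap_def using that assms by (intro mset_swap) (auto simp: set_monomials)
    then have "sum_list (swap \<gamma>) = sum_list \<gamma>"
      by (metis sum_mset_sum_list)
    moreover have "swap (swap \<gamma>) = \<gamma>"
      unfolding swap_def using that assms
      by (intro nth_equalityI) (auto simp: set_monomials nth_list_update)
    ultimately show ?thesis
      using that assms by (auto simp: set_monomials swap_def nth_list_update)
  qed
  show ?thesis
    unfolding exponent_sum_def
    by (rule sum.reindex_bij_witness[of _ swap swap]) (use swap in auto)
qed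

lemma exponent_sum_mult: "n * exponent_sum n d = d * length (monomials n d)"
proof -
  have "n * exponent_sum n d = (\<Sum>h<n. \<Sum>\<gamma>\<in>set (monomials n d). \<gamma> ! h)"
    by (simp add: exponent_sum_eq)
  also have "\<dots> = (\<Sum>\<gamma>\<in>set (monomials n d). \<Sum>h<n. \<gamma> ! h)"
    by (rule sum.swap)
  also have "\<dots> = (\<Sum>\<gamma>\<in>set (monomials n d). d)"
    by (intro sum.cong refl) (auto simp: set_monomials sum_list_conv_sum_nth)
  also have "\<dots> = d * length (monomials n d)"
    by (simp add: distinct_card[OF distinct_monomials])
  finally show ?thesis .
qed

text \<open>The exponent of $z_j \partial_{z_h} z^\gamma$, up to the factor $\gamma_h$.\<close>

definition shift_exponent :: "nat list \<Rightarrow> nat \<Rightarrow> nat \<Rightarrow> nat list" where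
  "shift_exponent \<gamma> h j = (let \<beta> = \<gamma>[h := \<gamma> ! h - 1] in \<beta>[j := Suc (\<beta> ! j)])"

lemma shift_exponent_in_monomials:
  assumes "\<gamma> \<in> set (monomials n d)" "h < n" "j < n" "\<gamma> ! h > 0"
  shows "shift_exponent \<gamma> h j \<in> set (monomials n d)"
proof -
  have "\<gamma> ! h \<le> sum_list \<gamma>"
    using assms by (intro member_le_sum_list) (auto simp: set_monomials)
  then show ?thesis
    using assms by (auto simp: set_monomials shift_exponent_def Let_def sum_list_update)
qed

lemma shift_exponent_eq_iff:
  assumes "length \<gamma> = n" "h < n" "j < n" "\<gamma> ! h > 0"
  shows "shift_exponent \<gamma> h j = \<gamma> \<longleftrightarrow> j = h"
proof
  assume "shift_exponent \<gamma> h j = \<gamma>"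
  then have "shift_exponent \<gamma> h j ! h = \<gamma> ! h" by simp
  then show "j = h"
    using assms by (auto simp: shift_exponent_def Let_def nth_list_update split: if_splits)
qed (use assms in \<open>simp add: shift_exponent_def Let_def list_update_same_conv\<close>)

lemma coeff_pderiv_form_pow:
  "coeff_pderiv (form_pow ls B \<gamma>) =
   (\<Sum>h<length \<gamma>. of_nat (\<gamma> ! h) * form_pow ls B (\<gamma>[h := \<gamma> ! h - 1]) * coeff_pderiv (form ls B h))"
proof -
  have "form_pow ls B (\<gamma>[h := \<gamma> ! h - 1]) =
        (\<Prod>i\<in>{..<length \<gamma>} - {h}. form ls B i ^ (\<gamma> ! i)) * form ls B h ^ (\<gamma> ! h - 1)"
    if "h < length \<gamma>" for h
    using that by (simp add: form_pow_def prod_lessThan_remove[of h] mult.commute)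
  then show ?thesis
    unfolding form_pow_def[of ls B \<gamma>] coeff_pderiv_prod[OF finite_lessThan] coeff_pderiv_power
    by (intro sum.cong refl) (simp add: mult_ac)
qed

lemma homogeneous_eqI:
  fixes f g :: "'a::comm_ring_1 mpoly"
  assumes "f \<in> homogeneous ls (shifted_deg ls s)" "g \<in> homogeneous ls (shifted_deg ls s)"
    and "\<And>\<zeta>. \<zeta> \<in> set (shifted_basis ls s) \<Longrightarrow>
           Poly_Mapping.lookup f (expo \<zeta>) = Poly_Mapping.lookup g (expo \<zeta>)"
  shows "f = g"
  by (subst homogeneous_expand[OF assms(1)], subst homogeneous_expand[OF assms(2)])
     (simp add: assms(3))

lemma homogeneous_const_mult:
  fixes f :: "'a::comm_ring_1 mpoly"
  assumes "f \<in> homogeneous ls D"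
  shows "Poly_Mapping.single 0 c * f \<in> homogeneous ls D"
proof -
  have "Poly_Mapping.keys (Poly_Mapping.single 0 c * f) \<subseteq> Poly_Mapping.keys f"
  proof
    fix m assume "m \<in> Poly_Mapping.keys (Poly_Mapping.single 0 c * f)"
    then have "c * Poly_Mapping.lookup f m \<noteq> 0" by (simp add: in_keys_iff lookup_const_mult)
    then have "Poly_Mapping.lookup f m \<noteq> 0" by (metis mult_zero_right)
    then show "m \<in> Poly_Mapping.keys f" by (simp add: in_keys_iff)
  qed
  then show ?thesis
    using assms unfolding homogeneous_def by blast
qed

lemma single_of_nat_mult:
  "Poly_Mapping.single 0 (of_nat k * c) = of_nat k * Poly_Mapping.single 0 (c :: 'a::comm_ring_1)"
  by (induction k) (simp_all add: distrib_right single_add)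

lemma set_mult_source: "set (mult_source ls) = {..<sum_list ls + 1} \<times> set (shifted_basis ls 0)"
  by (auto simp: mult_source_def)

lemma set_pow_source:
  "set (pow_source ls d) = set (monomials (sum_list ls + 1) d) \<times> set (shifted_basis ls 0)"
  by (simp add: pow_source_def)

text \<open>Since $\partial_B$ is invertible over the fraction field, the derivative of a form, applied to
  $T_n$, is a combination of the forms themselves. Multiplying by the determinant clears the
  denominators.\<close>

lemma form_pderiv:
  fixes B :: "nat list \<Rightarrow> 'a::field_char_0 poly"
  assumes nz: "mult_det ls B \<noteq> 0"
  obtains X where "pderiv (mult_det ls B) = (\<Sum>x\<in>set (mult_source ls). X x x)"
    and "\<And>h \<tau>. \<tau> \<in> set (shifted_basis ls 0) \<Longrightarrow>
      Poly_Mapping.single 0 (mult_det ls B) * (coeff_pderiv (form ls B h) * monomial \<tau>) =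
      (\<Sum>j<sum_list ls + 1. \<Sum>\<sigma>\<in>set (shifted_basis ls 0).
         Poly_Mapping.single 0 (X (j, \<sigma>) (h, \<tau>)) * (form ls B j * monomial \<sigma>))"
proof -
  define q where "q = mult_det ls B"
  let ?T = "shifted_basis ls 0" and ?C = "Poly_Mapping.single 0 :: 'a poly \<Rightarrow> 'a poly mpoly"
  have "\<exists>Y. \<forall>\<zeta>\<in>set (shifted_basis ls 1).
          q * pderiv (mult_entry ls B \<zeta> x) = (\<Sum>z\<in>set (mult_source ls). mult_entry ls B \<zeta> z * Y z)" for x
  proof -
    obtain Y where "\<And>\<zeta>. \<zeta> \<in> set (shifted_basis ls 1) \<Longrightarrow>
        list_det (mult_source ls) (shifted_basis ls 1) (mult_entry ls B) * pderiv (mult_entry ls B \<zeta> x) =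
        (\<Sum>z\<in>set (mult_source ls). mult_entry ls B \<zeta> z * Y z)"
      by (rule list_det_solve[OF length_mult_source distinct_mult_source distinct_shifted_basis,
        where b = "\<lambda>\<zeta>. pderiv (mult_entry ls B \<zeta> x)" and F = "mult_entry ls B"]) (rule that)
    then show ?thesis unfolding q_def mult_det_def by (intro exI[of _ Y] ballI)
  qed
  from choice[OF allI, OF this]
  obtain Y where "\<forall>x. \<forall>\<zeta>\<in>set (shifted_basis ls 1).
      q * pderiv (mult_entry ls B \<zeta> x) = (\<Sum>z\<in>set (mult_source ls). mult_entry ls B \<zeta> z * Y x z)" ..
  note Y = this[rule_format]
  define X where "X = (\<lambda>z x. Y x z)"
  have X: "q * pderiv (mult_entry ls B \<zeta> x) = (\<Sum>z\<in>set (mult_source ls). mult_entry ls B \<zeta> z * X z x)"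
    if "\<zeta> \<in> set (shifted_basis ls 1)" for x \<zeta>
    using Y[OF that] by (simp add: X_def)
  show thesis
  proof (rule that[of X])
    have "q * pderiv (list_det (mult_source ls) (shifted_basis ls 1) (mult_entry ls B)) =
          list_det (mult_source ls) (shifted_basis ls 1) (mult_entry ls B) *
          (\<Sum>x\<in>set (mult_source ls). X x x)"
      by (rule pderiv_list_det[OF length_mult_source distinct_mult_source X])
    then show "pderiv (mult_det ls B) = (\<Sum>x\<in>set (mult_source ls). X x x)"
      using nz by (simp add: q_def mult_det_def)
  next
    fix h \<tau> assume \<tau>: "\<tau> \<in> set ?T"
    have "coeff_pderiv (monomial \<tau> :: 'a poly mpoly) = 0"
      by (simp add: monomial_def coeff_pderiv_single)
    then have eq: "coeff_pderiv (form ls B h) * monomial \<tau> = coeff_pderiv (form ls B h * monomial \<tau>)"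
      by (simp add: coeff_pderiv_mult)
    have "?C q * (coeff_pderiv (form ls B h) * monomial \<tau>) =
      (\<Sum>z\<in>set (mult_source ls). ?C (X z (h, \<tau>)) * (form ls B (fst z) * monomial (snd z)))"
      (is "?l = ?r")
    proof (rule homogeneous_eqI[where ls = ls and s = 1])
      show "?l \<in> homogeneous ls (shifted_deg ls 1)"
        unfolding eq using form_monomial_homogeneous[OF \<tau>, of B h]
        by (intro homogeneous_const_mult coeff_pderiv_homogeneous) simp
      show "?r \<in> homogeneous ls (shifted_deg ls 1)"
      proof (rule homogeneous_sum)
        fix z assume "z \<in> set (mult_source ls)"
        then have "snd z \<in> set ?T" by (auto simp: set_mult_source)
        from form_monomial_homogeneous[OF this, of B "fst z"]
        show "?C (X z (h, \<tau>)) * (form ls B (fst z) * monomial (snd z)) \<in> homogeneous ls (shifted_deg ls 1)"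
          by (intro homogeneous_const_mult) simp
      qed
      fix \<zeta> assume "\<zeta> \<in> set (shifted_basis ls 1)"
      from X[OF this, of "(h, \<tau>)"]
      show "Poly_Mapping.lookup ?l (expo \<zeta>) = Poly_Mapping.lookup ?r (expo \<zeta>)"
        unfolding eq lookup_const_mult lookup_sum
        by (simp add: mult_entry_def case_prod_unfold mult.commute)
    qed
    then show "?C (mult_det ls B) * (coeff_pderiv (form ls B h) * monomial \<tau>) =
      (\<Sum>j<sum_list ls + 1. \<Sum>\<sigma>\<in>set ?T. ?C (X (j, \<sigma>) (h, \<tau>)) * (form ls B j * monomial \<sigma>))"
      unfolding set_mult_source q_def sum.cartesian_product' fst_conv snd_conv .
  qed
qed

text \<open>If the forms satisfy $q\,\delta g_h = \sum_j X_{jh} g_j$ with endomorphisms $X_{jh}$ of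
  $T_n$, then the derivation \<open>\<delta>\<close> acts on $S^d \otimes T_n$ as
  $\sum_{h,j} z_j \partial_{z_h} \otimes X_{jh}$. This is the matrix of that operator.\<close>

definition polarization ::
  "nat \<Rightarrow> (nat \<times> 'b \<Rightarrow> nat \<times> 'b \<Rightarrow> 'a::comm_ring_1) \<Rightarrow> nat list \<times> 'b \<Rightarrow> nat list \<times> 'b \<Rightarrow> 'a" where
  "polarization n X = (\<lambda>(\<gamma>', \<sigma>) (\<gamma>, \<tau>). \<Sum>h<n. \<Sum>j<n.
      if \<gamma> ! h > 0 \<and> \<gamma>' = shift_exponent \<gamma> h j then of_nat (\<gamma> ! h) * X (j, \<sigma>) (h, \<tau>) else 0)"

lemma trace_polarization:
  fixes X :: "nat \<times> 'b \<Rightarrow> nat \<times> 'b \<Rightarrow> 'a::comm_ring_1"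
  shows "(\<Sum>x\<in>set (monomials n d) \<times> T. polarization n X x x) =
    of_nat (exponent_sum n d) * (\<Sum>x\<in>{..<n} \<times> T. X x x)"
proof -
  have diag: "polarization n X (\<gamma>, \<tau>) (\<gamma>, \<tau>) = (\<Sum>h<n. of_nat (\<gamma> ! h) * X (h, \<tau>) (h, \<tau>))"
    if \<gamma>: "\<gamma> \<in> set (monomials n d)" for \<gamma> \<tau>
    unfolding polarization_def prod.case
  proof (rule sum.cong[OF refl])
    fix h assume h: "h \<in> {..<n}"
    have "(\<Sum>j<n. if \<gamma> ! h > 0 \<and> \<gamma> = shift_exponent \<gamma> h j then of_nat (\<gamma> ! h) * X (j, \<tau>) (h, \<tau>) else 0) =
          (\<Sum>j<n. if j = h then of_nat (\<gamma> ! h) * X (h, \<tau>) (h, \<tau>) else 0)"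
    proof (rule sum.cong[OF refl])
      fix j assume "j \<in> {..<n}"
      then have "0 < \<gamma> ! h \<Longrightarrow> shift_exponent \<gamma> h j = \<gamma> \<longleftrightarrow> j = h"
        using \<gamma> h by (intro shift_exponent_eq_iff[of \<gamma> n]) (auto simp: set_monomials)
      then show "(if \<gamma> ! h > 0 \<and> \<gamma> = shift_exponent \<gamma> h j then of_nat (\<gamma> ! h) * X (j, \<tau>) (h, \<tau>) else 0) =
          (if j = h then of_nat (\<gamma> ! h) * X (h, \<tau>) (h, \<tau>) else 0)"
        by (cases "\<gamma> ! h = 0") auto
    qed
    then show "(\<Sum>j<n. if \<gamma> ! h > 0 \<and> \<gamma> = shift_exponent \<gamma> h j then of_nat (\<gamma> ! h) * X (j, \<tau>) (h, \<tau>) else 0) =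
        of_nat (\<gamma> ! h) * X (h, \<tau>) (h, \<tau>)"
      using h by (simp add: sum.delta)
  qed
  have "(\<Sum>x\<in>set (monomials n d) \<times> T. polarization n X x x) =
        (\<Sum>\<gamma>\<in>set (monomials n d). \<Sum>\<tau>\<in>T. \<Sum>h<n. of_nat (\<gamma> ! h) * X (h, \<tau>) (h, \<tau>))"
    unfolding sum.cartesian_product'
    by (rule sum.cong[OF refl], rule sum.cong[OF refl], rule diag)
  also have "\<dots> = (\<Sum>\<tau>\<in>T. \<Sum>\<gamma>\<in>set (monomials n d). \<Sum>h<n. of_nat (\<gamma> ! h) * X (h, \<tau>) (h, \<tau>))"
    by (rule sum.swap)
  also have "\<dots> = (\<Sum>\<tau>\<in>T. \<Sum>h<n. \<Sum>\<gamma>\<in>set (monomials n d). of_nat (\<gamma> ! h) * X (h, \<tau>) (h, \<tau>))"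
    by (rule sum.cong[OF refl], rule sum.swap)
  also have "\<dots> = (\<Sum>\<tau>\<in>T. \<Sum>h<n. of_nat (exponent_sum n d) * X (h, \<tau>) (h, \<tau>))"
  proof (intro sum.cong refl)
    fix \<tau> h assume "h \<in> {..<n}"
    then have "(\<Sum>\<gamma>\<in>set (monomials n d). of_nat (\<gamma> ! h)) = (of_nat (exponent_sum n d) :: 'a)"
      by (simp only: of_nat_sum[symmetric] exponent_sum_eq lessThan_iff)
    then show "(\<Sum>\<gamma>\<in>set (monomials n d). of_nat (\<gamma> ! h) * X (h, \<tau>) (h, \<tau>)) =
        of_nat (exponent_sum n d) * X (h, \<tau>) (h, \<tau>)"
      by (simp only: sum_distrib_right[symmetric])
  qed
  also have "\<dots> = (\<Sum>h<n. \<Sum>\<tau>\<in>T. of_nat (exponent_sum n d) * X (h, \<tau>) (h, \<tau>))"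
    by (rule sum.swap)
  also have "\<dots> = of_nat (exponent_sum n d) * (\<Sum>x\<in>{..<n} \<times> T. X x x)"
    unfolding sum.cartesian_product' sum_distrib_left ..
  finally show ?thesis .
qed

text \<open>The product rule for $g^\gamma$ produces the factors $\gamma_h g^{\gamma - e_h} \delta g_h$, and
  $\delta g_h$ is replaced by the combination of the forms assumed here. Hence the derivative of
  $\Phi_d$ is again $\Phi_d$ followed by a matrix.\<close>

lemma pow_entry_pderiv:
  fixes B :: "nat list \<Rightarrow> 'a::field_char_0 poly"
  assumes X: "\<And>h \<tau>. \<tau> \<in> set (shifted_basis ls 0) \<Longrightarrow>
      Poly_Mapping.single 0 q * (coeff_pderiv (form ls B h) * monomial \<tau>) =
      (\<Sum>j<sum_list ls + 1. \<Sum>\<sigma>\<in>set (shifted_basis ls 0).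
         Poly_Mapping.single 0 (X (j, \<sigma>) (h, \<tau>)) * (form ls B j * monomial \<sigma>))"
    and x: "x \<in> set (pow_source ls d)"
  shows "q * pderiv (pow_entry ls B \<zeta> x) =
    (\<Sum>z\<in>set (pow_source ls d). pow_entry ls B \<zeta> z * polarization (sum_list ls + 1) X z x)"
proof -
  define n where "n = sum_list ls + 1"
  let ?T = "shifted_basis ls 0" and ?C = "Poly_Mapping.single 0 :: 'a poly \<Rightarrow> 'a poly mpoly"
  let ?M = "set (monomials n d)"
  obtain \<gamma> \<tau> where x_eq: "x = (\<gamma>, \<tau>)" by (cases x)
  have \<gamma>: "\<gamma> \<in> ?M" "length \<gamma> = n" and \<tau>: "\<tau> \<in> set ?T"
    using x by (auto simp: set_pow_source x_eq set_monomials n_def)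
  let ?c = "\<lambda>h j \<sigma>. of_nat (\<gamma> ! h) * X (j, \<sigma>) (h, \<tau>)"
  have step: "?C q * (of_nat (\<gamma> ! h) * form_pow ls B (\<gamma>[h := \<gamma> ! h - 1]) *
          coeff_pderiv (form ls B h) * monomial \<tau>) =
        (\<Sum>j<n. \<Sum>\<sigma>\<in>set ?T. if \<gamma> ! h > 0 then ?C (?c h j \<sigma>) *
           (form_pow ls B (shift_exponent \<gamma> h j) * monomial \<sigma>) else 0)" if "h < n" for h
  proof (cases "\<gamma> ! h > 0")
    case True
    let ?\<beta> = "\<gamma>[h := \<gamma> ! h - 1]"
    have "?C q * (of_nat (\<gamma> ! h) * form_pow ls B ?\<beta> * coeff_pderiv (form ls B h) * monomial \<tau>) =
          of_nat (\<gamma> ! h) * form_pow ls B ?\<beta> * (?C q * (coeff_pderiv (form ls B h) * monomial \<tau>))"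
      by (simp only: mult_ac)
    also have "\<dots> = (\<Sum>j<n. \<Sum>\<sigma>\<in>set ?T. of_nat (\<gamma> ! h) * form_pow ls B ?\<beta> *
          (?C (X (j, \<sigma>) (h, \<tau>)) * (form ls B j * monomial \<sigma>)))"
      unfolding X[OF \<tau>] n_def by (simp only: sum_distrib_left)
    also have "\<dots> = (\<Sum>j<n. \<Sum>\<sigma>\<in>set ?T. ?C (?c h j \<sigma>) *
           (form_pow ls B (shift_exponent \<gamma> h j) * monomial \<sigma>))"
    proof (intro sum.cong refl)
      fix j \<sigma> assume "j \<in> {..<n}"
      then have "form_pow ls B (shift_exponent \<gamma> h j) = form ls B j * form_pow ls B ?\<beta>"
        unfolding shift_exponent_def Let_def using \<gamma> by (intro form_pow_Suc) simp
      then show "of_nat (\<gamma> ! h) * form_pow ls B ?\<beta> *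
          (?C (X (j, \<sigma>) (h, \<tau>)) * (form ls B j * monomial \<sigma>)) =
        ?C (?c h j \<sigma>) * (form_pow ls B (shift_exponent \<gamma> h j) * monomial \<sigma>)"
        by (simp only: single_of_nat_mult mult_ac)
    qed
    finally show ?thesis using True by simp
  qed simp
  have "coeff_pderiv (monomial \<tau> :: 'a poly mpoly) = 0"
    by (simp add: monomial_def coeff_pderiv_single)
  then have "coeff_pderiv (form_pow ls B \<gamma> * monomial \<tau>) =
      (\<Sum>h<n. of_nat (\<gamma> ! h) * form_pow ls B (\<gamma>[h := \<gamma> ! h - 1]) *
          coeff_pderiv (form ls B h) * monomial \<tau>)"
    by (simp only: coeff_pderiv_mult coeff_pderiv_form_pow \<gamma>(2) sum_distrib_right mult_zero_right add_0_right)
  then have "?C q * coeff_pderiv (form_pow ls B \<gamma> * monomial \<tau>) =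
      (\<Sum>h<n. \<Sum>j<n. \<Sum>\<sigma>\<in>set ?T. if \<gamma> ! h > 0 then ?C (?c h j \<sigma>) *
           (form_pow ls B (shift_exponent \<gamma> h j) * monomial \<sigma>) else 0)"
    by (simp only: sum_distrib_left) (intro sum.cong refl, rule step, simp)
  from arg_cong[OF this, of "\<lambda>f. Poly_Mapping.lookup f (expo \<zeta>)"]
  have "q * pderiv (pow_entry ls B \<zeta> x) =
      (\<Sum>h<n. \<Sum>j<n. \<Sum>\<sigma>\<in>set ?T. Poly_Mapping.lookup (if \<gamma> ! h > 0 then ?C (?c h j \<sigma>) *
           (form_pow ls B (shift_exponent \<gamma> h j) * monomial \<sigma>) else 0) (expo \<zeta>))"
    by (simp only: lookup_const_mult lookup_sum pow_entry_def x_eq lookup_coeff_pderiv prod.case)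
  also have "\<dots> = (\<Sum>h<n. \<Sum>j<n. \<Sum>\<sigma>\<in>set ?T. \<Sum>\<gamma>'\<in>?M. pow_entry ls B \<zeta> (\<gamma>', \<sigma>) *
      (if \<gamma> ! h > 0 \<and> \<gamma>' = shift_exponent \<gamma> h j then ?c h j \<sigma> else 0))"
  proof (intro sum.cong refl)
    fix h j \<sigma> assume hj: "h \<in> {..<n}" "j \<in> {..<n}"
    show "Poly_Mapping.lookup (if \<gamma> ! h > 0 then ?C (?c h j \<sigma>) *
           (form_pow ls B (shift_exponent \<gamma> h j) * monomial \<sigma>) else 0) (expo \<zeta>) =
        (\<Sum>\<gamma>'\<in>?M. pow_entry ls B \<zeta> (\<gamma>', \<sigma>) *
        (if \<gamma> ! h > 0 \<and> \<gamma>' = shift_exponent \<gamma> h j then ?c h j \<sigma> else 0))"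
    proof (cases "\<gamma> ! h > 0")
      case True
      then have mem: "shift_exponent \<gamma> h j \<in> ?M"
        using \<gamma> hj by (intro shift_exponent_in_monomials) auto
      have "(\<Sum>\<gamma>'\<in>?M. pow_entry ls B \<zeta> (\<gamma>', \<sigma>) *
          (if \<gamma> ! h > 0 \<and> \<gamma>' = shift_exponent \<gamma> h j then ?c h j \<sigma> else 0)) =
        (\<Sum>\<gamma>'\<in>?M. if \<gamma>' = shift_exponent \<gamma> h j then
           ?c h j \<sigma> * pow_entry ls B \<zeta> (shift_exponent \<gamma> h j, \<sigma>) else 0)"
        using True by (intro sum.cong refl) (simp add: mult.commute)
      also have "\<dots> = ?c h j \<sigma> * pow_entry ls B \<zeta> (shift_exponent \<gamma> h j, \<sigma>)"
        using mem by (simp only: sum.delta finite_set if_True)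
      finally show ?thesis
        using True by (simp only: if_True lookup_const_mult pow_entry_def prod.case)
    qed simp
  qed
  also have "\<dots> = (\<Sum>h<n. \<Sum>j<n. \<Sum>z\<in>?M \<times> set ?T. pow_entry ls B \<zeta> z *
      (if \<gamma> ! h > 0 \<and> fst z = shift_exponent \<gamma> h j then ?c h j (snd z) else 0))"
  proof (intro sum.cong refl)
    fix h j
    show "(\<Sum>\<sigma>\<in>set ?T. \<Sum>\<gamma>'\<in>?M. pow_entry ls B \<zeta> (\<gamma>', \<sigma>) *
      (if \<gamma> ! h > 0 \<and> \<gamma>' = shift_exponent \<gamma> h j then ?c h j \<sigma> else 0)) =
      (\<Sum>z\<in>?M \<times> set ?T. pow_entry ls B \<zeta> z *
      (if \<gamma> ! h > 0 \<and> fst z = shift_exponent \<gamma> h j then ?c h j (snd z) else 0))"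
      by (subst sum.swap, subst sum.cartesian_product') (simp only: fst_conv snd_conv)
  qed
  also have "\<dots> = (\<Sum>h<n. \<Sum>z\<in>?M \<times> set ?T. \<Sum>j<n. pow_entry ls B \<zeta> z *
      (if \<gamma> ! h > 0 \<and> fst z = shift_exponent \<gamma> h j then ?c h j (snd z) else 0))"
    by (intro sum.cong refl, rule sum.swap)
  also have "\<dots> = (\<Sum>z\<in>?M \<times> set ?T. \<Sum>h<n. \<Sum>j<n. pow_entry ls B \<zeta> z *
      (if \<gamma> ! h > 0 \<and> fst z = shift_exponent \<gamma> h j then ?c h j (snd z) else 0))"
    by (rule sum.swap)
  also have "\<dots> = (\<Sum>z\<in>set (pow_source ls d). pow_entry ls B \<zeta> z * polarization n X z x)"
    unfolding set_pow_source polarization_def x_eq n_def case_prod_unfold fst_conv snd_conv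
    by (simp only: sum_distrib_left prod.collapse)
  finally show ?thesis unfolding n_def .
qed

text \<open>The logarithmic derivative of $\det\Phi_d$ is a multiple of the one of $\det\partial_B$, since
  both are traces that come from the same operators $X_{jh}$.\<close>

lemma mult_det_pow_det_pderiv:
  fixes B :: "nat list \<Rightarrow> 'a::field_char_0 poly"
  assumes nz: "mult_det ls B \<noteq> 0"
  shows "mult_det ls B * pderiv (pow_det ls d B) =
    of_nat (exponent_sum (sum_list ls + 1) d) * pow_det ls d B * pderiv (mult_det ls B)"
proof -
  obtain X where X: "pderiv (mult_det ls B) = (\<Sum>x\<in>set (mult_source ls). X x x)"
    "\<And>h \<tau>. \<tau> \<in> set (shifted_basis ls 0) \<Longrightarrow>
      Poly_Mapping.single 0 (mult_det ls B) * (coeff_pderiv (form ls B h) * monomial \<tau>) =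
      (\<Sum>j<sum_list ls + 1. \<Sum>\<sigma>\<in>set (shifted_basis ls 0).
         Poly_Mapping.single 0 (X (j, \<sigma>) (h, \<tau>)) * (form ls B j * monomial \<sigma>))"
    by (rule form_pderiv[OF nz]) (rule that)
  let ?Z = "polarization (sum_list ls + 1) X"
  have "mult_det ls B * pderiv (pow_det ls d B) =
        pow_det ls d B * (\<Sum>x\<in>set (pow_source ls d). ?Z x x)"
    unfolding pow_det_def
    by (rule pderiv_list_det[OF length_pow_source distinct_pow_source pow_entry_pderiv[OF X(2)]])
  also have "(\<Sum>x\<in>set (pow_source ls d). ?Z x x) =
      of_nat (exponent_sum (sum_list ls + 1) d) * pderiv (mult_det ls B)"
    unfolding X(1) set_pow_source set_mult_source by (rule trace_polarization)
  finally show ?thesis by (simp only: mult_ac)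
qed

text \<open>Comparing leading coefficients shows that every nonzero solution \<open>p\<close> has the degree of \<open>q\<close>. A
  suitable multiple of \<open>q\<close>, which is itself a solution, can then be subtracted from \<open>p\<close> to lower the
  degree, so the difference vanishes.\<close>

lemma poly_eq_smult_of_wronskian:
  fixes p q :: "'a::field_char_0 poly"
  assumes "q \<noteq> 0" and "pderiv p * q = p * pderiv q"
  shows "\<exists>c. p = smult c q"
proof -
  have degree_le: "degree r = degree q" if "r \<noteq> 0" "pderiv r * q = r * pderiv q" for r :: "'a poly"
  proof (cases "degree r = 0")
    case True
    then have "pderiv r = 0" by (simp add: pderiv_eq_0_iff)
    with that have "pderiv q = 0" by auto
    with True show ?thesis by (simp add: pderiv_eq_0_iff)
  next
    case False
    then have nz: "pderiv r \<noteq> 0" by (simp add: pderiv_eq_0_iff)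
    with that assms have nz': "pderiv q \<noteq> 0" by (metis mult_eq_0_iff)
    have "lead_coeff (pderiv r) * lead_coeff q = lead_coeff r * lead_coeff (pderiv q)"
      using that by (metis lead_coeff_mult)
    moreover have "lead_coeff (pderiv s) = of_nat (degree s) * lead_coeff s" if "pderiv s \<noteq> 0" for s :: "'a poly"
      using that by (auto simp: degree_pderiv coeff_pderiv pderiv_eq_0_iff)
    ultimately have "of_nat (degree r) * (lead_coeff r * lead_coeff q) =
                     of_nat (degree q) * (lead_coeff r * lead_coeff q)"
      using nz nz' by (simp add: mult_ac)
    then have "(of_nat (degree r) :: 'a) = of_nat (degree q)"
      using that assms by simp
    then show ?thesis by simp
  qed
  show ?thesis
  proof (cases "p = 0")
    case False
    define c where "c = lead_coeff p / lead_coeff q"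
    define r where "r = p - smult c q"
    have deg: "degree p = degree q" by (rule degree_le) (use False assms in auto)
    have "r = 0"
    proof (rule ccontr)
      assume r: "r \<noteq> 0"
      have "pderiv r * q = r * pderiv q"
        using assms by (simp add: r_def pderiv_diff pderiv_smult algebra_simps)
      then have "degree r = degree q" by (rule degree_le[OF r])
      moreover have "coeff r (degree q) = 0"
        using deg assms by (simp add: r_def c_def)
      ultimately show False using r by (metis leading_coeff_0_iff)
    qed
    then show ?thesis by (auto simp: r_def)
  qed (auto intro: exI[of _ 0])
qed

text \<open>The differential equation is solved along the line from \<open>B0\<close> to \<open>B\<close>. So $\det\Phi_d$ is a
  constant multiple of a power of $\det\partial_B$, and the constant is read off at \<open>B0\<close>.\<close>

lemma pow_det_eq:
  fixes B B0 :: "nat list \<Rightarrow> 'a::field_char_0" and d :: nat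
  assumes nz: "mult_det ls B0 \<noteq> 0"
  defines "e \<equiv> exponent_sum (sum_list ls + 1) d"
  shows "pow_det ls d B * mult_det ls B0 ^ e = pow_det ls d B0 * mult_det ls B ^ e"
proof -
  define L where "L = (\<lambda>is. [:B0 is, B is - B0 is:])"
  define p q where "p = pow_det ls d L" and "q = mult_det ls L"
  have L: "(\<lambda>is. poly (L is) 0) = B0" "(\<lambda>is. poly (L is) 1) = B" by (simp_all add: L_def)
  have eval: "poly p t = pow_det ls d (\<lambda>is. poly (L is) t)" "poly q t = mult_det ls (\<lambda>is. poly (L is) t)" for t
    unfolding p_def q_def pow_det_def mult_det_def pow_entry_poly mult_entry_poly
    by (rule list_det_poly[symmetric])+
  have q: "poly q 0 \<noteq> 0" using nz by (simp add: eval L)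
  then have "q \<noteq> 0" by auto
  then have ode: "q * pderiv p = of_nat e * p * pderiv q"
    unfolding p_def q_def e_def by (rule mult_det_pow_det_pderiv)
  have "pderiv p * q ^ e = p * pderiv (q ^ e)"
  proof (cases e)
    case 0
    with ode \<open>q \<noteq> 0\<close> show ?thesis by simp
  next
    case (Suc e')
    have "pderiv p * q ^ e = q ^ e' * (q * pderiv p)" by (simp add: Suc mult_ac)
    also have "\<dots> = p * pderiv (q ^ e)"
      unfolding ode by (simp add: Suc pderiv_power_Suc mult_ac of_nat_poly del: power_Suc of_nat_Suc)
    finally show ?thesis .
  qed
  then obtain c where c: "p = smult c (q ^ e)"
    using poly_eq_smult_of_wronskian[of "q ^ e" p] \<open>q \<noteq> 0\<close> by auto
  have "poly p 1 * poly q 0 ^ e = poly p 0 * poly q 1 ^ e"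
    by (simp add: c)
  then show ?thesis by (simp add: eval L)
qed

section \<open>Integral spans and the Dedekind--Mertens lemma\<close>

text \<open>Additive subgroups are used, not ideals: this keeps track of the multidegree and of the
  integrality of the coefficients at the same time.\<close>

inductive_set int_span :: "'a::ab_group_add set \<Rightarrow> 'a set" for S where
  zero: "0 \<in> int_span S"
| base: "x \<in> S \<Longrightarrow> x \<in> int_span S"
| diff: "x \<in> int_span S \<Longrightarrow> y \<in> int_span S \<Longrightarrow> x - y \<in> int_span S"

lemma int_span_subset:
  assumes "S \<subseteq> int_span T"
  shows "int_span S \<subseteq> int_span T"
proof
  fix x assume "x \<in> int_span S"
  then show "x \<in> int_span T"
    by induction (use assms in \<open>auto intro: int_span.intros\<close>)
qed

lemma int_span_mult:
  fixes a :: "'a::comm_ring_1"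
  assumes "x \<in> int_span S" "\<And>y. y \<in> S \<Longrightarrow> a * y \<in> int_span T"
  shows "a * x \<in> int_span T"
  using assms(1)
  by induction (auto intro: int_span.intros assms(2) simp: right_diff_distrib)

lemma int_span_image_finite:
  fixes G :: "'i \<Rightarrow> 'a::comm_ring_1"
  assumes "x \<in> int_span (G ` S)" "finite S"
  shows "\<exists>c. x = (\<Sum>s\<in>S. of_int (c s) * G s)"
  using assms(1)
proof induction
  case zero
  show ?case by (rule exI[of _ "\<lambda>_. 0"]) simp
next
  case (base x)
  then obtain t where t: "t \<in> S" "x = G t" by auto
  have "(\<Sum>s\<in>S. of_int (if s = t then 1 else 0) * G s) = (\<Sum>s\<in>S. if s = t then G t else 0)"
    by (intro sum.cong) auto
  then show ?case
    using t assms(2) by (intro exI[of _ "\<lambda>s. if s = t then 1 else 0"]) (simp add: sum.delta)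
next
  case (diff x y)
  then obtain c d where "x = (\<Sum>s\<in>S. of_int (c s) * G s)" "y = (\<Sum>s\<in>S. of_int (d s) * G s)"
    by blast
  then show ?case
    by (intro exI[of _ "\<lambda>s. c s - d s"]) (simp add: left_diff_distrib sum_subtractf)
qed

text \<open>With \<open>c\<close> for the content, \<open>content_mult f n g\<close> is the additive version of $c(f)^n c(g)$.\<close>

primrec coeff_products :: "'a::comm_ring_1 poly \<Rightarrow> nat \<Rightarrow> 'a set" where
  "coeff_products f 0 = {1}"
| "coeff_products f (Suc n) = {coeff f i * w | i w. w \<in> coeff_products f n}"

definition content_mult :: "'a::comm_ring_1 poly \<Rightarrow> nat \<Rightarrow> 'a poly \<Rightarrow> 'a set" where
  "content_mult f n g = int_span {coeff g h * w | h w. w \<in> coeff_products f n}"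

lemma content_multI: "w \<in> coeff_products f n \<Longrightarrow> coeff g h * w \<in> content_mult f n g"
  unfolding content_mult_def by (rule int_span.base) auto

lemma content_mult_diff:
  "x \<in> content_mult f n g \<Longrightarrow> y \<in> content_mult f n g \<Longrightarrow> x - y \<in> content_mult f n g"
  unfolding content_mult_def by (rule int_span.diff)

text \<open>The Dedekind--Mertens lemma $c(f)^{n+1} c(g) \subseteq c(f)^n c(fg)$ for \<open>g\<close> of degree at most
  \<open>n\<close>. Both polynomials are shortened by their leading terms. A product of coefficients of \<open>f\<close> that
  avoids the leading one is treated by induction on the length of \<open>f\<close>, at the price of a term that
  contains the leading coefficient of \<open>f\<close>. Such terms (the fact \<open>lead\<close> below) are treated by
  induction on the length of \<open>g\<close>, because the product of the two leading coefficients is a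
  coefficient of \<open>f * g\<close>.\<close>

lemma dedekind_mertens:
  fixes f g :: "'a::comm_ring_1 poly"
  assumes "\<And>i. i > n \<Longrightarrow> coeff g i = 0"
  shows "w \<in> coeff_products f (Suc n) \<Longrightarrow> coeff g j * w \<in> content_mult f n (f * g)"
proof -
  \<comment> \<open>\<open>N\<close> and \<open>M\<close> bound the numbers of coefficients, so that 0 stands for the zero polynomial.\<close>
  have "\<forall>f g :: 'a poly. (\<forall>i\<ge>N. coeff g i = 0) \<longrightarrow> (\<forall>i\<ge>M. coeff f i = 0) \<longrightarrow>
      (\<forall>j. \<forall>w\<in>coeff_products f N. coeff g j * w \<in> content_mult f (N - 1) (f * g))" for N M
  proof (induction N arbitrary: M)
    case 0
    show ?case
    proof (intro allI impI ballI)
      fix f g :: "'a poly" and j w assume "\<forall>i\<ge>0. coeff g i = 0"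
      then show "coeff g j * w \<in> content_mult f (0 - 1) (f * g)"
        by (simp add: content_mult_def int_span.zero)
    qed
  next
    case (Suc n)
    note IH_n = Suc.IH[rule_format]
    show ?case
    proof (induction M)
      case 0
      show ?case
      proof (intro allI impI ballI)
        fix f g :: "'a poly" and j w
        assume "\<forall>i\<ge>0. coeff f i = 0" "w \<in> coeff_products f (Suc n)"
        then have "w = 0" by auto
        then show "coeff g j * w \<in> content_mult f (Suc n - 1) (f * g)"
          by (simp add: content_mult_def int_span.zero)
      qed
    next
      case (Suc m)
      note IH_m = Suc.IH[rule_format]
      show ?case
      proof (intro allI impI ballI)
        fix f g :: "'a poly" and j w
        assume g: "\<forall>i\<ge>Suc n. coeff g i = 0" and f: "\<forall>i\<ge>Suc m. coeff f i = 0"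
          and w: "w \<in> coeff_products f (Suc n)"
        let ?J = "content_mult f n (f * g)"
        define f' g' where "f' = f - monom (coeff f m) m" and "g' = g - monom (coeff g n) n"
        have f': "coeff f' i = (if i = m then 0 else coeff f i)" for i by (simp add: f'_def)
        have g': "coeff g' i = (if i = n then 0 else coeff g i)" for i by (simp add: g'_def)
        have top: "coeff (f * g) (m + n) = coeff f m * coeff g n"
        proof -
          have "coeff f i * coeff g (m + n - i) = (if i = m then coeff f m * coeff g n else 0)"
            if "i \<le> m + n" for i
            using f g that by (cases i m rule: linorder_cases) auto
          then have "coeff (f * g) (m + n) = (\<Sum>i\<le>m + n. if i = m then coeff f m * coeff g n else 0)"
            unfolding coeff_mult by (intro sum.cong) auto
          then show ?thesis by (simp add: sum.delta)
        qed
        have lead: "coeff f m * (coeff g j * u) \<in> ?J" if u: "u \<in> coeff_products f n" for j u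
        proof (cases "j < n")
          case False
          then consider "j = n" | "coeff g j = 0" using g by force
          then show ?thesis
          proof cases
            case 1
            have "coeff (f * g) (m + n) * u \<in> ?J" by (rule content_multI[OF u])
            then show ?thesis by (simp add: top 1 mult.assoc)
          qed (simp add: content_mult_def int_span.zero)
        next
          case True
          then obtain n' where n': "n = Suc n'" by (cases n) auto
          have "coeff g' j * u \<in> content_mult f (n - 1) (f * g')"
            by (rule IH_n[of g' "Suc m"]) (use f g u in \<open>auto simp: g'\<close>)
          then have "coeff g j * u \<in> content_mult f n' (f * g')"
            using True by (simp add: g' n')
          then show ?thesis
            unfolding content_mult_def[of f n']
          proof (rule int_span_mult[of _ _ "coeff f m" "{coeff (f * g) h * w | h w. w \<in> coeff_products f n}",
                folded content_mult_def])
            fix y assume "y \<in> {coeff (f * g') h * w | h w. w \<in> coeff_products f n'}"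
            then obtain h v where y: "y = coeff (f * g') h * v" and v: "v \<in> coeff_products f n'" by auto
            define c where "c = (if h < n then 0 else coeff f (h - n))"
            have eq: "coeff (f * g') h = coeff (f * g) h - coeff g n * c"
              unfolding g'_def right_diff_distrib coeff_diff
              by (simp add: coeff_monom_mult mult.commute[of f] c_def)
            have "coeff f m * y =
                coeff (f * g) h * (coeff f m * v) - coeff (f * g) (m + n) * (c * v)"
              unfolding y top eq by (simp add: algebra_simps)
            moreover have "coeff (f * g) h * (coeff f m * v) \<in> ?J"
              by (rule content_multI) (use v n' in auto)
            moreover have "coeff (f * g) (m + n) * (c * v) \<in> ?J"
            proof (cases "h < n")
              case False
              then show ?thesis by (intro content_multI) (use v n' in \<open>auto simp: c_def\<close>)
            qed (simp add: c_def content_mult_def int_span.zero)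
            ultimately show "coeff f m * y \<in> ?J" by (simp add: content_mult_diff)
          qed
        qed
        have products: "u \<in> coeff_products f' k \<or> (\<exists>i v. k = Suc i \<and> v \<in> coeff_products f i \<and> u = coeff f m * v)"
          if "u \<in> coeff_products f k" for k u
          using that
        proof (induction k arbitrary: u)
          case (Suc k)
          then obtain i v where u: "u = coeff f i * v" and v: "v \<in> coeff_products f k" by auto
          show ?case
          proof (cases "i = m")
            case True
            with u v show ?thesis by blast
          next
            case False
            from Suc.IH[OF v] show ?thesis
            proof
              assume "v \<in> coeff_products f' k"
              then have "coeff f' i * v \<in> coeff_products f' (Suc k)" by auto
              then show ?thesis using False by (simp add: u f')
            next
              assume "\<exists>i v'. k = Suc i \<and> v' \<in> coeff_products f i \<and> v = coeff f m * v'"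
              then obtain i' v' where "k = Suc i'" "v' \<in> coeff_products f i'" "v = coeff f m * v'" by blast
              then have "coeff f i * v' \<in> coeff_products f k" "u = coeff f m * (coeff f i * v')"
                using u by (auto simp: mult.left_commute)
              then show ?thesis by blast
            qed
          qed
        qed simp
        have sub: "coeff_products f' k \<subseteq> coeff_products f k \<union> {0}" for k
        proof (induction k)
          case (Suc k)
          show ?case
          proof
            fix u assume "u \<in> coeff_products f' (Suc k)"
            then obtain i v where u: "u = coeff f' i * v" and v: "v \<in> coeff_products f' k" by auto
            show "u \<in> coeff_products f (Suc k) \<union> {0}"
            proof (cases "i = m \<or> v = 0")
              case False
              then have "v \<in> coeff_products f k" "coeff f' i = coeff f i" using v Suc by (auto simp: f')
              then show ?thesis using u by auto
            qed (auto simp: u f')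
          qed
        qed simp
        from products[OF w] show "coeff g j * w \<in> content_mult f (Suc n - 1) (f * g)"
        proof
          assume w': "w \<in> coeff_products f' (Suc n)"
          have "coeff g j * w \<in> content_mult f' (Suc n - 1) (f' * g)"
            by (rule IH_m) (use f g w' in \<open>auto simp: f' Suc_le_eq\<close>)
          moreover have "content_mult f' n (f' * g) \<subseteq> ?J"
            unfolding content_mult_def[of f'] content_mult_def[of f]
          proof (rule int_span_subset, fold content_mult_def[of f], safe)
            fix h v assume v: "v \<in> coeff_products f' n"
            show "coeff (f' * g) h * v \<in> ?J"
            proof (cases "v = 0")
              case False
              then have v': "v \<in> coeff_products f n" using sub v by auto
              define c where "c = (if h < m then 0 else coeff g (h - m))"
              have "coeff (f' * g) h = coeff (f * g) h - coeff f m * c"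
                unfolding f'_def left_diff_distrib coeff_diff
                by (simp add: coeff_monom_mult c_def)
              then have "coeff (f' * g) h * v = coeff (f * g) h * v - coeff f m * (c * v)"
                by (simp only: left_diff_distrib mult.assoc)
              moreover have "coeff f m * (c * v) \<in> ?J"
                using lead[OF v'] by (auto simp: c_def content_mult_def int_span.zero)
              ultimately show ?thesis
                using content_multI[OF v'] by (simp add: content_mult_diff)
            qed (simp add: content_mult_def int_span.zero)
          qed
          ultimately show ?thesis by auto
        next
          assume "\<exists>i v. Suc n = Suc i \<and> v \<in> coeff_products f i \<and> w = coeff f m * v"
          then show ?thesis using lead by (auto simp: mult.left_commute)
        qed
      qed
    qed
  qed
  from this[of "Suc n" "Suc (degree f)"] assms
  show "w \<in> coeff_products f (Suc n) \<Longrightarrow> coeff g j * w \<in> content_mult f n (f * g)"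
    by (auto simp: coeff_eq_0)
qed


section \<open>The identity matrix is unimodular\<close>

text \<open>The inverse has an integral determinant \<open>z\<close>. For integral entries \<open>F\<close> this leaves 1 and
  -1 as the only possibilities.\<close>

lemma list_det_unit:
  fixes F :: "'y \<Rightarrow> 'x \<Rightarrow> 'a::comm_ring_1"
  assumes len: "length xs = length ys" and dist: "distinct xs" "distinct ys"
    and inv: "\<And>\<zeta>. \<zeta> \<in> set ys \<Longrightarrow> \<exists>c. \<forall>\<xi>\<in>set ys.
          (\<Sum>x\<in>set xs. F \<xi> x * of_int (c x)) = (if \<xi> = \<zeta> then 1 else 0)"
  shows "\<exists>z :: int. list_det xs ys F * of_int z = 1"
proof -
  have "\<exists>c. \<forall>\<zeta>\<in>set ys. \<forall>\<xi>\<in>set ys.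
          (\<Sum>x\<in>set xs. F \<xi> x * of_int (c \<zeta> x)) = (if \<xi> = \<zeta> then 1 else 0)"
    by (rule bchoice, rule ballI, rule inv)
  then obtain c where c: "\<And>\<zeta> \<xi>. \<zeta> \<in> set ys \<Longrightarrow> \<xi> \<in> set ys \<Longrightarrow>
      (\<Sum>x\<in>set xs. F \<xi> x * of_int (c \<zeta> x)) = (if \<xi> = \<zeta> then 1 else 0)"
    by blast
  let ?C = "\<lambda>x \<zeta>. of_int (c \<zeta> x) :: 'a"
  have "list_det xs ys F * list_det ys xs ?C =
        list_det ys ys (\<lambda>\<xi> \<zeta>. \<Sum>x\<in>set xs. F \<xi> x * ?C x \<zeta>)"
    by (rule list_det_mult[symmetric]) (use len dist in auto)
  also have "\<dots> = list_det ys ys (\<lambda>\<xi> \<zeta>. if \<xi> = \<zeta> then 1 else 0)"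
    by (rule list_det_cong) (rule c)
  also have "\<dots> = 1" by (rule list_det_id[OF dist(2)])
  finally have "list_det xs ys F * list_det ys xs ?C = 1" .
  moreover have "list_det ys xs ?C \<in> \<int>" by (rule list_det_Ints) simp
  ultimately show ?thesis by (auto elim!: Ints_cases)
qed

text \<open>If the polynomials \<open>G x\<close> span all monomials of $T_{n+s}$ over the integers, their coefficient
  matrix has an integral right inverse.\<close>

lemma list_det_unit_if_span:
  fixes G :: "'x \<Rightarrow> 'a::comm_ring_1 mpoly"
  assumes len: "length xs = length (shifted_basis ls s)" and dist: "distinct xs"
    and span: "\<And>m. m \<in> expos ls (shifted_deg ls s) \<Longrightarrow> Poly_Mapping.single m 1 \<in> int_span (G ` set xs)"
  shows "\<exists>z :: int. list_det xs (shifted_basis ls s) (\<lambda>\<zeta> x. Poly_Mapping.lookup (G x) (expo \<zeta>)) * of_int z = 1"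
proof (rule list_det_unit[OF len dist distinct_shifted_basis])
  fix \<zeta> assume \<zeta>: "\<zeta> \<in> set (shifted_basis ls s)"
  then have "expo \<zeta> \<in> expos ls (shifted_deg ls s)" by (auto simp flip: expo_image)
  from int_span_image_finite[OF span[OF this] finite_set]
  obtain c where c: "Poly_Mapping.single (expo \<zeta>) 1 = (\<Sum>x\<in>set xs. of_int (c x) * G x)" by blast
  have "(\<Sum>x\<in>set xs. Poly_Mapping.lookup (G x) (expo \<xi>) * of_int (c x)) = (if \<xi> = \<zeta> then 1 else 0)"
    if \<xi>: "\<xi> \<in> set (shifted_basis ls s)" for \<xi>
  proof -
    have "(\<Sum>x\<in>set xs. Poly_Mapping.lookup (G x) (expo \<xi>) * of_int (c x)) =
          Poly_Mapping.lookup (\<Sum>x\<in>set xs. of_int (c x) * G x) (expo \<xi>)"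
      unfolding lookup_sum
      by (intro sum.cong refl, simp only: single_of_int[symmetric] lookup_const_mult, rule mult.commute)
    also have "\<dots> = (if \<xi> = \<zeta> then 1 else 0)"
      unfolding c[symmetric] lookup_single when_def
      using inj_onD[OF inj_on_expo _ \<zeta> \<xi>] by auto
    finally show ?thesis .
  qed
  then show "\<exists>c. \<forall>\<xi>\<in>set (shifted_basis ls s).
      (\<Sum>x\<in>set xs. Poly_Mapping.lookup (G x) (expo \<xi>) * of_int (c x)) = (if \<xi> = \<zeta> then 1 else 0)"
    by blast
qed

abbreviation id_form :: "nat list \<Rightarrow> nat \<Rightarrow> complex mpoly" where
  "id_form ls \<equiv> form ls identity_multimat"

lemma id_form_eq:
  "id_form ls h = (\<Sum>is\<in>{is \<in> indices ls. sum_list is = h}. Poly_Mapping.single (unit_expo is) 1)"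
proof -
  have "id_form ls h = (\<Sum>is\<in>indices ls. if sum_list is = h then Poly_Mapping.single (unit_expo is) 1 else 0)"
    unfolding form_def by (intro sum.cong refl) (auto simp: identity_multimat_def)
  then show ?thesis by (simp add: sum.inter_filter)
qed

lemma sum_list_indices_le: "is \<in> indices ls \<Longrightarrow> sum_list is \<le> sum_list ls"
  by (auto simp: indices_def sum_list_conv_sum_nth intro: sum_mono)

lemma id_form_eq_0: "h > sum_list ls \<Longrightarrow> id_form ls h = 0"
  unfolding id_form_eq using sum_list_indices_le by (intro sum.neutral) fastforce

definition var_expo :: "nat \<Rightarrow> nat \<Rightarrow> nat \<Rightarrow> nat \<Rightarrow> nat" where
  "var_expo q i = (\<lambda>j' i'. if j' = q \<and> i' = i then 1 else 0)"

definition var :: "nat \<Rightarrow> nat \<Rightarrow> complex mpoly" where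
  "var q i = Poly_Mapping.single (var_expo q i) 1"

definition var_poly :: "nat \<Rightarrow> nat \<Rightarrow> complex mpoly poly" where
  "var_poly q l = (\<Sum>i\<le>l. monom (var q i) i)"

definition id_form_poly :: "nat list \<Rightarrow> complex mpoly poly" where
  "id_form_poly ls = (\<Sum>h\<le>sum_list ls. monom (id_form ls h) h)"

lemma coeff_sum_monom:
  "coeff (\<Sum>i\<le>(n::nat). monom (c i) i) h = (if h \<le> n then c h else 0)"
  by (simp add: coeff_sum sum.delta)

lemma coeff_var_poly: "coeff (var_poly q l) i = (if i \<le> l then var q i else 0)"
  by (simp add: var_poly_def coeff_sum_monom)

lemma coeff_id_form_poly: "coeff (id_form_poly ls) h = id_form ls h"
  by (simp add: id_form_poly_def coeff_sum_monom id_form_eq_0)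

lemma unit_expo_append:
  "length is = q \<Longrightarrow> unit_expo (is @ [i]) = unit_expo is + var_expo q i"
  by (auto simp: fun_eq_iff unit_expo_def var_expo_def nth_append)

text \<open>The forms of the identity matrix are the coefficients of the product of the generic
  polynomials \<open>var_poly 0 l\<^sub>1, var_poly 1 l\<^sub>2, \<dots>\<close> in one variable, which is why the lemma of Dedekind
  and Mertens applies to them.\<close>

lemma id_form_append:
  "id_form (ls @ [l]) h = coeff (var_poly (length ls) l * id_form_poly ls) h"
proof -
  have "id_form (ls @ [l]) h = (\<Sum>(is, i)\<in>{(is, i). is \<in> indices ls \<and> i \<le> l \<and> sum_list is + i = h}.
          Poly_Mapping.single (unit_expo is) 1 * var (length ls) i)"
    unfolding id_form_eq
  proof (rule sum.reindex_bij_witness[of _ "\<lambda>(is, i). is @ [i]" "\<lambda>xs. (butlast xs, last xs)"])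
    fix xs assume "xs \<in> {xs \<in> indices (ls @ [l]). sum_list xs = h}"
    then obtain "is" i where "xs = is @ [i]" "is \<in> indices ls" "i \<le> l" "sum_list is + i = h"
      by (auto simp: indices_append indices_singleton)
    moreover from this have "length is = length ls" by (simp add: indices_def)
    ultimately show "(case (butlast xs, last xs) of (is, i) \<Rightarrow> is @ [i]) = xs"
      "(butlast xs, last xs) \<in> {(is, i). is \<in> indices ls \<and> i \<le> l \<and> sum_list is + i = h}"
      "(case (butlast xs, last xs) of (is, i) \<Rightarrow> Poly_Mapping.single (unit_expo is) 1 * var (length ls) i) =
         Poly_Mapping.single (unit_expo xs) 1"
      by (auto simp: var_def mult_single unit_expo_append)
  qed (auto simp: indices_append indices_singleton)
  also have "{(is, i). is \<in> indices ls \<and> i \<le> l \<and> sum_list is + i = h} =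
      (\<lambda>(i, is). (is, i)) ` (SIGMA i:{i. i \<le> l \<and> i \<le> h}. {is \<in> indices ls. sum_list is = h - i})"
    by (auto simp: image_iff)
  also have "(\<Sum>(is, i)\<in>\<dots>. Poly_Mapping.single (unit_expo is) 1 * var (length ls) i) =
      (\<Sum>(i, is)\<in>(SIGMA i:{i. i \<le> l \<and> i \<le> h}. {is \<in> indices ls. sum_list is = h - i}).
          Poly_Mapping.single (unit_expo is) 1 * var (length ls) i)"
    by (subst sum.reindex) (auto simp: inj_on_def case_prod_unfold)
  also have "\<dots> = (\<Sum>i\<in>{i. i \<le> l \<and> i \<le> h}. var (length ls) i * id_form ls (h - i))"
    unfolding id_form_eq sum_distrib_left
    by (subst sum.Sigma[symmetric]) (auto simp: mult.commute)
  also have "\<dots> = (\<Sum>i\<le>h. if i \<le> l then var (length ls) i * id_form ls (h - i) else 0)"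
    by (rule sum.mono_neutral_cong_left) auto
  also have "\<dots> = coeff (var_poly (length ls) l * id_form_poly ls) h"
    unfolding coeff_mult coeff_var_poly coeff_id_form_poly by (intro sum.cong refl) auto
  finally show ?thesis .
qed

definition column_expos :: "nat \<Rightarrow> nat \<Rightarrow> nat \<Rightarrow> (nat \<Rightarrow> nat \<Rightarrow> nat) set" where
  "column_expos q l s = {m. (\<forall>j i. m j i \<noteq> 0 \<longrightarrow> j = q \<and> i \<le> l) \<and> (\<Sum>i\<le>l. m q i) = s}"

lemma single_in_coeff_products:
  "m \<in> column_expos q l s \<Longrightarrow> Poly_Mapping.single m 1 \<in> coeff_products (var_poly q l) s"
proof (induction s arbitrary: m)
  case 0
  have "m j i = 0" for j i
  proof (rule ccontr)
    assume "m j i \<noteq> 0"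
    moreover from this have "j = q" "i \<le> l" using 0 unfolding column_expos_def by blast+
    ultimately show False using 0 by (auto simp: column_expos_def)
  qed
  then have "m = 0" by (auto simp: fun_eq_iff)
  then show ?case by (simp only: coeff_products.simps singleton_iff single_one)
next
  case (Suc s)
  then have "(\<Sum>i\<le>l. m q i) \<noteq> 0" by (simp add: column_expos_def)
  then obtain i where i: "i \<le> l" "m q i \<noteq> 0" by (metis atMost_iff sum.neutral)
  define m' where "m' = (\<lambda>j' i'. if j' = q \<and> i' = i then m q i - 1 else m j' i')"
  have m: "m = var_expo q i + m'"
    using i by (auto simp: fun_eq_iff m'_def var_expo_def)
  have "(\<Sum>i'\<le>l. m q i') = (\<Sum>i'\<le>l. if i' = i then 1 else 0) + (\<Sum>i'\<le>l. m' q i')"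
    unfolding m by (simp add: var_expo_def sum.distrib)
  also have "(\<Sum>i'\<le>l. if i' = i then 1 else 0) = (1 :: nat)"
    using i(1) by (simp add: sum.delta)
  finally have "(\<Sum>i'\<le>l. m' q i') = s"
    using Suc.prems by (simp add: column_expos_def)
  moreover have "j = q \<and> i' \<le> l" if "m' j i' \<noteq> 0" for j i'
  proof -
    have "m j i' \<noteq> 0" using that i by (simp add: m'_def split: if_splits)
    then show ?thesis using Suc.prems unfolding column_expos_def by blast
  qed
  ultimately have "m' \<in> column_expos q l s"
    unfolding column_expos_def by blast
  then have "coeff (var_poly q l) i * Poly_Mapping.single m' 1 \<in> coeff_products (var_poly q l) (Suc s)"
    using Suc.IH by auto
  moreover have "coeff (var_poly q l) i * Poly_Mapping.single m' 1 = Poly_Mapping.single m 1"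
    using i(1) by (simp add: m coeff_var_poly var_def mult_single)
  ultimately show ?case by (simp only:)
qed

lemma coeff_products_var_poly:
  assumes "u \<in> coeff_products (var_poly q l) s"
  shows "u = 0 \<or> (\<exists>m\<in>column_expos q l s. u = Poly_Mapping.single m 1)"
  using assms
proof (induction s arbitrary: u)
  case 0
  have "(0 :: nat \<Rightarrow> nat \<Rightarrow> nat) \<in> column_expos q l 0" by (simp add: column_expos_def)
  moreover have "u = Poly_Mapping.single 0 1"
    using 0 by (simp only: coeff_products.simps singleton_iff single_one)
  ultimately show ?case by blast
next
  case (Suc s)
  then obtain i v where u: "u = coeff (var_poly q l) i * v" and v: "v \<in> coeff_products (var_poly q l) s"
    by auto
  from Suc.IH[OF v] show ?case
  proof
    assume "\<exists>m\<in>column_expos q l s. v = Poly_Mapping.single m 1"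
    then obtain m where m: "m \<in> column_expos q l s" "v = Poly_Mapping.single m 1" by blast
    show ?thesis
    proof (cases "i \<le> l")
      case True
      have "(\<Sum>i'\<le>l. var_expo q i q i') = 1"
        using True by (simp add: var_expo_def sum.delta)
      then have "var_expo q i + m \<in> column_expos q l (Suc s)"
        using m True by (auto simp: column_expos_def sum.distrib var_expo_def split: if_splits)
      moreover have "u = Poly_Mapping.single (var_expo q i + m) 1"
        using True by (simp add: u m coeff_var_poly var_def mult_single)
      ultimately show ?thesis by blast
    qed (simp add: u coeff_var_poly)
  qed (simp add: u)
qed

definition id_products :: "nat list \<Rightarrow> complex mpoly set" where
  "id_products ls = {id_form ls h * Poly_Mapping.single m 1 | h m.
     h \<le> sum_list ls \<and> m \<in> expos ls (shifted_deg ls 0)}"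

lemma expos_append:
  assumes "m \<in> expos ls (shifted_deg ls s)" "m' \<in> column_expos (length ls) l (sum_list ls + s)"
  shows "m + m' \<in> expos (ls @ [l]) (shifted_deg (ls @ [l]) s)"
proof -
  have "j < length (ls @ [l]) \<and> i \<le> (ls @ [l]) ! j" if "(m + m') j i \<noteq> 0" for j i
  proof (cases "m j i = 0")
    case True
    with that have "m' j i \<noteq> 0" by simp
    with assms(2) have "j = length ls" "i \<le> l" unfolding column_expos_def by blast+
    then show ?thesis by simp
  next
    case False
    with assms(1) have "j < length ls" "i \<le> ls ! j" unfolding expos_def by blast+
    then show ?thesis by (simp add: nth_append)
  qed
  moreover have "(\<Sum>i\<le>(ls @ [l]) ! j. (m + m') j i) = shifted_deg (ls @ [l]) s j"
    if "j < length (ls @ [l])" for j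
  proof (cases "j = length ls")
    case True
    then have "m j i = 0" for i using assms(1) by (auto simp: expos_def)
    then show ?thesis using assms(2) True by (simp add: shifted_deg_def column_expos_def)
  next
    case False
    then have j: "j < length ls" using that by simp
    have "m' j i = 0" for i using assms(2) False unfolding column_expos_def by blast
    then show ?thesis using assms(1) j by (simp add: shifted_deg_def expos_def nth_append)
  qed
  ultimately show ?thesis unfolding expos_def by blast
qed

lemma expos_appendE:
  assumes "m \<in> expos (ls @ [l]) (shifted_deg (ls @ [l]) s)"
  obtains m1 m2 where "m = m1 + m2" "m1 \<in> expos ls (shifted_deg ls s)"
    "m2 \<in> column_expos (length ls) l (sum_list ls + s)"
proof -
  define m1 m2 where "m1 = (\<lambda>j i. if j < length ls then m j i else 0)"
    and "m2 = (\<lambda>j i. if j = length ls then m j i else 0)"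
  have supp: "j < Suc (length ls) \<and> i \<le> (ls @ [l]) ! j" if "m j i \<noteq> 0" for j i
    using assms that by (simp add: expos_def)
  have sum: "(\<Sum>i\<le>(ls @ [l]) ! j. m j i) = shifted_deg (ls @ [l]) s j" if "j < Suc (length ls)" for j
    using assms that by (simp add: expos_def)
  have "m j i = (m1 + m2) j i" for j i
    using supp[of j i] by (cases "m j i = 0") (auto simp: m1_def m2_def)
  then have "m = m1 + m2" by (auto simp: fun_eq_iff)
  moreover have "m1 \<in> expos ls (shifted_deg ls s)"
  proof -
    have "i \<le> ls ! j" if "j < length ls" "m j i \<noteq> 0" for j i
      using supp[OF that(2)] that(1) by (simp add: nth_append)
    moreover have "(\<Sum>i\<le>ls ! j. m j i) = shifted_deg ls s j" if "j < length ls" for j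
      using sum[of j] that by (simp add: nth_append shifted_deg_def)
    ultimately show ?thesis by (auto simp: expos_def m1_def)
  qed
  moreover have "m2 \<in> column_expos (length ls) l (sum_list ls + s)"
    using supp[of "length ls"] sum[of "length ls"]
    by (auto simp: column_expos_def m2_def shifted_deg_def)
  ultimately show thesis by (rule that)
qed

text \<open>The boundary map of the identity matrix is surjective over the integers, by induction on the
  number of factors. A monomial of $T_{n+1}$ for \<open>ls @ [l]\<close> has degree \<open>sum_list ls + 1\<close> in the last
  group of variables. This is the power of the content of \<open>var_poly\<close> that is needed to pass from the
  coefficients of \<open>id_form_poly ls\<close> to those of the product.\<close>

lemma id_products_span:
  "m \<in> expos ls (shifted_deg ls 1) \<Longrightarrow> Poly_Mapping.single m 1 \<in> int_span (id_products ls)"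
proof (induction ls arbitrary: m rule: rev_induct)
  case Nil
  then have "m j i = 0" for j i by (auto simp: expos_def)
  then have m: "m = 0" by (auto simp: fun_eq_iff)
  have "unit_expo [] = 0" by (auto simp: unit_expo_def fun_eq_iff)
  then have "id_form [] 0 = 1" by (simp add: form_def identity_multimat_def)
  moreover have "(0 :: nat \<Rightarrow> nat \<Rightarrow> nat) \<in> expos [] (shifted_deg [] 0)" by (simp add: expos_def)
  ultimately have "1 \<in> id_products []"
    unfolding id_products_def by (intro CollectI exI[of _ 0]) auto
  then show ?case unfolding m single_one by (rule int_span.base)
next
  case (snoc l ls)
  define L q where "L = sum_list ls" and "q = length ls"
  let ?f = "var_poly q l" and ?g = "id_form_poly ls"
  obtain m1 m2 where m: "m = m1 + m2" "m1 \<in> expos ls (shifted_deg ls 1)" "m2 \<in> column_expos q l (Suc L)"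
    using expos_appendE[OF snoc.prems] by (auto simp: L_def q_def)
  have w: "Poly_Mapping.single m2 1 \<in> coeff_products ?f (Suc L)"
    by (rule single_in_coeff_products[OF m(3)])
  have "Poly_Mapping.single m2 1 * Poly_Mapping.single m1 1 \<in> int_span (id_products (ls @ [l]))"
  proof (rule int_span_mult[OF snoc.IH[OF m(2)]])
    fix y assume "y \<in> id_products ls"
    then obtain h m' where y: "y = id_form ls h * Poly_Mapping.single m' 1"
      and m': "m' \<in> expos ls (shifted_deg ls 0)" by (auto simp: id_products_def)
    have "coeff ?g h * Poly_Mapping.single m2 1 \<in> content_mult ?f L (?f * ?g)"
      by (rule dedekind_mertens[OF _ w]) (simp add: coeff_id_form_poly id_form_eq_0 L_def)
    then have "Poly_Mapping.single m' 1 * (coeff ?g h * Poly_Mapping.single m2 1)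
        \<in> int_span (id_products (ls @ [l]))"
      unfolding content_mult_def
    proof (rule int_span_mult)
      fix z assume "z \<in> {coeff (?f * ?g) h * w | h w. w \<in> coeff_products ?f L}"
      then obtain h' u where z: "z = id_form (ls @ [l]) h' * u" and u: "u \<in> coeff_products ?f L"
        unfolding q_def id_form_append[symmetric] by blast
      from coeff_products_var_poly[OF u]
      show "Poly_Mapping.single m' 1 * z \<in> int_span (id_products (ls @ [l]))"
      proof
        assume "\<exists>n\<in>column_expos q l L. u = Poly_Mapping.single n 1"
        then obtain n where n: "n \<in> column_expos q l L" "u = Poly_Mapping.single n 1" by blast
        have *: "m' + n \<in> expos (ls @ [l]) (shifted_deg (ls @ [l]) 0)"
          using expos_append[OF m', of n l] n by (simp add: q_def L_def)
        have eq: "Poly_Mapping.single m' 1 * z = id_form (ls @ [l]) h' * Poly_Mapping.single (m' + n) 1"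
          unfolding z n(2) by (subst mult.left_commute) (simp add: mult_single)
        show ?thesis
        proof (cases "h' \<le> sum_list (ls @ [l])")
          case True
          then show ?thesis unfolding eq id_products_def using * by (intro int_span.base) blast
        next
          case False
          then have "id_form (ls @ [l]) h' = 0" by (intro id_form_eq_0) simp
          then show ?thesis unfolding eq by (simp add: int_span.zero)
        qed
      qed (simp add: z int_span.zero)
    qed
    then show "Poly_Mapping.single m2 1 * y \<in> int_span (id_products (ls @ [l]))"
      unfolding y coeff_id_form_poly by (simp only: mult_ac)
  qed
  moreover have "Poly_Mapping.single m 1 = Poly_Mapping.single m2 1 * Poly_Mapping.single m1 (1 :: complex)"
    unfolding m(1) by (simp only: mult_single mult_1_left add.commute)
  ultimately show ?case by (simp only:)
qed

lemma expos_split: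
  assumes "m \<in> expos ls (\<lambda>j. Suc (D j))"
  obtains m1 u where "m = m1 + u" "m1 \<in> expos ls D" "u \<in> expos ls (\<lambda>_. 1)"
proof -
  have "\<exists>i. i \<le> ls ! j \<and> m j i \<noteq> 0" if "j < length ls" for j
  proof (rule ccontr)
    assume "\<not> ?thesis"
    then have "(\<Sum>i\<le>ls ! j. m j i) = 0" by auto
    moreover have "(\<Sum>i\<le>ls ! j. m j i) = Suc (D j)"
      using assms that unfolding expos_def by blast
    ultimately show False by simp
  qed
  then obtain i where i: "\<And>j. j < length ls \<Longrightarrow> i j \<le> ls ! j" "\<And>j. j < length ls \<Longrightarrow> m j (i j) \<noteq> 0"
    by metis
  define "is" where "is = map i [0..<length ls]"
  have "is \<in> indices ls" using i by (simp add: indices_def is_def)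
  define m1 where "m1 = (\<lambda>j i'. if j < length ls \<and> i' = i j then m j i' - 1 else m j i')"
  have m: "m = m1 + unit_expo is"
    using i(2) by (auto simp: fun_eq_iff m1_def unit_expo_def is_def)
  have u: "unit_expo is \<in> expos ls (\<lambda>_. 1)"
    by (rule unit_expo_in_expos[OF \<open>is \<in> indices ls\<close>])
  have supp: "j < length ls \<and> i' \<le> ls ! j" if "m1 j i' \<noteq> 0" for j i'
  proof -
    have "m j i' \<noteq> 0" using that by (auto simp: m1_def split: if_splits)
    then show ?thesis using assms unfolding expos_def by blast
  qed
  have sum: "(\<Sum>i'\<le>ls ! j. m1 j i') = D j" if "j < length ls" for j
  proof -
    have "(\<Sum>i'\<le>ls ! j. m j i') = (\<Sum>i'\<le>ls ! j. m1 j i') + (\<Sum>i'\<le>ls ! j. unit_expo is j i')"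
      unfolding m by (simp add: sum.distrib)
    moreover have "(\<Sum>i'\<le>ls ! j. unit_expo is j i') = 1"
      using u that unfolding expos_def by blast
    moreover have "(\<Sum>i'\<le>ls ! j. m j i') = Suc (D j)"
      using assms that unfolding expos_def by blast
    ultimately show ?thesis by simp
  qed
  have "m1 \<in> expos ls D"
    unfolding expos_def using supp sum by blast
  from that[OF m this u] show thesis .
qed

lemma id_products_subset:
  "id_products ls \<subseteq> (\<lambda>(h, \<eta>). id_form ls h * monomial \<eta>) ` set (mult_source ls)"
proof
  fix x assume "x \<in> id_products ls"
  then obtain h m where x: "x = id_form ls h * Poly_Mapping.single m 1" "h \<le> sum_list ls"
    "m \<in> expos ls (shifted_deg ls 0)" by (auto simp: id_products_def)
  then obtain \<eta> where "\<eta> \<in> set (shifted_basis ls 0)" "m = expo \<eta>"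
    unfolding expo_image[symmetric] by blast
  then show "x \<in> (\<lambda>(h, \<eta>). id_form ls h * monomial \<eta>) ` set (mult_source ls)"
    using x by (intro image_eqI[of _ _ "(h, \<eta>)"]) (auto simp: set_mult_source monomial_def)
qed

text \<open>Surjectivity passes from $\Phi_1$ to all $\Phi_d$: a monomial of $T_{n+d+1}$ is a monomial of
  $T_{n+d}$ times one variable from each group, and that product of variables maps $T_n$ to
  $T_{n+1}$.\<close>

lemma pow_products_span:
  "m \<in> expos ls (shifted_deg ls d) \<Longrightarrow> Poly_Mapping.single m 1 \<in>
     int_span ((\<lambda>(\<gamma>, \<tau>). form_pow ls identity_multimat \<gamma> * monomial \<tau>) ` set (pow_source ls d))"
proof (induction d arbitrary: m)
  case 0
  then obtain \<tau> where \<tau>: "\<tau> \<in> set (shifted_basis ls 0)" "m = expo \<tau>"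
    unfolding expo_image[symmetric] by blast
  let ?\<gamma> = "replicate (sum_list ls + 1) (0 :: nat)"
  have "?\<gamma> \<in> set (monomials (sum_list ls + 1) 0)"
    by (simp add: set_monomials sum_list_replicate del: replicate_Suc)
  then have "(?\<gamma>, \<tau>) \<in> set (pow_source ls 0)"
    using \<tau> by (simp only: set_pow_source mem_Times_iff fst_conv snd_conv)
  moreover have "form_pow ls identity_multimat ?\<gamma> = 1"
    unfolding form_pow_def by (rule prod.neutral) (simp del: replicate_Suc)
  then have "Poly_Mapping.single m 1 = form_pow ls identity_multimat ?\<gamma> * monomial \<tau>"
    by (simp only: \<tau>(2) monomial_def mult_1_left)
  ultimately show ?case
    by (intro int_span.base image_eqI[of _ _ "(?\<gamma>, \<tau>)"]) (simp_all only: prod.case)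
next
  case (Suc d)
  let ?G = "\<lambda>(\<gamma>, \<tau>). form_pow ls identity_multimat \<gamma> * monomial \<tau>"
  have "m \<in> expos ls (\<lambda>j. Suc (shifted_deg ls d j))"
    using Suc.prems by (simp add: shifted_deg_def)
  then obtain m1 u where m: "m = m1 + u" "m1 \<in> expos ls (shifted_deg ls d)" "u \<in> expos ls (\<lambda>_. 1)"
    by (rule expos_split)
  have "Poly_Mapping.single u 1 * Poly_Mapping.single m1 1 \<in> int_span (?G ` set (pow_source ls (Suc d)))"
  proof (rule int_span_mult[OF Suc.IH[OF m(2)]])
    fix y assume "y \<in> ?G ` set (pow_source ls d)"
    then obtain \<gamma> \<tau> where y: "y = form_pow ls identity_multimat \<gamma> * monomial \<tau>"
      and \<gamma>: "\<gamma> \<in> set (monomials (sum_list ls + 1) d)" and \<tau>: "\<tau> \<in> set (shifted_basis ls 0)"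
      unfolding set_pow_source by auto
    have "expo \<tau> + u \<in> expos ls (shifted_deg ls 1)"
    proof -
      have "expo \<tau> \<in> expos ls (shifted_deg ls 0)" using \<tau> by (auto simp flip: expo_image)
      from expos_add[OF this m(3)] show ?thesis by (simp add: shifted_deg_def)
    qed
    from id_products_span[OF this]
    have "form_pow ls identity_multimat \<gamma> * Poly_Mapping.single (expo \<tau> + u) 1
        \<in> int_span (?G ` set (pow_source ls (Suc d)))"
    proof (rule int_span_mult)
      fix z assume "z \<in> id_products ls"
      then obtain h \<sigma> where z: "z = id_form ls h * monomial \<sigma>" and h: "h < sum_list ls + 1"
        and \<sigma>: "\<sigma> \<in> set (shifted_basis ls 0)"
        using id_products_subset[of ls] unfolding set_mult_source by auto
      have len: "length \<gamma> = sum_list ls + 1" "sum_list \<gamma> = d" using \<gamma> by (auto simp: set_monomials)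
      let ?\<gamma> = "\<gamma>[h := Suc (\<gamma> ! h)]"
      have "form_pow ls identity_multimat \<gamma> * z = ?G (?\<gamma>, \<sigma>)"
        using h len by (simp add: z form_pow_Suc mult.left_commute mult.assoc)
      moreover have "?\<gamma> \<in> set (monomials (sum_list ls + 1) (Suc d))"
        using h len by (simp add: set_monomials sum_list_update)
      then have "(?\<gamma>, \<sigma>) \<in> set (pow_source ls (Suc d))"
        using \<sigma> by (simp only: set_pow_source mem_Times_iff fst_conv snd_conv)
      ultimately show "form_pow ls identity_multimat \<gamma> * z \<in> int_span (?G ` set (pow_source ls (Suc d)))"
        by (intro int_span.base) (rule image_eqI)
    qed
    moreover have "Poly_Mapping.single u 1 * y =
        form_pow ls identity_multimat \<gamma> * Poly_Mapping.single (expo \<tau> + u) 1"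
      unfolding y monomial_def by (subst mult.left_commute) (simp only: mult_single mult_1_left add.commute)
    ultimately show "Poly_Mapping.single u 1 * y \<in> int_span (?G ` set (pow_source ls (Suc d)))"
      by (simp only:)
  qed
  moreover have "Poly_Mapping.single m 1 = Poly_Mapping.single u 1 * Poly_Mapping.single m1 (1 :: complex)"
    unfolding m(1) by (simp only: mult_single mult_1_left add.commute)
  ultimately show ?case by (simp only:)
qed

lemma mult_det_identity: "mult_det ls identity_multimat \<in> {1, -1 :: complex}"
proof -
  let ?G = "\<lambda>(h, \<eta>). id_form ls h * monomial \<eta>"
  have span: "Poly_Mapping.single m 1 \<in> int_span (?G ` set (mult_source ls))"
    if "m \<in> expos ls (shifted_deg ls 1)" for m
  proof -
    have "id_products ls \<subseteq> int_span (?G ` set (mult_source ls))"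
      using id_products_subset[of ls] by (auto intro: int_span.base)
    from int_span_subset[OF this] id_products_span[OF that] show ?thesis by (rule subsetD)
  qed
  have "mult_entry ls identity_multimat = (\<lambda>\<zeta> x. Poly_Mapping.lookup (?G x) (expo \<zeta>))"
    by (simp add: fun_eq_iff mult_entry_def)
  then have det: "mult_det ls identity_multimat = list_det (mult_source ls) (shifted_basis ls 1)
      (\<lambda>\<zeta> x. Poly_Mapping.lookup (?G x) (expo \<zeta>))"
    by (simp only: mult_det_def)
  have "\<exists>z :: int. mult_det ls identity_multimat * of_int z = (1 :: complex)"
    unfolding det by (rule list_det_unit_if_span[OF length_mult_source distinct_mult_source span])
  then obtain z :: int where z: "mult_det ls identity_multimat * of_int z = (1 :: complex)" ..
  have "mult_det ls identity_multimat \<in> (\<int> :: complex set)"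
    unfolding mult_det_def
  proof (rule list_det_Ints)
    fix \<zeta> x assume \<zeta>: "\<zeta> \<in> set (shifted_basis ls 1)" and "x \<in> set (mult_source ls)"
    then obtain h \<eta> where x: "x = (h, \<eta>)" and \<eta>: "\<eta> \<in> set (shifted_basis ls 0)"
      unfolding set_mult_source by auto
    have "mult_entry ls identity_multimat \<zeta> (h, \<eta>) =
        (\<Sum>is\<in>{is \<in> indices ls. mul_vars \<eta> is = \<zeta>}. identity_multimat (h # is))"
      by (rule mult_entry_eq[OF \<eta>]) (use \<zeta> in simp)
    also have "\<dots> \<in> \<int>"
      by (intro Ints_sum) (simp add: identity_multimat_def)
    finally show "mult_entry ls identity_multimat \<zeta> x \<in> (\<int> :: complex set)"
      by (simp only: x)
  qed
  then obtain w where w: "mult_det ls identity_multimat = (of_int w :: complex)"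
    by (rule Ints_cases)
  have "of_int (w * z) = (1 :: complex)" using z by (simp only: w of_int_mult)
  then have "w * z = 1" by (simp only: of_int_eq_1_iff)
  then have "w = 1 \<or> w = -1" unfolding zmult_eq_1_iff by blast
  then show ?thesis unfolding w by auto
qed

lemma pow_det_identity: "pow_det ls d identity_multimat \<noteq> (0 :: complex)"
proof -
  let ?G = "\<lambda>(\<gamma>, \<tau>). form_pow ls identity_multimat \<gamma> * monomial \<tau>"
  have "pow_entry ls identity_multimat = (\<lambda>\<zeta> x. Poly_Mapping.lookup (?G x) (expo \<zeta>))"
    by (simp add: fun_eq_iff pow_entry_def)
  then have det: "pow_det ls d identity_multimat = list_det (pow_source ls d) (shifted_basis ls d)
      (\<lambda>\<zeta> x. Poly_Mapping.lookup (?G x) (expo \<zeta>))"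
    by (simp only: pow_det_def)
  have "\<exists>z :: int. pow_det ls d identity_multimat * of_int z = (1 :: complex)"
    unfolding det
    by (rule list_det_unit_if_span[OF length_pow_source distinct_pow_source pow_products_span])
  then show ?thesis by auto
qed

section \<open>The boundary map of a convolution\<close>

lemma mul_vars_append:
  "length \<alpha> = length is \<Longrightarrow> mul_vars (\<alpha> @ \<eta>) (is @ js) = mul_vars \<alpha> is @ mul_vars \<eta> js"
  by (simp add: mul_vars_def)

text \<open>Index tuples and exponent lists split simultaneously, because multiplication by a variable acts
  on each factor separately.\<close>

lemma mult_entry_append:
  assumes "\<alpha> \<in> set (shifted_basis ks s)" "\<beta> \<in> set (shifted_basis ks (Suc s))"
    and "\<eta> \<in> set (shifted_basis ls (sum_list ks + s))" "\<zeta> \<in> set (shifted_basis ls (Suc (sum_list ks + s)))"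
  shows "mult_entry (ks @ ls) C (\<beta> @ \<zeta>) (h, \<alpha> @ \<eta>) =
    (\<Sum>is\<in>{is \<in> indices ks. mul_vars \<alpha> is = \<beta>}. \<Sum>js\<in>{js \<in> indices ls. mul_vars \<eta> js = \<zeta>}. C (h # is @ js))"
proof -
  have len: "length \<alpha> = length ks" "length \<beta> = length ks" using assms by (auto simp: set_shifted_basis)
  have *: "\<alpha> @ \<eta> \<in> set (shifted_basis (ks @ ls) s)" "\<beta> @ \<zeta> \<in> set (shifted_basis (ks @ ls) (Suc s))"
    using assms len by (simp_all add: append_in_shifted_basis)
  have "{xs \<in> indices (ks @ ls). mul_vars (\<alpha> @ \<eta>) xs = \<beta> @ \<zeta>} =
      (\<lambda>(is, js). is @ js) ` ({is \<in> indices ks. mul_vars \<alpha> is = \<beta>} \<times> {js \<in> indices ls. mul_vars \<eta> js = \<zeta>})"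
    (is "?L = ?f ` ?R")
  proof -
    have "mul_vars (\<alpha> @ \<eta>) (is @ js) = \<beta> @ \<zeta> \<longleftrightarrow> mul_vars \<alpha> is = \<beta> \<and> mul_vars \<eta> js = \<zeta>"
      if "is \<in> indices ks" for "is" js
    proof -
      have "length is = length ks" using that by (simp add: indices_def)
      then show ?thesis
        using len length_mul_vars[OF that len(1)] by (simp add: mul_vars_append)
    qed
    then show ?thesis unfolding indices_append by auto
  qed
  moreover have "inj_on ?f ?R"
    by (auto simp: inj_on_def indices_def)
  ultimately show ?thesis
    unfolding mult_entry_eq[OF *]
    by (simp add: sum.reindex sum.cartesian_product case_prod_unfold)
qed

lemma shifted_basis_singleton: "set (shifted_basis [\<kappa>] s) = (\<lambda>\<gamma>. [\<gamma>]) ` set (monomials (\<kappa> + 1) s)"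
  by (auto simp: set_shifted_basis set_monomials length_Suc_conv image_iff)

lemma mult_entry_snoc:
  fixes A :: "nat list \<Rightarrow> 'a::comm_ring_1"
  assumes "\<alpha> \<in> set (shifted_basis ks s)" "\<beta> \<in> set (shifted_basis ks (Suc s))"
    and "\<gamma> \<in> set (monomials (\<kappa> + 1) (sum_list ks + s))" "\<gamma>' \<in> set (monomials (\<kappa> + 1) (Suc (sum_list ks + s)))"
  shows "mult_entry (ks @ [\<kappa>]) A (\<beta> @ [\<gamma>']) (i, \<alpha> @ [\<gamma>]) =
    (\<Sum>is\<in>{is \<in> indices ks. mul_vars \<alpha> is = \<beta>}. \<Sum>h\<le>\<kappa>.
       if \<gamma>[h := Suc (\<gamma> ! h)] = \<gamma>' then A (i # is @ [h]) else 0)"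
proof -
  have "[\<gamma>] \<in> set (shifted_basis [\<kappa>] (sum_list ks + s))" "[\<gamma>'] \<in> set (shifted_basis [\<kappa>] (Suc (sum_list ks + s)))"
    using assms(3,4) unfolding shifted_basis_singleton by blast+
  note eq = mult_entry_append[OF assms(1,2) this, of A i]
  have "{js \<in> indices [\<kappa>]. mul_vars [\<gamma>] js = [\<gamma>']} = (\<lambda>h. [h]) ` {h. h \<le> \<kappa> \<and> \<gamma>[h := Suc (\<gamma> ! h)] = \<gamma>'}"
    by (auto simp: indices_singleton mul_vars_def)
  then have "(\<Sum>js\<in>{js \<in> indices [\<kappa>]. mul_vars [\<gamma>] js = [\<gamma>']}. A (i # is @ js)) =
      (\<Sum>h\<le>\<kappa>. if \<gamma>[h := Suc (\<gamma> ! h)] = \<gamma>' then A (i # is @ [h]) else 0)" for "is"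
    by (simp add: sum.reindex inj_on_def sum.inter_filter[symmetric] flip: atMost_iff)
  then show ?thesis unfolding eq by (intro sum.cong refl)
qed

text \<open>With $m = k_1 + \dots + k_{p-1}$ this is the commutative square
  $\partial_{A * B} \circ (\mathrm{id} \otimes \Phi_m) = (\mathrm{id} \otimes \Phi_{m+1}) \circ
  (\partial_A \otimes \mathrm{id})$ in coordinates. Both ways multiply by the forms of $A * B$, which
  arise from those of \<open>A\<close> by substituting the forms of \<open>B\<close> for the variables of the last
  factor.\<close>

lemma convolution_square:
  fixes A B C :: "nat list \<Rightarrow> 'a::comm_ring_1"
  assumes C: "\<And>i is js. length is = length ks \<Longrightarrow>
      C (i # is @ js) = (\<Sum>h\<le>sum_list ls. A (i # is @ [h]) * B (h # js))"
    and \<alpha>: "\<alpha> \<in> set (shifted_basis ks 0)" and \<beta>: "\<beta> \<in> set (shifted_basis ks 1)"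
    and \<gamma>: "\<gamma> \<in> set (monomials (sum_list ls + 1) (sum_list ks))" and \<tau>: "\<tau> \<in> set (shifted_basis ls 0)"
    and \<zeta>: "\<zeta> \<in> set (shifted_basis ls (Suc (sum_list ks)))"
  shows "(\<Sum>\<eta>\<in>set (shifted_basis ls (sum_list ks)).
            mult_entry (ks @ ls) C (\<beta> @ \<zeta>) (i, \<alpha> @ \<eta>) * pow_entry ls B \<eta> (\<gamma>, \<tau>)) =
         (\<Sum>\<gamma>'\<in>set (monomials (sum_list ls + 1) (Suc (sum_list ks))).
            pow_entry ls B \<zeta> (\<gamma>', \<tau>) * mult_entry (ks @ [sum_list ls]) A (\<beta> @ [\<gamma>']) (i, \<alpha> @ [\<gamma>]))"
proof -
  define m \<kappa> I where "m = sum_list ks" and "\<kappa> = sum_list ls" and "I = {is \<in> indices ks. mul_vars \<alpha> is = \<beta>}"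
  let ?\<gamma> = "\<lambda>h. \<gamma>[h := Suc (\<gamma> ! h)]"
  have len: "length \<gamma> = \<kappa> + 1" "sum_list \<gamma> = m" using \<gamma> by (auto simp: set_monomials m_def \<kappa>_def)
  have left: "mult_entry (ks @ ls) C (\<beta> @ \<zeta>) (i, \<alpha> @ \<eta>) =
      (\<Sum>is\<in>I. \<Sum>h\<le>\<kappa>. A (i # is @ [h]) * mult_entry ls B \<zeta> (h, \<eta>))"
    if \<eta>: "\<eta> \<in> set (shifted_basis ls m)" for \<eta>
  proof -
    have "mult_entry (ks @ ls) C (\<beta> @ \<zeta>) (i, \<alpha> @ \<eta>) =
        (\<Sum>is\<in>I. \<Sum>js\<in>{js \<in> indices ls. mul_vars \<eta> js = \<zeta>}. C (i # is @ js))"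
      unfolding I_def by (rule mult_entry_append) (use \<alpha> \<beta> \<zeta> \<eta> in \<open>auto simp: m_def\<close>)
    also have "\<dots> = (\<Sum>is\<in>I. \<Sum>js\<in>{js \<in> indices ls. mul_vars \<eta> js = \<zeta>}.
        \<Sum>h\<le>\<kappa>. A (i # is @ [h]) * B (h # js))"
      by (intro sum.cong refl) (auto simp: I_def indices_def \<kappa>_def C)
    also have "\<dots> = (\<Sum>is\<in>I. \<Sum>h\<le>\<kappa>. \<Sum>js\<in>{js \<in> indices ls. mul_vars \<eta> js = \<zeta>}.
        A (i # is @ [h]) * B (h # js))"
      by (intro sum.cong refl, rule sum.swap)
    also have "\<dots> = (\<Sum>is\<in>I. \<Sum>h\<le>\<kappa>. A (i # is @ [h]) * mult_entry ls B \<zeta> (h, \<eta>))"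
      using mult_entry_eq[OF \<eta>, of \<zeta> B] \<zeta> by (simp only: sum_distrib_left m_def)
    finally show ?thesis .
  qed
  have pow: "(\<Sum>\<eta>\<in>set (shifted_basis ls m). mult_entry ls B \<zeta> (h, \<eta>) * pow_entry ls B \<eta> (\<gamma>, \<tau>)) =
      pow_entry ls B \<zeta> (?\<gamma> h, \<tau>)" if "h \<le> \<kappa>" for h
  proof -
    have "form_pow ls B \<gamma> * monomial \<tau> \<in> homogeneous ls (shifted_deg ls m)"
      using form_pow_monomial_homogeneous[OF \<tau>, of B \<gamma>] len by simp
    from lookup_form_mult[OF this, of B h \<zeta>]
    show ?thesis
      using that len by (simp add: pow_entry_def form_pow_Suc mult.assoc)
  qed
  have "(\<Sum>\<eta>\<in>set (shifted_basis ls m).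
            mult_entry (ks @ ls) C (\<beta> @ \<zeta>) (i, \<alpha> @ \<eta>) * pow_entry ls B \<eta> (\<gamma>, \<tau>)) =
      (\<Sum>\<eta>\<in>set (shifted_basis ls m). \<Sum>is\<in>I. \<Sum>h\<le>\<kappa>.
         A (i # is @ [h]) * (mult_entry ls B \<zeta> (h, \<eta>) * pow_entry ls B \<eta> (\<gamma>, \<tau>)))"
    by (intro sum.cong refl) (simp only: left sum_distrib_right mult.assoc)
  also have "\<dots> = (\<Sum>is\<in>I. \<Sum>h\<le>\<kappa>. \<Sum>\<eta>\<in>set (shifted_basis ls m).
         A (i # is @ [h]) * (mult_entry ls B \<zeta> (h, \<eta>) * pow_entry ls B \<eta> (\<gamma>, \<tau>)))"
    by (subst sum.swap, intro sum.cong refl, rule sum.swap)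
  also have "\<dots> = (\<Sum>is\<in>I. \<Sum>h\<le>\<kappa>. A (i # is @ [h]) * pow_entry ls B \<zeta> (?\<gamma> h, \<tau>))"
    by (intro sum.cong refl) (simp add: pow flip: sum_distrib_left)
  finally have LHS: "(\<Sum>\<eta>\<in>set (shifted_basis ls m).
            mult_entry (ks @ ls) C (\<beta> @ \<zeta>) (i, \<alpha> @ \<eta>) * pow_entry ls B \<eta> (\<gamma>, \<tau>)) =
      (\<Sum>is\<in>I. \<Sum>h\<le>\<kappa>. A (i # is @ [h]) * pow_entry ls B \<zeta> (?\<gamma> h, \<tau>))" .
  let ?M = "set (monomials (\<kappa> + 1) (Suc m))"
  have "(\<Sum>\<gamma>'\<in>?M. pow_entry ls B \<zeta> (\<gamma>', \<tau>) * mult_entry (ks @ [\<kappa>]) A (\<beta> @ [\<gamma>']) (i, \<alpha> @ [\<gamma>])) =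
      (\<Sum>\<gamma>'\<in>?M. \<Sum>is\<in>I. \<Sum>h\<le>\<kappa>. if ?\<gamma> h = \<gamma>' then A (i # is @ [h]) * pow_entry ls B \<zeta> (\<gamma>', \<tau>) else 0)"
  proof (intro sum.cong refl)
    fix \<gamma>' assume "\<gamma>' \<in> ?M"
    then have "mult_entry (ks @ [\<kappa>]) A (\<beta> @ [\<gamma>']) (i, \<alpha> @ [\<gamma>]) =
        (\<Sum>is\<in>I. \<Sum>h\<le>\<kappa>. if ?\<gamma> h = \<gamma>' then A (i # is @ [h]) else 0)"
      unfolding I_def by (intro mult_entry_snoc[where s = 0]) (use \<alpha> \<beta> \<gamma> in \<open>simp_all add: m_def \<kappa>_def\<close>)
    then show "pow_entry ls B \<zeta> (\<gamma>', \<tau>) * mult_entry (ks @ [\<kappa>]) A (\<beta> @ [\<gamma>']) (i, \<alpha> @ [\<gamma>]) =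
        (\<Sum>is\<in>I. \<Sum>h\<le>\<kappa>. if ?\<gamma> h = \<gamma>' then A (i # is @ [h]) * pow_entry ls B \<zeta> (\<gamma>', \<tau>) else 0)"
      by (auto simp: sum_distrib_left mult.commute intro!: sum.cong)
  qed
  also have "\<dots> = (\<Sum>is\<in>I. \<Sum>h\<le>\<kappa>. \<Sum>\<gamma>'\<in>?M.
      if ?\<gamma> h = \<gamma>' then A (i # is @ [h]) * pow_entry ls B \<zeta> (\<gamma>', \<tau>) else 0)"
    by (subst sum.swap, intro sum.cong refl, rule sum.swap)
  also have "\<dots> = (\<Sum>is\<in>I. \<Sum>h\<le>\<kappa>. A (i # is @ [h]) * pow_entry ls B \<zeta> (?\<gamma> h, \<tau>))"
  proof (intro sum.cong refl)
    fix "is" h assume "h \<in> {..\<kappa>}"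
    then have "?\<gamma> h \<in> ?M"
      using len by (simp add: set_monomials sum_list_update)
    then show "(\<Sum>\<gamma>'\<in>?M. if ?\<gamma> h = \<gamma>' then A (i # is @ [h]) * pow_entry ls B \<zeta> (\<gamma>', \<tau>) else 0) =
        A (i # is @ [h]) * pow_entry ls B \<zeta> (?\<gamma> h, \<tau>)"
      by (simp only: sum.delta' finite_set if_True)
  qed
  finally show ?thesis
    using LHS unfolding m_def \<kappa>_def by (simp only:)
qed

lemma image_nested_products:
  "(\<lambda>((i, a), b). (i, f a b)) ` ((I \<times> S) \<times> G) = I \<times> (\<lambda>(a, b). f a b) ` (S \<times> G)" (is "?L1 = ?R1")
  "(\<lambda>((i, a), (g, t)). (t, (i, f a g))) ` ((I \<times> S) \<times> (G \<times> T)) = T \<times> (I \<times> (\<lambda>(a, g). f a g) ` (S \<times> G))"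
    (is "?L2 = ?R2")
  "(\<lambda>(a, (g, t)). (t, f a g)) ` (S \<times> (G \<times> T)) = T \<times> (\<lambda>(a, g). f a g) ` (S \<times> G)"
    (is "?L3 = ?R3")
proof -
  have "(i, f a b) \<in> ?L1" if "i \<in> I" "a \<in> S" "b \<in> G" for i a b
    by (rule image_eqI[of _ _ "((i, a), b)"]) (use that in auto)
  then have "?R1 \<subseteq> ?L1" by auto
  moreover have "?L1 \<subseteq> ?R1" by auto
  ultimately show "?L1 = ?R1" by (rule equalityI[rotated])
  have "(t, (i, f a g)) \<in> ?L2" if "i \<in> I" "a \<in> S" "g \<in> G" "t \<in> T" for i a g t
    by (rule image_eqI[of _ _ "((i, a), (g, t))"]) (use that in auto)
  then have "?R2 \<subseteq> ?L2" by auto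
  moreover have "?L2 \<subseteq> ?R2" by auto
  ultimately show "?L2 = ?R2" by (rule equalityI[rotated])
  have "(t, f a g) \<in> ?L3" if "a \<in> S" "g \<in> G" "t \<in> T" for a g t
    by (rule image_eqI[of _ _ "(a, (g, t))"]) (use that in auto)
  then have "?R3 \<subseteq> ?L3" by auto
  moreover have "?L3 \<subseteq> ?R3" by auto
  ultimately show "?L3 = ?R3" by (rule equalityI[rotated])
qed

lemma set_shifted_basis_snoc:
  "set (shifted_basis (ks @ [\<kappa>]) s) =
    (\<lambda>(\<alpha>, \<gamma>). \<alpha> @ [\<gamma>]) ` (set (shifted_basis ks s) \<times> set (monomials (\<kappa> + 1) (sum_list ks + s)))"
proof -
  have "S \<times> (\<lambda>\<gamma>. [\<gamma>]) ` G = (\<lambda>(\<alpha>, \<gamma>). (\<alpha>, [\<gamma>])) ` (S \<times> G)" for S :: "nat list list set" and G :: "nat list set"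
    by auto
  then show ?thesis
    unfolding set_shifted_basis_append shifted_basis_singleton
    by (simp add: image_image case_prod_unfold)
qed

text \<open>The convolution depends only on the number of factors \<open>n\<close> of \<open>A\<close> between the first and the
  last one and on the contracted dimension.\<close>

definition convolve :: "nat \<Rightarrow> nat \<Rightarrow> multimat \<Rightarrow> multimat \<Rightarrow> multimat" where
  "convolve n \<kappa> A B = (\<lambda>is. \<Sum>h\<le>\<kappa>. A (take (Suc n) is @ [h]) * B (h # drop (Suc n) is))"

lemma convolve_apply:
  "length is = n \<Longrightarrow> convolve n \<kappa> A B (i # is @ js) = (\<Sum>h\<le>\<kappa>. A (i # is @ [h]) * B (h # js))"
  by (simp add: convolve_def)

text \<open>Determinants of the four sides of the square. The factor \<open>c\<close> accounts for the ordering of the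
  bases and is therefore independent of the matrices.\<close>

lemma convolution_det_square:
  "\<exists>c :: complex. c \<noteq> 0 \<and> (\<forall>A B. mult_det (ks @ ls) (convolve (length ks) (sum_list ls) A B) *
      pow_det ls (sum_list ks) B ^ ((sum_list (ks @ ls) + 1) * length (shifted_basis ks 0)) =
    c * pow_det ls (Suc (sum_list ks)) B ^ length (shifted_basis ks 1) *
      mult_det (ks @ [sum_list ls]) A ^ length (shifted_basis ls 0))"
proof -
  define m \<kappa> where "m = sum_list ks" and "\<kappa> = sum_list ls"
  let ?T = "shifted_basis ls 0"
  define U where "U = List.product [0..<sum_list (ks @ ls) + 1] (shifted_basis ks 0)"
  let ?S = "shifted_basis ks 1"
  define Y0 where "Y0 = List.product U (shifted_basis ls m)"
  define Y1 where "Y1 = List.product ?S (shifted_basis ls (Suc m))"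
  define X0 where "X0 = List.product U (pow_source ls m)"
  define X1 where "X1 = List.product ?S (pow_source ls (Suc m))"
  \<comment> \<open>The corners of the square are tensor products. These maps identify their bases with those of
    the source and target of the two boundary maps.\<close>
  define f0 :: "(nat \<times> nat list list) \<times> nat list list \<Rightarrow> nat \<times> nat list list"
    where "f0 = (\<lambda>((i, \<alpha>), \<eta>). (i, \<alpha> @ \<eta>))"
  define f1 :: "nat list list \<times> nat list list \<Rightarrow> nat list list" where "f1 = (\<lambda>(\<beta>, \<zeta>). \<beta> @ \<zeta>)"
  define g0 :: "(nat \<times> nat list list) \<times> nat list \<times> nat list list \<Rightarrow> nat list list \<times> nat \<times> nat list list"
    where "g0 = (\<lambda>((i, \<alpha>), (\<gamma>, \<tau>)). (\<tau>, (i, \<alpha> @ [\<gamma>])))"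
  define g1 :: "nat list list \<times> nat list \<times> nat list list \<Rightarrow> nat list list \<times> nat list list"
    where "g1 = (\<lambda>(\<beta>, (\<gamma>, \<tau>)). (\<tau>, \<beta> @ [\<gamma>]))"
  have distU: "distinct U" by (simp add: U_def distinct_product distinct_shifted_basis)
  have setU: "set U = {..<m + \<kappa> + 1} \<times> set (shifted_basis ks 0)"
    by (auto simp: U_def m_def \<kappa>_def)
  have lenU: "length U = (sum_list (ks @ ls) + 1) * length (shifted_basis ks 0)"
    by (simp add: U_def)
  have lenks: "length \<alpha> = length ks" if "\<alpha> \<in> set (shifted_basis ks s)" for \<alpha> s
    using that by (simp add: set_shifted_basis)

  have Y0: "distinct (map f0 Y0)" "set (map f0 Y0) = set (mult_source (ks @ ls))"
  proof -
    have "inj_on f0 (set Y0)"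
      using lenks by (auto simp: inj_on_def f0_def Y0_def setU)
    then show "distinct (map f0 Y0)"
      by (simp add: distinct_map Y0_def distinct_product distU distinct_shifted_basis)
    show "set (map f0 Y0) = set (mult_source (ks @ ls))"
      unfolding set_map Y0_def set_product setU f0_def image_nested_products
      by (simp add: set_mult_source set_shifted_basis_append m_def \<kappa>_def)
  qed
  have Y1: "distinct (map f1 Y1)" "set (map f1 Y1) = set (shifted_basis (ks @ ls) 1)"
  proof -
    have "inj_on f1 (set Y1)"
      using lenks by (auto simp: inj_on_def f1_def Y1_def)
    then show "distinct (map f1 Y1)"
      by (simp add: distinct_map Y1_def distinct_product distinct_shifted_basis)
    show "set (map f1 Y1) = set (shifted_basis (ks @ ls) 1)"
      by (simp add: Y1_def f1_def set_shifted_basis_append m_def)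
  qed
  have X0: "distinct (map g0 X0)" "set (map g0 X0) = set (List.product ?T (mult_source (ks @ [\<kappa>])))"
  proof -
    have "inj_on g0 (set X0)"
      using lenks by (auto simp: inj_on_def g0_def X0_def setU)
    then show "distinct (map g0 X0)"
      by (simp add: distinct_map X0_def distinct_product distU distinct_pow_source)
    have "g0 ` (({..<m + \<kappa> + 1} \<times> set (shifted_basis ks 0)) \<times>
          (set (monomials (sum_list ls + 1) m) \<times> set ?T)) =
        set ?T \<times> ({..<m + \<kappa> + 1} \<times> (\<lambda>(\<alpha>, \<gamma>). \<alpha> @ [\<gamma>]) `
          (set (shifted_basis ks 0) \<times> set (monomials (sum_list ls + 1) m)))"
      unfolding g0_def by (rule image_nested_products(2))
    then show "set (map g0 X0) = set (List.product ?T (mult_source (ks @ [\<kappa>])))"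
      unfolding set_map X0_def set_product setU set_pow_source
      by (simp add: set_mult_source set_shifted_basis_snoc m_def \<kappa>_def)
  qed
  have X1: "distinct (map g1 X1)" "set (map g1 X1) = set (List.product ?T (shifted_basis (ks @ [\<kappa>]) 1))"
  proof -
    have "inj_on g1 (set X1)"
      using lenks by (auto simp: inj_on_def g1_def X1_def)
    then show "distinct (map g1 X1)"
      by (simp add: distinct_map X1_def distinct_product distinct_pow_source distinct_shifted_basis)
    show "set (map g1 X1) = set (List.product ?T (shifted_basis (ks @ [\<kappa>]) 1))"
      unfolding set_map X1_def set_product set_pow_source g1_def
        image_nested_products(3)[where f = "\<lambda>\<alpha> \<gamma>. \<alpha> @ [\<gamma>]"]
      by (simp add: set_shifted_basis_snoc m_def \<kappa>_def)
  qed
  have lenY0: "length Y0 = length (mult_source (ks @ ls))"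
    using Y0 distinct_mult_source by (metis distinct_card length_map)
  have lenY1: "length Y1 = length (shifted_basis (ks @ ls) 1)"
    using Y1 distinct_shifted_basis by (metis distinct_card length_map)
  have lenX0: "length X0 = length Y0" by (simp add: X0_def Y0_def length_pow_source)
  have lenX1: "length X1 = length Y1" by (simp add: X1_def Y1_def length_pow_source)
  have lenY: "length Y0 = length Y1" using lenY0 lenY1 length_mult_source by metis
  obtain c1 :: complex where c1: "c1 \<noteq> 0"
    "\<And>F. list_det (map f0 Y0) (map f1 Y1) F =
         c1 * list_det (mult_source (ks @ ls)) (shifted_basis (ks @ ls) 1) F"
    by (rule list_det_reorder[OF Y0(1) distinct_mult_source Y0(2) Y1(1) distinct_shifted_basis Y1(2)],
        simp add: lenY, rule that)
  obtain c2 :: complex where c2: "c2 \<noteq> 0"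
    "\<And>F. list_det (map g0 X0) (map g1 X1) F =
         c2 * list_det (List.product ?T (mult_source (ks @ [\<kappa>]))) (List.product ?T (shifted_basis (ks @ [\<kappa>]) 1)) F"
    by (rule list_det_reorder[OF X0(1) _ X0(2) X1(1) _ X1(2)],
        simp add: distinct_product distinct_mult_source distinct_shifted_basis,
        simp add: distinct_product distinct_shifted_basis,
        simp add: lenY lenX0 lenX1, rule that)
  show ?thesis
  proof (intro exI[of _ "c2 / c1"] conjI allI)
    show "c2 / c1 \<noteq> 0" using c1 c2 by simp
    fix A B :: multimat
    define C where "C = convolve (length ks) (sum_list ls) A B"
    have C: "C (i # is @ js) = (\<Sum>h\<le>sum_list ls. A (i # is @ [h]) * B (h # js))"
      if "length is = length ks" for i "is" js
      unfolding C_def by (rule convolve_apply[OF that])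
    define M1 where "M1 = (\<lambda>y x. mult_entry (ks @ ls) C (f1 y) (f0 x))"
    define MA where "MA = (\<lambda>y x. (\<lambda>(v, z) (u, x). if v = u then mult_entry (ks @ [\<kappa>]) A z x else 0)
                              (g1 y) (g0 x))"
    define E :: "(nat \<times> nat list list) \<times> nat list list \<Rightarrow> (nat \<times> nat list list) \<times> nat list \<times> nat list list \<Rightarrow> complex"
      where "E = (\<lambda>(v, \<eta>) (u, x). if v = u then pow_entry ls B \<eta> x else 0)"
    define E' :: "nat list list \<times> nat list list \<Rightarrow> nat list list \<times> nat list \<times> nat list list \<Rightarrow> complex"
      where "E' = (\<lambda>(v, \<eta>) (u, x). if v = u then pow_entry ls B \<eta> x else 0)"
    have detM1: "list_det Y0 Y1 M1 = c1 * mult_det (ks @ ls) C"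
      unfolding M1_def list_det_map[symmetric] c1(2) mult_det_def ..
    have "list_det X0 X1 MA = c2 * list_det (List.product ?T (mult_source (ks @ [\<kappa>])))
        (List.product ?T (shifted_basis (ks @ [\<kappa>]) 1))
        (\<lambda>(v, z) (u, x). if v = u then mult_entry (ks @ [\<kappa>]) A z x else 0)"
      unfolding MA_def list_det_map[symmetric] c2(2) ..
    also have "\<dots> = c2 * mult_det (ks @ [\<kappa>]) A ^ length ?T"
      unfolding mult_det_def
      by (subst list_det_product[OF length_mult_source distinct_shifted_basis]) (rule refl)
    finally have detMA: "list_det X0 X1 MA = c2 * mult_det (ks @ [\<kappa>]) A ^ length ?T" .
    have detE: "list_det X0 Y0 E = pow_det ls m B ^ length U"
      unfolding X0_def Y0_def E_def pow_det_def
      by (rule list_det_product[OF length_pow_source distU])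
    have detE': "list_det X1 Y1 E' = pow_det ls (Suc m) B ^ length ?S"
      unfolding X1_def Y1_def E'_def pow_det_def
      by (rule list_det_product[OF length_pow_source distinct_shifted_basis])
    have "list_det X0 Y1 (\<lambda>z x. \<Sum>y\<in>set Y0. M1 z y * E y x) =
          list_det X0 Y1 (\<lambda>z x. \<Sum>y\<in>set X1. E' z y * MA y x)"
    proof (rule list_det_cong)
      fix z x assume "z \<in> set Y1" "x \<in> set X0"
      then obtain \<beta> \<zeta> i \<alpha> \<gamma> \<tau> where z: "z = (\<beta>, \<zeta>)" and x: "x = ((i, \<alpha>), (\<gamma>, \<tau>))"
        and mem: "\<beta> \<in> set ?S" "\<zeta> \<in> set (shifted_basis ls (Suc m))"
          "(i, \<alpha>) \<in> set U" "\<alpha> \<in> set (shifted_basis ks 0)" "\<gamma> \<in> set (monomials (\<kappa> + 1) m)" "\<tau> \<in> set ?T"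
        by (auto simp: Y1_def X0_def setU set_pow_source \<kappa>_def)
      have "(\<Sum>y\<in>set Y0. M1 z y * E y x) =
          (\<Sum>v\<in>set U. \<Sum>\<eta>\<in>set (shifted_basis ls m). M1 z (v, \<eta>) * E (v, \<eta>) x)"
        unfolding Y0_def set_product sum.cartesian_product' ..
      also have "\<dots> = (\<Sum>v\<in>set U. if v = (i, \<alpha>) then
          (\<Sum>\<eta>\<in>set (shifted_basis ls m). mult_entry (ks @ ls) C (\<beta> @ \<zeta>) (i, \<alpha> @ \<eta>) * pow_entry ls B \<eta> (\<gamma>, \<tau>)) else 0)"
        by (intro sum.cong refl) (auto simp: M1_def E_def x z f0_def f1_def)
      also have "\<dots> = (\<Sum>\<eta>\<in>set (shifted_basis ls m).
          mult_entry (ks @ ls) C (\<beta> @ \<zeta>) (i, \<alpha> @ \<eta>) * pow_entry ls B \<eta> (\<gamma>, \<tau>))"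
        using mem(3) by (simp only: sum.delta finite_set if_True)
      also have "\<dots> = (\<Sum>\<gamma>'\<in>set (monomials (\<kappa> + 1) (Suc m)).
            pow_entry ls B \<zeta> (\<gamma>', \<tau>) * mult_entry (ks @ [\<kappa>]) A (\<beta> @ [\<gamma>']) (i, \<alpha> @ [\<gamma>]))"
        unfolding m_def \<kappa>_def by (rule convolution_square[OF C])
          (use mem in \<open>simp_all only: m_def \<kappa>_def\<close>)
      also have "\<dots> = (\<Sum>\<gamma>'\<in>set (monomials (\<kappa> + 1) (Suc m)). \<Sum>\<tau>'\<in>set ?T. if \<tau>' = \<tau> then
            pow_entry ls B \<zeta> (\<gamma>', \<tau>) * mult_entry (ks @ [\<kappa>]) A (\<beta> @ [\<gamma>']) (i, \<alpha> @ [\<gamma>]) else 0)"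
        using mem(6) by (simp only: sum.delta finite_set if_True)
      also have "\<dots> = (\<Sum>w\<in>set (pow_source ls (Suc m)). pow_entry ls B \<zeta> w * MA (\<beta>, w) x)"
        unfolding set_pow_source sum.cartesian_product' \<kappa>_def[symmetric]
        by (intro sum.cong refl) (auto simp: MA_def x g0_def g1_def)
      also have "\<dots> = (\<Sum>v\<in>set ?S. if v = \<beta> then
          (\<Sum>w\<in>set (pow_source ls (Suc m)). pow_entry ls B \<zeta> w * MA (\<beta>, w) x) else 0)"
        using mem(1) by (simp only: sum.delta finite_set if_True)
      also have "\<dots> = (\<Sum>v\<in>set ?S. \<Sum>w\<in>set (pow_source ls (Suc m)). E' z (v, w) * MA (v, w) x)"
        by (intro sum.cong refl) (auto simp: E'_def z)
      also have "\<dots> = (\<Sum>y\<in>set X1. E' z y * MA y x)"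
        unfolding X1_def set_product sum.cartesian_product' ..
      finally show "(\<Sum>y\<in>set Y0. M1 z y * E y x) = (\<Sum>y\<in>set X1. E' z y * MA y x)" .
    qed
    moreover have "list_det X0 Y1 (\<lambda>z x. \<Sum>y\<in>set Y0. M1 z y * E y x) = list_det Y0 Y1 M1 * list_det X0 Y0 E"
      by (rule list_det_mult[OF lenX0 lenY[symmetric]])
         (simp add: Y0_def distinct_product distU distinct_shifted_basis)
    moreover have "list_det X0 Y1 (\<lambda>z x. \<Sum>y\<in>set X1. E' z y * MA y x) = list_det X1 Y1 E' * list_det X0 X1 MA"
      by (rule list_det_mult)
         (simp_all only: lenX0 lenX1 lenY, simp add: X1_def distinct_product distinct_pow_source distinct_shifted_basis)
    ultimately have "c1 * mult_det (ks @ ls) C * pow_det ls m B ^ length U =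
        pow_det ls (Suc m) B ^ length ?S * (c2 * mult_det (ks @ [\<kappa>]) A ^ length ?T)"
      unfolding detM1 detMA detE detE' by (simp only:)
    then have "mult_det (ks @ ls) C * pow_det ls m B ^ length U =
        c2 / c1 * pow_det ls (Suc m) B ^ length ?S * mult_det (ks @ [\<kappa>]) A ^ length ?T"
      using c1(1) by (simp add: field_simps)
    then show "mult_det (ks @ ls) (convolve (length ks) (sum_list ls) A B) * pow_det ls (sum_list ks) B ^
          ((sum_list (ks @ ls) + 1) * length (shifted_basis ks 0)) =
      c2 / c1 * pow_det ls (Suc (sum_list ks)) B ^ length ?S *
        mult_det (ks @ [sum_list ls]) A ^ length ?T"
      unfolding m_def \<kappa>_def lenU C_def .
  qed
qed

text \<open>The exponents of $\det\partial_B$ that the two maps $\Phi_m$ and $\Phi_{m+1}$ contribute to the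
  square differ by the multinomial coefficient of the theorem. Multiplied by
  $k_1! \cdots k_{p-1}!\,(\kappa+1)!$ the identity reads
  $(m+1)\,(k_0+1)! = m\,(k_0+1)! + (k_0+1)!$ with $k_0 = m + \kappa$.\<close>

lemma exponent_identity:
  fixes ks ls :: "nat list"
  defines "m \<equiv> sum_list ks" and "\<kappa> \<equiv> sum_list ls"
  shows "length (shifted_basis ks 1) * exponent_sum (\<kappa> + 1) (Suc m) =
    (m + \<kappa> + 1) * length (shifted_basis ks 0) * exponent_sum (\<kappa> + 1) m +
    multinomial (m + \<kappa> + 1) (ks @ [\<kappa> + 1])"
proof -
  define P where "P = prod_list (map fact ks :: nat list)"
  define a b c c' f where "a = length (shifted_basis ks 0)" and "b = length (shifted_basis ks 1)"
    and "c = exponent_sum (\<kappa> + 1) m" and "c' = exponent_sum (\<kappa> + 1) (Suc m)"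
    and "f = multinomial (m + \<kappa> + 1) (ks @ [\<kappa> + 1])"
  have "P \<noteq> 0" using fact_prod_pos[of ks] unfolding P_def by (rule neq0_conv[THEN iffD2])
  have a: "a * P = fact m" using length_shifted_basis[of ks 0] by (simp add: a_def P_def m_def)
  have b: "b * P = fact (Suc m)" using length_shifted_basis[of ks 1] by (simp add: b_def P_def m_def)
  have "f = length (shifted_basis (ks @ [\<kappa> + 1]) 0)"
    unfolding f_def by (rule multinomial_eq_length_shifted_basis) (simp add: m_def)
  then have f: "f * (P * fact (\<kappa> + 1)) = fact (m + \<kappa> + 1)"
    using length_shifted_basis[of "ks @ [\<kappa> + 1]" 0] by (simp add: P_def m_def add.assoc)
  have count: "(\<kappa> + 1) * exponent_sum (\<kappa> + 1) d * (fact d * fact \<kappa>) = d * fact (\<kappa> + d)" for d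
  proof -
    have "length (monomials (\<kappa> + 1) d) * (fact d * fact \<kappa>) = fact (\<kappa> + d)"
      using binomial_fact_lemma[of d "\<kappa> + d"] by (simp add: length_monomials mult_ac)
    then show ?thesis
      unfolding exponent_sum_mult by (metis mult.assoc)
  qed
  have fact: "fact (\<kappa> + 1) = (\<kappa> + 1) * (fact \<kappa> :: nat)" by simp
  have "b * c' * (P * fact (\<kappa> + 1)) = (b * P) * ((\<kappa> + 1) * c' * fact \<kappa>)"
    unfolding fact by (simp only: mult_ac)
  also have "\<dots> = (\<kappa> + 1) * c' * (fact (Suc m) * fact \<kappa>)"
    unfolding b by (simp only: mult_ac)
  also have "\<dots> = Suc m * fact (m + \<kappa> + 1)"
    unfolding c'_def count by (simp add: add.commute)
  finally have 1: "b * c' * (P * fact (\<kappa> + 1)) = Suc m * fact (m + \<kappa> + 1)" .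
  have "(m + \<kappa> + 1) * a * c * (P * fact (\<kappa> + 1)) = (m + \<kappa> + 1) * ((a * P) * ((\<kappa> + 1) * c * fact \<kappa>))"
    unfolding fact by (simp only: mult_ac)
  also have "\<dots> = (m + \<kappa> + 1) * ((\<kappa> + 1) * c * (fact m * fact \<kappa>))"
    unfolding a by (simp only: mult_ac)
  also have "\<dots> = (m + \<kappa> + 1) * (m * fact (\<kappa> + m))"
    unfolding c_def count ..
  also have "\<dots> = m * fact (m + \<kappa> + 1)"
    by (simp add: add.commute[of \<kappa>] mult.left_commute distrib_left distrib_right)
  finally have 2: "(m + \<kappa> + 1) * a * c * (P * fact (\<kappa> + 1)) = m * fact (m + \<kappa> + 1)" .
  have "b * c' * (P * fact (\<kappa> + 1)) = ((m + \<kappa> + 1) * a * c + f) * (P * fact (\<kappa> + 1))"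
    unfolding 1 add_mult_distrib[of "(m + \<kappa> + 1) * a * c" f] 2 f by simp
  moreover have "P * fact (\<kappa> + 1) \<noteq> (0 :: nat)" using \<open>P \<noteq> 0\<close> by simp
  ultimately have "b * c' = (m + \<kappa> + 1) * a * c + f" by (metis mult_right_cancel)
  then show ?thesis by (simp only: a_def b_def c_def c'_def f_def)
qed

section \<open>The determinant of a convolution\<close>

lemma mult_det_cong:
  assumes "\<And>i is. is \<in> indices ls \<Longrightarrow> B (i # is) = B' (i # is)"
  shows "mult_det ls B = mult_det ls B'"
proof -
  have "form ls B h = form ls B' h" for h
    unfolding form_def by (intro sum.cong refl) (simp add: assms)
  then have "mult_entry ls B = mult_entry ls B'"
    by (simp add: mult_entry_def fun_eq_iff)
  then show ?thesis by (simp add: mult_det_def)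
qed

lemma det_boundary_map:
  assumes "boundary_format k"
  shows "det (boundary_map k A) = mult_det (tl k) A"
proof -
  have src: "source_basis k = mult_source (tl k)"
    using assms by (simp add: source_basis_eq mult_source_def boundary_format_def)
  have tgt: "target_basis k = shifted_basis (tl k) 1"
    by (rule target_basis_eq)
  have "det (boundary_map k A) = list_det (mult_source (tl k)) (shifted_basis (tl k) 1)
      (\<lambda>\<zeta> (i, \<alpha>). \<Sum>is\<in>{is \<in> indices (tl k). mul_vars \<alpha> is = \<zeta>}. A (i # is))"
    unfolding boundary_map_def list_det_def src tgt by (simp add: case_prod_unfold)
  also have "\<dots> = mult_det (tl k) A"
    unfolding mult_det_def
  proof (rule list_det_cong)
    fix \<zeta> x assume \<zeta>: "\<zeta> \<in> set (shifted_basis (tl k) 1)" and "x \<in> set (mult_source (tl k))"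
    then obtain i \<alpha> where x: "x = (i, \<alpha>)" and \<alpha>: "\<alpha> \<in> set (shifted_basis (tl k) 0)"
      unfolding set_mult_source by auto
    show "(case x of (i, \<alpha>) \<Rightarrow> \<Sum>is\<in>{is \<in> indices (tl k). mul_vars \<alpha> is = \<zeta>}. A (i # is)) =
        mult_entry (tl k) A \<zeta> x"
      unfolding x prod.case by (rule mult_entry_eq[OF \<alpha>, symmetric]) (use \<zeta> in simp)
  qed
  finally show ?thesis .
qed

lemma conv_eq_convolve:
  "conv (k0 # ks @ [\<kappa>]) A B = convolve (length ks) \<kappa> A B"
  by (simp add: conv_def convolve_def fun_eq_iff)

text \<open>In the sum over \<open>h\<close> only \<open>h = sum_list js\<close> contributes, where \<open>js\<close> are the indices that
  belong to \<open>ls\<close>. The boundary format puts this value in the range of summation.\<close>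

lemma mult_det_convolve_identity:
  "mult_det (ks @ ls) (convolve (length ks) (sum_list ls) identity_multimat identity_multimat) =
   mult_det (ks @ ls) identity_multimat"
proof (rule mult_det_cong)
  fix i xs assume "xs \<in> indices (ks @ ls)"
  then obtain "is" js where xs: "xs = is @ js" and mem: "is \<in> indices ks" "js \<in> indices ls"
    unfolding indices_append by auto
  have len: "length is = length ks" using mem by (simp add: indices_def)
  have "convolve (length ks) (sum_list ls) identity_multimat identity_multimat (i # xs) =
      (\<Sum>h\<le>sum_list ls. if h = sum_list js then (if i = sum_list is + sum_list js then 1 else 0) else 0)"
    unfolding xs convolve_apply[OF len] by (intro sum.cong refl) (auto simp: identity_multimat_def)
  also have "\<dots> = identity_multimat (i # xs)"
    using sum_list_indices_le[OF mem(2)] by (simp add: sum.delta xs identity_multimat_def)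
  finally show "convolve (length ks) (sum_list ls) identity_multimat identity_multimat (i # xs) =
      identity_multimat (i # xs)" .
qed

text \<open>Both $\det\Phi_m$ and $\det\Phi_{m+1}$ are powers of $\det\partial_B$ up to constants, and the
  former can be cancelled when $\det\partial_B \neq 0$.\<close>

lemma mult_det_convolve_generic:
  fixes ks ls :: "nat list"
  defines "f \<equiv> multinomial (sum_list (ks @ ls) + 1) (ks @ [sum_list ls + 1])"
    and "e \<equiv> length (shifted_basis ls 0)"
  obtains c :: complex where
    "\<And>A B. mult_det ls B \<noteq> 0 \<Longrightarrow>
      mult_det (ks @ ls) (convolve (length ks) (sum_list ls) A B) =
      c * mult_det (ks @ [sum_list ls]) A ^ e * mult_det ls B ^ f"
proof -
  define m where "m = sum_list ks"
  define a b where "a = (sum_list (ks @ ls) + 1) * length (shifted_basis ks 0)"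
    and "b = length (shifted_basis ks 1)"
  define \<epsilon> where "\<epsilon> = exponent_sum (sum_list ls + 1)"
  define q0 where "q0 = mult_det ls (identity_multimat :: multimat)"
  define P where "P = (\<lambda>d. pow_det ls d (identity_multimat :: multimat))"
  have q0: "q0 \<noteq> 0" using mult_det_identity[of ls] by (auto simp: q0_def)
  have P: "P d \<noteq> 0" for d using pow_det_identity by (simp add: P_def)
  have exps: "b * \<epsilon> (Suc m) = a * \<epsilon> m + f"
    using exponent_identity[of ks ls] by (simp add: a_def b_def \<epsilon>_def m_def f_def)
  obtain c where c: "\<And>A B. mult_det (ks @ ls) (convolve (length ks) (sum_list ls) A B) *
        pow_det ls m B ^ a = c * pow_det ls (Suc m) B ^ b * mult_det (ks @ [sum_list ls]) A ^ e"
    using convolution_det_square[of ks ls] unfolding a_def b_def e_def m_def by blast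
  define r where "r = (\<lambda>d. P d / q0 ^ \<epsilon> d)"
  have r: "r d \<noteq> 0" for d using P q0 by (simp add: r_def)
  show thesis
  proof (rule that[of "c * r (Suc m) ^ b / r m ^ a"])
    fix A B :: multimat assume B: "mult_det ls B \<noteq> 0"
    let ?D = "mult_det (ks @ ls) (convolve (length ks) (sum_list ls) A B)"
    let ?q = "mult_det ls B" and ?dA = "mult_det (ks @ [sum_list ls]) A"
    have pow: "pow_det ls d B = r d * ?q ^ \<epsilon> d" for d
      using pow_det_eq[of ls identity_multimat d B] q0 by (simp add: r_def P_def q0_def \<epsilon>_def field_simps)
    have "?D * pow_det ls m B ^ a = c * pow_det ls (Suc m) B ^ b * ?dA ^ e"
      by (rule c)
    then have "?D * (r m ^ a * ?q ^ (\<epsilon> m * a)) = c * (r (Suc m) ^ b * ?q ^ (\<epsilon> (Suc m) * b)) * ?dA ^ e"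
      by (simp only: pow power_mult_distrib power_mult)
    also have "\<epsilon> (Suc m) * b = \<epsilon> m * a + f"
      using exps by (simp only: mult.commute)
    finally have "(?D * r m ^ a) * ?q ^ (\<epsilon> m * a) = (c * r (Suc m) ^ b * ?dA ^ e * ?q ^ f) * ?q ^ (\<epsilon> m * a)"
      by (simp only: power_add mult_ac)
    moreover have "?q ^ (\<epsilon> m * a) \<noteq> 0" using B by simp
    ultimately have "?D * r m ^ a = c * r (Suc m) ^ b * ?dA ^ e * ?q ^ f"
      using mult_right_cancel by blast
    then show "?D = c * r (Suc m) ^ b / r m ^ a * ?dA ^ e * ?q ^ f"
      using r[of m] by (simp add: field_simps)
  qed
qed

text \<open>Both sides are polynomials along the line from the identity matrix to \<open>B\<close>, and
  $\det\partial_B$ is not identically zero on it. So the exceptional matrices are harmless.\<close>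

lemma mult_det_convolve:
  fixes ks ls :: "nat list"
  defines "f \<equiv> multinomial (sum_list (ks @ ls) + 1) (ks @ [sum_list ls + 1])"
    and "e \<equiv> length (shifted_basis ls 0)"
  obtains c :: complex where
    "\<And>A B. mult_det (ks @ ls) (convolve (length ks) (sum_list ls) A B) =
      c * mult_det (ks @ [sum_list ls]) A ^ e * mult_det ls B ^ f"
proof -
  obtain c where c: "\<And>A B. mult_det ls B \<noteq> 0 \<Longrightarrow>
      mult_det (ks @ ls) (convolve (length ks) (sum_list ls) A B) =
      c * mult_det (ks @ [sum_list ls]) A ^ e * mult_det ls B ^ f"
    using mult_det_convolve_generic[of ls ks] unfolding f_def e_def by metis
  have "mult_det (ks @ ls) (convolve (length ks) (sum_list ls) A B) =
      c * mult_det (ks @ [sum_list ls]) A ^ e * mult_det ls B ^ f" for A B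
  proof -
    let ?I = "identity_multimat" and ?conv = "convolve (length ks) (sum_list ls) A"
    define L where "L = (\<lambda>is. [:?I is, B is - ?I is:])"
    define M where "M = (\<lambda>is. [:?conv ?I is, ?conv B is - ?conv ?I is:])"
    define q where "q = mult_det ls L"
    define p where "p = mult_det (ks @ ls) M - smult (c * mult_det (ks @ [sum_list ls]) A ^ e) (q ^ f)"
    have eval: "poly (mult_det ns F) t = mult_det ns (\<lambda>is. poly (F is) t)"
      for ns t and F :: "nat list \<Rightarrow> complex poly"
      unfolding mult_det_def mult_entry_poly by (rule list_det_poly[symmetric])
    have M: "(\<lambda>is. poly (M is) t) = ?conv (\<lambda>is. poly (L is) t)" for t
      by (simp add: M_def L_def convolve_def fun_eq_iff sum.distrib sum_subtractf sum_distrib_left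
          algebra_simps)
    have L: "(\<lambda>is. poly (L is) 0) = ?I" "(\<lambda>is. poly (L is) 1) = B" by (simp_all add: L_def)
    have "poly q 0 \<noteq> 0"
      using mult_det_identity[of ls] by (auto simp: q_def eval L)
    then have "q \<noteq> 0" by auto
    have "poly (q * p) t = 0" for t
    proof (cases "poly q t = 0")
      case False
      then have "mult_det ls (\<lambda>is. poly (L is) t) \<noteq> 0" by (simp add: q_def eval)
      from c[OF this, of A] show ?thesis by (simp add: p_def q_def eval M)
    qed simp
    then have "\<forall>t. poly (q * p) t = 0" by blast
    then have "q * p = 0" by (simp only: poly_all_0_iff_0)
    with \<open>q \<noteq> 0\<close> have "poly p 1 = 0" by simp
    then show ?thesis by (simp add: p_def q_def eval M L)
  qed
  then show thesis by (rule that)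
qed

lemma sgn_of_sign: "s \<in> {1, -1 :: complex} \<Longrightarrow> sgn s = s"
  by (auto simp: sgn_minus)

text \<open>The remaining constant is found by taking identity matrices for \<open>A\<close> and \<open>B\<close>. There the three
  determinants are 1 or -1, and these are the signs that normalise the hyperdeterminants.\<close>

lemma hyperdet_convolution:
  assumes "boundary_format (k0 # ks @ [\<kappa>])" "boundary_format (\<kappa> # ls)"
  shows "hyperdet (k0 # ks @ ls) (conv (k0 # ks @ [\<kappa>]) A B) =
    hyperdet (k0 # ks @ [\<kappa>]) A ^ multinomial \<kappa> ls *
    hyperdet (\<kappa> # ls) B ^ multinomial (k0 + 1) (ks @ [\<kappa> + 1])"
proof -
  have \<kappa>: "\<kappa> = sum_list ls" and k0: "k0 = sum_list ks + sum_list ls"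
    using assms by (auto simp: boundary_format_def)
  have bf: "boundary_format (k0 # ks @ ls)" by (simp add: boundary_format_def k0)
  define e f where "e = multinomial \<kappa> ls" and "f = multinomial (k0 + 1) (ks @ [\<kappa> + 1])"
  have e: "e = length (shifted_basis ls 0)"
    unfolding e_def by (rule multinomial_eq_length_shifted_basis) (rule \<kappa>)
  obtain c where c: "\<And>A B. mult_det (ks @ ls) (convolve (length ks) (sum_list ls) A B) =
      c * mult_det (ks @ [sum_list ls]) A ^ e * mult_det ls B ^ f"
    using mult_det_convolve[of ks ls] unfolding e f_def k0 \<kappa> sum_list_append by metis
  define sA sB sC where "sA = mult_det (ks @ [\<kappa>]) (identity_multimat :: multimat)"
    and "sB = mult_det ls (identity_multimat :: multimat)"
    and "sC = mult_det (ks @ ls) (identity_multimat :: multimat)"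
  have sgn: "sgn sA = sA" "sgn sB = sB" "sgn sC = sC"
    unfolding sA_def sB_def sC_def by (rule sgn_of_sign[OF mult_det_identity])+
  have sq: "sA * sA = 1" "sB * sB = 1" "sC * sC = 1"
    unfolding sA_def sB_def sC_def using mult_det_identity[of "ks @ [\<kappa>]"]
      mult_det_identity[of ls] mult_det_identity[of "ks @ ls"] by auto
  have "sC = c * sA ^ e * sB ^ f"
    using c[of identity_multimat identity_multimat]
    by (simp only: mult_det_convolve_identity sA_def sB_def sC_def \<kappa>)
  moreover have "sA ^ e * sA ^ e = 1" "sB ^ f * sB ^ f = 1"
    by (simp_all only: power_mult_distrib[symmetric] sq power_one)
  ultimately have "sC * c = sA ^ e * sB ^ f"
    using sq(3) by (metis mult.assoc mult.commute mult_1_right)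
  moreover have "hyperdet (k0 # ks @ ls) (conv (k0 # ks @ [\<kappa>]) A B) =
      sC * (c * mult_det (ks @ [\<kappa>]) A ^ e * mult_det ls B ^ f)"
    unfolding hyperdet_def det_boundary_map[OF bf] list.sel conv_eq_convolve sC_def[symmetric] sgn
    using c[of A B] by (simp only: \<kappa>)
  moreover have "hyperdet (k0 # ks @ [\<kappa>]) A = sA * mult_det (ks @ [\<kappa>]) A"
    unfolding hyperdet_def det_boundary_map[OF assms(1)] list.sel sA_def[symmetric] sgn ..
  moreover have "hyperdet (\<kappa> # ls) B = sB * mult_det ls B"
    unfolding hyperdet_def det_boundary_map[OF assms(2)] list.sel sB_def[symmetric] sgn ..
  ultimately show ?thesis
    unfolding e_def[symmetric] f_def[symmetric]
    by (simp only: power_mult_distrib mult.assoc[symmetric]) (simp only: mult_ac)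
qed

section \<open>Nondegeneracy of a convolution\<close>

text \<open>As a map, $A * B$ is \<open>A\<close> with the value of \<open>B\<close> inserted as the last argument.\<close>

lemma apply_map_convolution:
  assumes "length vs = length ks" "length ws = length ls"
  shows "apply_map (k0 # ks @ ls) (conv (k0 # ks @ [\<kappa>]) A B) (vs @ ws) i =
    apply_map (k0 # ks @ [\<kappa>]) A (vs @ [vec (\<kappa> + 1) (apply_map (\<kappa> # ls) B ws)]) i"
proof -
  have prod_append: "(\<Prod>r<length (ks @ ns). (vs @ us) ! r $ ((is @ js) ! r)) =
      (\<Prod>r<length ks. vs ! r $ (is ! r)) * (\<Prod>r<length ns. us ! r $ (js ! r))"
    if "length is = length ks" for "is" js :: "nat list" and us :: "complex vec list" and ns :: "nat list"
  proof -
    have "(\<Prod>r<length (ks @ ns). (vs @ us) ! r $ ((is @ js) ! r)) =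
        (\<Prod>r<length ks. (vs @ us) ! r $ ((is @ js) ! r)) *
        (\<Prod>r<length ns. (vs @ us) ! (length ks + r) $ ((is @ js) ! (length ks + r)))"
    proof -
      have "(\<Prod>r<a + b. g r) = (\<Prod>r<a. g r) * (\<Prod>r<b. g (a + r))" for a b and g :: "nat \<Rightarrow> complex"
        by (induction b) (simp_all add: mult.assoc)
      then show ?thesis by (simp only: length_append)
    qed
    also have "\<dots> = (\<Prod>r<length ks. vs ! r $ (is ! r)) * (\<Prod>r<length ns. us ! r $ (js ! r))"
      using that assms(1) by (intro arg_cong2[of _ _ _ _ "(*)"] prod.cong refl) (auto simp: nth_append)
    finally show ?thesis .
  qed
  have sum_append: "(\<Sum>xs\<in>indices (ks @ ns). g xs) = (\<Sum>is\<in>indices ks. \<Sum>js\<in>indices ns. g (is @ js))"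
    for ns and g :: "nat list \<Rightarrow> complex"
  proof -
    have "inj_on (\<lambda>(is, js). is @ js) (indices ks \<times> indices ns)"
      by (auto simp: inj_on_def indices_def)
    then show ?thesis
      unfolding indices_append by (simp add: sum.reindex sum.cartesian_product case_prod_unfold)
  qed
  let ?v = "\<lambda>is. \<Prod>r<length ks. vs ! r $ (is ! r)"
  let ?w = "\<lambda>js. \<Prod>r<length ls. ws ! r $ (js ! r)"
  have len: "length is = length ks" if "is \<in> indices ks" for "is" using that by (simp add: indices_def)
  have "apply_map (k0 # ks @ ls) (conv (k0 # ks @ [\<kappa>]) A B) (vs @ ws) i =
      (\<Sum>is\<in>indices ks. \<Sum>js\<in>indices ls. (\<Sum>h\<le>\<kappa>. A (i # is @ [h]) * B (h # js)) * (?v is * ?w js))"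
    unfolding apply_map_def list.sel sum_append conv_eq_convolve
    by (intro sum.cong refl) (simp only: convolve_apply len prod_append)
  also have "\<dots> = (\<Sum>is\<in>indices ks. \<Sum>js\<in>indices ls. \<Sum>h\<le>\<kappa>. A (i # is @ [h]) * ?v is * (B (h # js) * ?w js))"
    by (intro sum.cong refl, unfold sum_distrib_right, intro sum.cong refl) (simp only: mult_ac)
  also have "\<dots> = (\<Sum>is\<in>indices ks. \<Sum>h\<le>\<kappa>. \<Sum>js\<in>indices ls. A (i # is @ [h]) * ?v is * (B (h # js) * ?w js))"
    by (intro sum.cong refl, rule sum.swap)
  also have "\<dots> = (\<Sum>is\<in>indices ks. \<Sum>h\<le>\<kappa>. A (i # is @ [h]) * ?v is * apply_map (\<kappa> # ls) B ws h)"
    by (simp only: apply_map_def list.sel sum_distrib_left)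
  also have "\<dots> = (\<Sum>is\<in>indices ks. \<Sum>js\<in>indices [\<kappa>]. A (i # is @ js) *
      (?v is * (\<Prod>r<length [\<kappa>]. [vec (\<kappa> + 1) (apply_map (\<kappa> # ls) B ws)] ! r $ (js ! r))))"
  proof (intro sum.cong refl)
    fix "is"
    show "(\<Sum>h\<le>\<kappa>. A (i # is @ [h]) * ?v is * apply_map (\<kappa> # ls) B ws h) =
        (\<Sum>js\<in>indices [\<kappa>]. A (i # is @ js) *
        (?v is * (\<Prod>r<length [\<kappa>]. [vec (\<kappa> + 1) (apply_map (\<kappa> # ls) B ws)] ! r $ (js ! r))))"
      unfolding indices_singleton
      by (subst sum.reindex) (auto simp: inj_on_def mult.assoc intro!: sum.cong)
  qed
  also have "\<dots> = apply_map (k0 # ks @ [\<kappa>]) A (vs @ [vec (\<kappa> + 1) (apply_map (\<kappa> # ls) B ws)]) i"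
    unfolding apply_map_def list.sel sum_append
    by (intro sum.cong refl) (simp only: len prod_append)
  finally show ?thesis .
qed

lemma nondegenerate_convolution:
  assumes A: "nondegenerate (k0 # ks @ [\<kappa>]) A" and B: "nondegenerate (\<kappa> # ls) B"
  shows "nondegenerate (k0 # ks @ ls) (conv (k0 # ks @ [\<kappa>]) A B)"
proof
  assume "degenerate (k0 # ks @ ls) (conv (k0 # ks @ [\<kappa>]) A B)"
  then obtain us where us: "length us = length (ks @ ls)"
    "\<And>r. r < length (ks @ ls) \<Longrightarrow> us ! r \<in> carrier_vec ((ks @ ls) ! r + 1) \<and> us ! r \<noteq> 0\<^sub>v ((ks @ ls) ! r + 1)"
    "\<And>i. i \<le> k0 \<Longrightarrow> apply_map (k0 # ks @ ls) (conv (k0 # ks @ [\<kappa>]) A B) us i = 0"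
    by (auto simp: degenerate_def)
  define vs ws where "vs = take (length ks) us" and "ws = drop (length ks) us"
  have len: "length vs = length ks" "length ws = length ls" and us_eq: "us = vs @ ws"
    using us(1) by (simp_all add: vs_def ws_def)
  have vs: "vs ! r \<in> carrier_vec (ks ! r + 1) \<and> vs ! r \<noteq> 0\<^sub>v (ks ! r + 1)" if "r < length ks" for r
    using us(2)[of r] that len by (simp add: us_eq nth_append)
  have ws: "ws ! r \<in> carrier_vec (ls ! r + 1) \<and> ws ! r \<noteq> 0\<^sub>v (ls ! r + 1)" if "r < length ls" for r
    using us(2)[of "length ks + r"] that len by (simp add: us_eq nth_append)
  define u where "u = vec (\<kappa> + 1) (apply_map (\<kappa> # ls) B ws)"
  have "\<exists>h\<le>\<kappa>. apply_map (\<kappa> # ls) B ws h \<noteq> 0"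
    using B ws len unfolding degenerate_def by auto
  then obtain h where h: "h \<le> \<kappa>" "apply_map (\<kappa> # ls) B ws h \<noteq> 0" by blast
  have "u \<noteq> 0\<^sub>v (\<kappa> + 1)"
  proof
    assume "u = 0\<^sub>v (\<kappa> + 1)"
    then have "u $ h = 0" using h(1) by simp
    then show False using h by (simp add: u_def)
  qed
  moreover have "u \<in> carrier_vec (\<kappa> + 1)" by (simp add: u_def)
  ultimately have carrier: "(vs @ [u]) ! r \<in> carrier_vec ((ks @ [\<kappa>]) ! r + 1) \<and> (vs @ [u]) ! r \<noteq> 0\<^sub>v ((ks @ [\<kappa>]) ! r + 1)"
    if "r < length (ks @ [\<kappa>])" for r
    using vs len that by (cases "r < length ks") (auto simp: nth_append less_Suc_eq)
  have "apply_map (k0 # ks @ [\<kappa>]) A (vs @ [u]) i = 0" if "i \<le> k0" for i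
    using us(3)[OF that] unfolding us_eq apply_map_convolution[OF len] u_def .
  with carrier len have "degenerate (k0 # ks @ [\<kappa>]) A"
    unfolding degenerate_def list.sel by (intro exI[of _ "vs @ [u]"]) simp
  with A show False by contradiction
qed

theorem theorem4p2:
  fixes p q :: nat and k l :: "nat list" and A B :: multimat
  assumes "p \<ge> 1"
    and "length k = p + 1" and "length l = q + 1"
    and "l ! 0 = k ! p"
    and "boundary_format k" and "boundary_format l"
    and "nondegenerate k A" and "nondegenerate l B"
  shows "nondegenerate (conv_format k l) (conv k A B) \<and>
    hyperdet (conv_format k l) (conv k A B) =
      hyperdet k A ^ multinomial (l ! 0) (tl l) *
      hyperdet l B ^ multinomial (k ! 0 + 1) (butlast (tl k) @ [k ! p + 1])"
proof -
  obtain k0 ks' where k': "k = k0 # ks'" using assms(2) by (cases k) auto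
  with assms have "ks' \<noteq> []" by auto
  then obtain ks \<kappa> where "ks' = ks @ [\<kappa>]" by (cases ks' rule: rev_cases) auto
  with k' have k: "k = k0 # ks @ [\<kappa>]" by simp
  have "p = Suc (length ks)" using assms(2) by (simp add: k)
  then have kp: "k ! p = \<kappa>" by (simp add: k)
  obtain ls where l: "l = \<kappa> # ls" using assms(3,4) kp by (cases l) auto
  have "conv_format k l = k0 # ks @ ls" by (simp add: conv_format_def k l)
  moreover have "butlast (tl k) = ks" "k ! 0 = k0" "l ! 0 = \<kappa>" "tl l = ls" by (simp_all add: k l)
  moreover have "nondegenerate (k0 # ks @ ls) (conv k A B)"
    using assms(7,8) unfolding k l by (rule nondegenerate_convolution)
  moreover have "hyperdet (k0 # ks @ ls) (conv k A B) =
      hyperdet k A ^ multinomial \<kappa> ls * hyperdet l B ^ multinomial (k0 + 1) (ks @ [\<kappa> + 1])"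
    using assms(5,6) unfolding k l by (rule hyperdet_convolution)
  ultimately show ?thesis by (simp only: kp not_False_eq_True simp_thms)
qed

end
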